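(* On the round sphere $\mathbb S^n$, for all integers $N\ge1$, the $Q$-curvature polynomial is given by $$Q_{2N}^{res}(\lambda) = (-1)^{N-1}\,\prod_{j=0}^{N-1}\left(\tfrac n2-j\right)\;\lambda\;\prod_{j=1}^{N-1}(\lambda-N-j).$$
   Context: Let $h$ be the round metric of curvature $1$ on $\mathbb S^n$. The associated Poincaré-Einstein metric is $g_+=r^{-2}(dr^2+h_r)$ with $h_r=(1-r^2/4)^2h$ on $\mathbb S^n\times(0,\varepsilon)$. The holographic coefficients $v_{2j}$ are defined by $v(r)=\mathrm{dvol}(h_r)/\mathrm{dvol}(h)=\sum_{j\ge0}v_{2j}r^{2j}$. All Laplacians are non-positive. For $f\in C^\infty(\mathbb S^n)$ and generic $\lambda\in\mathbb C$, there are unique coefficients $\mathcal T_{2j}(\lambda)f$, $j\ge0$, with $\mathcal T_0(\lambda)=\mathrm{Id}$ such that $u=\sum_{j\ge0}r^{\lambda+2j}\,\mathcal T_{2j}(\lambda)f$ is a formal solution of $-\Delta_{g_+}u=\lambda(n-\lambda)u$. The $\mathcal T_{2j}(\lambda)$ are differential operators on $\mathbb S^n$, rational in $\lambda$, and $\mathcal T_{2j}^*(\lambda)$ is the formal adjoint with respect to $\mathrm{dvol}(h)$ and the bilinear pairing $\int fg\,\mathrm{dvol}(h)$. The $Q$-curvature polynomial is $$Q_{2N}^{res}(\lambda) = -2^{2N}N!\left(\lambda+\tfrac n2-2N+1\right)\cdots\left(\lambda+\tfrac n2-N\right)\sum_{j=0}^N\mathcal T_{2j}^*(\lambda+n-2N)(v_{2N-2j}),$$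 where the prefactor contains the $N$ consecutive factors $\lambda+\frac n2-2N+k$, $k=1,\dots,N$. Empty products equal $1$. *)

theory Defs
  imports
    "HOL-Analysis.Analysis"
    "HOL-Library.Landau_Symbols"
    "HOL-Computational_Algebra.Polynomial"
begin

section \<open>Calculus in local coordinates\<close>

definition partial :: "'m::finite \<Rightarrow> (real^'m \<Rightarrow> 'b::real_normed_vector) \<Rightarrow> real^'m \<Rightarrow> 'b" where
  "partial i F x = frechet_derivative F (at x) (axis i 1)"

text \<open>Functions of class \<open>C\<^sup>k\<close> on the whole coordinate space.\<close>

primrec C_k :: "nat \<Rightarrow> (real^'m::finite \<Rightarrow> complex) \<Rightarrow> bool" where
  "C_k 0 F \<longleftrightarrow> continuous_on UNIV F"
| "C_k (Suc k) F \<longleftrightarrow> (\<forall>x. F differentiable (at x)) \<and> (\<forall>i. C_k k (partial i F))"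

text \<open>The (non-positive) Laplacian
  \<open>1 / sqrt (det G) \<Sum>\<^sub>i \<partial>\<^sub>i (sqrt (det G) \<Sum>\<^sub>j G\<^sup>i\<^sup>j \<partial>\<^sub>j u)\<close>
  of the Riemannian metric with coefficient matrix \<open>G\<close>.\<close>

definition laplace_beltrami ::
    "(real^'m::finite \<Rightarrow> real^'m^'m) \<Rightarrow> (real^'m \<Rightarrow> complex) \<Rightarrow> real^'m \<Rightarrow> complex" where
  "laplace_beltrami G u x =
     (\<Sum>i\<in>UNIV. partial i
        (\<lambda>y. \<Sum>j\<in>UNIV. (sqrt (det (G y)) * matrix_inv (G y) $ i $ j) *\<^sub>R partial j u y) x)
     /\<^sub>R sqrt (det (G x))"

section \<open>The round sphere\<close>

text \<open>The unit sphere of \<open>\<real>\<^sup>n \<times> \<real>\<close>, where \<open>n = CARD('n) \<ge> 1\<close>.\<close>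

typedef ('n::finite) usphere = "sphere (0 :: (real^'n) \<times> real) 1"
  by (rule exI[of _ "(0, 1)"]) simp

text \<open>Inverse stereographic projections from the north pole (\<open>s = 1\<close>) and from the south pole
  (\<open>s = -1\<close>). Only these two values of \<open>s\<close> are used; the two parametrizations form an atlas.\<close>

definition stereo :: "real \<Rightarrow> real^'n::finite \<Rightarrow> 'n usphere" where
  "stereo s x = Abs_usphere
     ((2 / (1 + (norm x)\<^sup>2)) *\<^sub>R x, s * ((norm x)\<^sup>2 - 1) / (1 + (norm x)\<^sup>2))"

definition smooth_on_sphere :: "('n::finite usphere \<Rightarrow> complex) set" where
  "smooth_on_sphere = {f. \<forall>s\<in>{1, -1}. \<forall>k. C_k k (\<lambda>x. f (stereo s x))}"

text \<open>The metric induced by the Euclidean metric, in the chart \<open>s\<close>.\<close>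

definition round_metric :: "real \<Rightarrow> real^'n::finite \<Rightarrow> real^'n^'n" where
  "round_metric s x =
     (\<chi> i j. inner (partial i (\<lambda>y. Rep_usphere (stereo s y)) x)
                  (partial j (\<lambda>y. Rep_usphere (stereo s y)) x))"

text \<open>The integral against \<open>dvol(h)\<close>. The chart \<open>s = 1\<close> omits a single point, which is a null set.\<close>

definition sphere_integral :: "('n::finite usphere \<Rightarrow> complex) \<Rightarrow> complex" where
  "sphere_integral F =
     (LINT x|lborel. sqrt (det (round_metric 1 x)) *\<^sub>R F (stereo 1 x))"

definition formal_adjoint ::
    "(('n::finite usphere \<Rightarrow> complex) \<Rightarrow> ('n usphere \<Rightarrow> complex))
     \<Rightarrow> ('n usphere \<Rightarrow> complex) \<Rightarrow> ('n usphere \<Rightarrow> complex)" where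
  "formal_adjoint A g =
     (THE b. b \<in> smooth_on_sphere \<and>
        (\<forall>f\<in>smooth_on_sphere.
           sphere_integral (\<lambda>p. A f p * g p) = sphere_integral (\<lambda>p. f p * b p)))"

section \<open>The Poincare-Einstein metric\<close>

definition h_metric :: "real \<Rightarrow> real \<Rightarrow> real^'n::finite \<Rightarrow> real^'n^'n" where
  "h_metric s r x = (1 - r\<^sup>2 / 4)\<^sup>2 *\<^sub>R round_metric s x"

text \<open>Coordinates on the product of a chart of the sphere with an \<open>r\<close>-interval are indexed by
  \<open>'n option\<close>: the index \<open>None\<close> is the variable \<open>r\<close>, the indices \<open>Some i\<close> are those of the
  chart.\<close>

definition r_coord :: "real^('n::finite option) \<Rightarrow> real" where
  "r_coord y = y $ None"

definition x_coord :: "real^('n::finite option) \<Rightarrow> real^'n" where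
  "x_coord y = (\<chi> i. y $ Some i)"

definition collar_point :: "real^'n::finite \<Rightarrow> real \<Rightarrow> real^('n option)" where
  "collar_point x r = (\<chi> a. case a of None \<Rightarrow> r | Some i \<Rightarrow> x $ i)"

definition g_plus :: "real \<Rightarrow> real^('n::finite option) \<Rightarrow> real^('n option)^('n option)" where
  "g_plus s y =
     (\<chi> a b. (case (a, b) of
                 (None, None) \<Rightarrow> 1
               | (Some i, Some j) \<Rightarrow> h_metric s (r_coord y) (x_coord y) $ i $ j
               | _ \<Rightarrow> 0) / (r_coord y)\<^sup>2)"

definition laplace_g_plus ::
    "real \<Rightarrow> ('n::finite usphere \<Rightarrow> real \<Rightarrow> complex) \<Rightarrow> real^'n \<Rightarrow> real \<Rightarrow> complex" where
  "laplace_g_plus s u x r =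
     laplace_beltrami (g_plus s) (\<lambda>y. u (stereo s (x_coord y)) (r_coord y)) (collar_point x r)"

text \<open>\<open>holographic_coeff k\<close> is \<open>v\<^sub>2\<^sub>k\<close>, the coefficient of \<open>r\<^sup>2\<^sup>k\<close> in \<open>dvol(h\<^sub>r)/dvol(h)\<close>.\<close>

definition holographic_coeff :: "nat \<Rightarrow> 'n::finite usphere \<Rightarrow> real" where
  "holographic_coeff =
     (THE w. \<exists>\<epsilon>>0. \<forall>s\<in>{1, -1}. \<forall>x. \<forall>r\<in>{0<..<\<epsilon>}.
        (\<lambda>k. w k (stereo s x) * r ^ (2 * k)) sums
          (sqrt (det (h_metric s r x)) / sqrt (det (round_metric s x))))"

section \<open>Formal eigenfunctions\<close>

definition partial_sol ::
    "complex \<Rightarrow> (nat \<Rightarrow> 'n::finite usphere \<Rightarrow> complex) \<Rightarrow> nat \<Rightarrow> 'n usphere \<Rightarrow> real \<Rightarrow> complex" where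
  "partial_sol \<mu> a M p r =
     (\<Sum>j\<le>M. complex_of_real r powr (\<mu> + 2 * of_nat j) * a j p)"

text \<open>\<open>\<Sum>\<^sub>j r\<^sup>\<mu>\<^sup>+\<^sup>2\<^sup>j a\<^sub>j\<close> solves \<open>- \<Delta> u = \<mu> (n - \<mu>) u\<close> formally and has leading coefficient \<open>f\<close>.
  After division by \<open>r\<^sup>\<mu>\<close>, the equation is one between power series in \<open>r\<^sup>2\<close> whose coefficients
  up to \<open>r\<^sup>2\<^sup>M\<close> only involve \<open>a\<^sub>0, \<dots>, a\<^sub>M\<close>. Hence all of them vanish iff, for each \<open>M\<close>, the
  \<open>M\<close>-th partial sum satisfies the equation up to \<open>O(r\<^sup>\<mu>\<^sup>+\<^sup>2\<^sup>M\<^sup>+\<^sup>2)\<close>.\<close>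

definition formal_solution ::
    "complex \<Rightarrow> ('n::finite usphere \<Rightarrow> complex) \<Rightarrow> (nat \<Rightarrow> 'n usphere \<Rightarrow> complex) \<Rightarrow> bool" where
  "formal_solution \<mu> f a \<longleftrightarrow>
     a 0 = f \<and> (\<forall>j. a j \<in> smooth_on_sphere) \<and>
     (\<forall>M. \<forall>s\<in>{1, -1}. \<forall>x.
        (\<lambda>r. - laplace_g_plus s (partial_sol \<mu> a M) x r
              - \<mu> * (of_nat CARD('n) - \<mu>) * partial_sol \<mu> a M (stereo s x) r)
        \<in> O[at_right 0](\<lambda>r. complex_of_real r powr (\<mu> + 2 * of_nat M + 2)))"

text \<open>The indicial exponents are \<open>\<mu>\<close> and \<open>n - \<mu>\<close>; \<open>\<mu>\<close> is generic if \<open>n - \<mu>\<close> is none of the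
  exponents \<open>\<mu> + 2 j\<close>, \<open>j \<ge> 1\<close>, of the expansion.\<close>

definition generic :: "nat \<Rightarrow> complex \<Rightarrow> bool" where
  "generic n \<mu> \<longleftrightarrow> (\<forall>j\<ge>1. \<mu> + 2 * of_nat j \<noteq> of_nat n - \<mu>)"

text \<open>\<open>T_op j \<mu>\<close> is \<open>\<T>\<^sub>2\<^sub>j(\<mu>)\<close>, for generic \<open>\<mu>\<close>.\<close>

definition T_op ::
    "nat \<Rightarrow> complex \<Rightarrow> ('n::finite usphere \<Rightarrow> complex) \<Rightarrow> 'n usphere \<Rightarrow> complex" where
  "T_op j \<mu> f = (THE a. formal_solution \<mu> f a) j"

section \<open>The Q-curvature polynomial\<close>

text \<open>The defining formula is meaningful where \<open>\<lambda> + n - 2N\<close> is generic, that is, off a countable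
  set. Its value at a point \<open>p\<close> of the sphere is there a polynomial in \<open>\<lambda>\<close>, which is the value of
  the Q-curvature polynomial at \<open>p\<close>.\<close>

definition Q_res :: "nat \<Rightarrow> 'n::finite usphere \<Rightarrow> complex poly" where
  "Q_res N p = (THE q. \<forall>l. generic CARD('n) (l + of_nat CARD('n) - 2 * of_nat N) \<longrightarrow>
     poly q l =
       - (2 ^ (2 * N)) * fact N
       * (\<Prod>k=1..N. l + of_nat CARD('n) / 2 - 2 * of_nat N + of_nat k)
       * (\<Sum>j=0..N. formal_adjoint (T_op j (l + of_nat CARD('n) - 2 * of_nat N))
                      (\<lambda>p'. complex_of_real (holographic_coeff (N - j) p')) p))"

end

theory Submission
  imports
    Defs
    "HOL-Complex_Analysis.Cauchy_Integral_Formula"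
    "HOL-Probability.Sinc_Integral"
    "HOL-Computational_Algebra.Formal_Power_Series"
begin

text \<open>
  The holographic coefficients of the sphere are constant, since \<open>v(r) = (1 - r\<^sup>2/4)\<^sup>n\<close>. Hence the
  polynomial only sees the adjoints of the operators \<open>\<T>\<^sub>2\<^sub>j(\<mu>)\<close> on constants, with
  \<open>\<mu> = \<lambda> + n - 2N\<close>, and the statement splits into a geometric part, which identifies
  \<open>\<T>\<^sub>2\<^sub>j\<^sup>*(\<mu>)(1)\<close>, and a hypergeometric summation.

  For the geometric part, \<open>\<Delta>\<close> of \<open>r\<^sup>\<nu> a(x)\<close> for the metric \<open>g\<^sub>+\<close> is computed in the stereographic
  charts, where \<open>h\<close> is conformally flat (\<open>laplace_g_plus_partial_sol\<close>). After multiplication by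
  \<open>(1 - r\<^sup>2/4)\<^sup>2\<close> the eigenvalue equation becomes a three-term recursion for the coefficients
  \<open>a\<^sub>j = \<T>\<^sub>2\<^sub>j(\<mu>) f\<close> that involves the Laplacian of the sphere and is uniquely solvable for generic
  \<open>\<mu>\<close> (\<open>T_op_eq_frobenius_sol\<close>). That the two charts give the same Laplacian is its invariance
  under inversion in the unit sphere of the chart (\<open>chart_lap_inversion\<close>). The Laplacian of a smooth
  function has integral \<open>0\<close> (\<open>sphere_integral_lap\<close>), so integrating the recursion gives
  \<open>\<integral> \<T>\<^sub>2\<^sub>j(\<mu>) f = c\<^sub>j \<integral> f\<close>, where \<open>c\<^sub>j\<close> obeys the same recursion without Laplacian; that
  is, \<open>\<T>\<^sub>2\<^sub>j\<^sup>*(\<mu>)(1) = c\<^sub>j\<close> (\<open>formal_adjoint_const\<close>). The recursion factors through a two-term one,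
  whose solution is
  \<open>c\<^sub>j = (\<mu>)\<^sub>j (n/2)\<^sub>j / (j! 4\<^sup>j (\<mu> - n/2 + 1)\<^sub>j)\<close>. Equivalently, the rotationally
  invariant eigenfunction is \<open>r\<^sup>\<mu> F(\<mu>, n/2; \<mu> - n/2 + 1; r\<^sup>2/4)\<close>.

  The sum in the definition of the polynomial is therefore the coefficient of \<open>r\<^sup>2\<^sup>N\<close> in
  \<open>(1 - r\<^sup>2/4)\<^sup>n F(\<mu>, n/2; \<mu> - n/2 + 1; r\<^sup>2/4)\<close>. Euler's transformation absorbs \<open>n - 1\<close> of the
  \<open>n\<close> factors and turns the series into \<open>(1 - s) F(1 - n/2, \<mu> + 1 - n; \<mu> - n/2 + 1; s)\<close> with
  \<open>s = r\<^sup>2/4\<close> (\<open>euler_transformation\<close>). Its \<open>N\<close>-th coefficient is a difference of two consecutive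
  hypergeometric coefficients, in which the factor \<open>- (n/2) \<lambda>\<close> appears and the denominator
  \<open>(\<mu> - n/2 + 1)\<^sub>N\<close> cancels against the prefactor of the polynomial (\<open>Q_value\<close>).
\<close>

section \<open>Partial derivatives and functions of class \<open>C\<^sup>k\<close>\<close>

lemma frechet_derivative_worksI:
  "F differentiable (at x) \<Longrightarrow> (F has_derivative frechet_derivative F (at x)) (at x)"
  by (simp add: frechet_derivative_works)

lemma partial_eq:
  assumes "(F has_derivative D) (at x)"
  shows "partial i F x = D (axis i 1)"
  using frechet_derivative_at[OF assms] by (simp add: partial_def)

lemma partial_cong:
  assumes "\<forall>\<^sub>F y in nhds x. F y = G y"
  shows "partial i F x = partial i G x"
proof -
  have "(F has_derivative D) (at x) \<longleftrightarrow> (G has_derivative D) (at x)" for D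
  proof -
    obtain S where "open S" "x \<in> S" "\<And>y. y \<in> S \<Longrightarrow> F y = G y"
      using assms by (auto simp: eventually_nhds)
    then show ?thesis
      using has_derivative_transform_within_open[of F D x UNIV S G]
        has_derivative_transform_within_open[of G D x UNIV S F] by auto
  qed
  then show ?thesis
    by (simp add: partial_def frechet_derivative_def)
qed

lemma partial_const [simp]: "partial i (\<lambda>_. c) x = 0"
  using partial_eq[OF has_derivative_const] by auto

lemma partial_add:
  assumes "F differentiable at x" "G differentiable at x"
  shows "partial i (\<lambda>y. F y + G y) x = partial i F x + partial i G x"
  using partial_eq[OF has_derivative_add[OF frechet_derivative_worksI[OF assms(1)] frechet_derivative_worksI[OF assms(2)]]]
  by (simp add: partial_def)

lemma partial_mult:
  fixes F G :: "real^'m::finite \<Rightarrow> 'b::real_normed_algebra"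
  assumes "F differentiable at x" "G differentiable at x"
  shows "partial i (\<lambda>y. F y * G y) x = F x * partial i G x + partial i F x * G x"
  using partial_eq[OF has_derivative_mult[OF frechet_derivative_worksI[OF assms(1)] frechet_derivative_worksI[OF assms(2)]]]
  by (simp add: partial_def)

lemma partial_bounded_linear:
  assumes "bounded_linear h" "F differentiable at x"
  shows "partial i (\<lambda>y. h (F y)) x = h (partial i F x)"
  using partial_eq[OF bounded_linear.has_derivative[OF assms(1) frechet_derivative_worksI[OF assms(2)]]]
  by (simp add: partial_def)

lemma partial_sum:
  assumes "finite J" "\<And>j. j \<in> J \<Longrightarrow> F j differentiable at x"
  shows "partial i (\<lambda>y. \<Sum>j\<in>J. F j y) x = (\<Sum>j\<in>J. partial i (F j) x)"
proof -
  have "((\<lambda>y. \<Sum>j\<in>J. F j y) has_derivative (\<lambda>h. \<Sum>j\<in>J. frechet_derivative (F j) (at x) h)) (at x)"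
    by (intro has_derivative_sum frechet_derivative_worksI assms)
  from partial_eq[OF this] show ?thesis by (simp add: partial_def)
qed

lemma partial_of_real_coord:
  fixes x :: "real^'m::finite"
  shows "partial i (\<lambda>y. complex_of_real (y $ k)) x = (if i = k then 1 else 0)"
proof -
  have "((\<lambda>y::real^'m. complex_of_real (y $ k)) has_derivative (\<lambda>h. complex_of_real (h $ k))) (at x)"
    by (intro bounded_linear.has_derivative[OF bounded_linear_of_real] bounded_linear_imp_has_derivative)
       (rule bounded_linear_vec_nth)
  from partial_eq[OF this, of i] show ?thesis by (simp add: axis_def)
qed

lemma differentiable_of_real_coord [simp]:
  "(\<lambda>y. complex_of_real (y $ k)) differentiable at x"
  by (rule bounded_linear_imp_differentiable)
     (intro bounded_linear_compose[OF bounded_linear_of_real] bounded_linear_vec_nth)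

lemma C_k_partial: "C_k (Suc k) F \<Longrightarrow> C_k k (partial i F)"
  by simp

lemma C_k_continuous: "C_k k F \<Longrightarrow> continuous_on UNIV F"
  by (cases k) (auto simp: continuous_on_eq_continuous_at intro: differentiable_imp_continuous_within)

text \<open>The recursion defining \<open>C_k\<close> passes to partial derivatives, so monotonicity in \<open>k\<close> goes down
  to the fact that differentiable functions are continuous.\<close>
lemma C_k_Suc_imp: "C_k (Suc k) F \<Longrightarrow> C_k k F"
proof (induction k arbitrary: F)
  case 0
  then show ?case using C_k_continuous by (metis C_k.simps(1))
next
  case (Suc k)
  then show ?case by (metis C_k.simps(2))
qed

lemma C_k_const: "C_k k (\<lambda>_. c)"
proof (induction k arbitrary: c)
  case (Suc k)
  have "partial i (\<lambda>_. c) = (\<lambda>_. 0)" for i :: 'a by auto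
  with Suc show ?case by simp
qed simp

lemma C_k_of_real_coord: "C_k k (\<lambda>y. complex_of_real (y $ i))"
proof (cases k)
  case 0
  then show ?thesis by (auto intro!: continuous_intros)
next
  case (Suc k)
  have "partial j (\<lambda>y. complex_of_real (y $ i)) = (\<lambda>_. if j = i then 1 else 0)" for j
    by (auto simp: partial_of_real_coord)
  with Suc show ?thesis by (simp add: C_k_const)
qed

lemma C_k_add: "C_k k F \<Longrightarrow> C_k k G \<Longrightarrow> C_k k (\<lambda>y. F y + G y)"
proof (induction k arbitrary: F G)
  case 0
  then show ?case by (auto intro: continuous_on_add)
next
  case (Suc k)
  have "partial i (\<lambda>y. F y + G y) = (\<lambda>y. partial i F y + partial i G y)" for i
    using Suc.prems by (auto simp: partial_add)
  with Suc show ?case by simp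
qed

lemma C_k_mult: "C_k k F \<Longrightarrow> C_k k G \<Longrightarrow> C_k k (\<lambda>y. F y * G y)"
proof (induction k arbitrary: F G)
  case 0
  then show ?case by (auto intro: continuous_on_mult)
next
  case (Suc k)
  have "partial i (\<lambda>y. F y * G y) = (\<lambda>y. F y * partial i G y + partial i F y * G y)" for i
    using Suc.prems by (auto simp: partial_mult)
  moreover have "C_k k F" "C_k k G"
    using Suc.prems C_k_Suc_imp by blast+
  ultimately show ?case using Suc by (simp add: C_k_add)
qed

lemma C_k_cnj: "C_k k F \<Longrightarrow> C_k k (\<lambda>y. cnj (F y))"
proof (induction k arbitrary: F)
  case 0
  then show ?case by (auto intro: continuous_intros)
next
  case (Suc k)
  have "partial i (\<lambda>y. cnj (F y)) = (\<lambda>y. cnj (partial i F y))" for i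
    using Suc.prems by (auto simp: partial_bounded_linear[OF bounded_linear_cnj])
  moreover have "(\<lambda>y. cnj (F y)) differentiable at x" for x
    using Suc.prems bounded_linear.has_derivative[OF bounded_linear_cnj]
    unfolding differentiable_def C_k.simps by blast
  ultimately show ?case using Suc by simp
qed

lemma C_k_sum: "finite J \<Longrightarrow> (\<And>j. j \<in> J \<Longrightarrow> C_k k (F j)) \<Longrightarrow> C_k k (\<lambda>y. \<Sum>j\<in>J. F j y)"
  by (induction J rule: finite_induct) (auto simp: C_k_const C_k_add)

section \<open>Stereographic charts and the round metric\<close>

text \<open>The round metric in a stereographic chart is the Euclidean metric divided by the square of this
  function.\<close>
definition inv_conf :: "real^'m::finite \<Rightarrow> real" where
  "inv_conf x = (1 + (norm x)\<^sup>2) / 2"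

lemma norm_sq_sum: "(norm x)\<^sup>2 = (\<Sum>i\<in>UNIV. (x $ i)\<^sup>2)" for x :: "real^'m::finite"
  by (simp add: norm_vec_def L2_set_def sum_nonneg)

lemma C_k_inv_conf: "C_k k (\<lambda>x. complex_of_real (inv_conf x))"
proof -
  have *: "(\<lambda>x::real^'a. complex_of_real (inv_conf x)) =
     (\<lambda>x. (1/2) * (1 + (\<Sum>i\<in>UNIV. complex_of_real (x $ i) * complex_of_real (x $ i))))"
    unfolding inv_conf_def norm_sq_sum by (simp add: power2_eq_square)
  show ?thesis unfolding *
    by (intro C_k_mult C_k_add C_k_sum C_k_const C_k_of_real_coord) auto
qed

lemma inv_conf_pos [simp]: "inv_conf x > 0"
  by (simp add: inv_conf_def add_pos_nonneg)

lemma inv_conf_nonzero [simp]: "inv_conf x \<noteq> 0"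
  using inv_conf_pos[of x] by linarith

lemma one_plus_norm_sq: "1 + (norm x)\<^sup>2 = 2 * inv_conf x"
  by (simp add: inv_conf_def)

lemma norm_sq_inv_conf: "(norm x)\<^sup>2 = 2 * inv_conf x - 1"
  by (simp add: inv_conf_def field_simps)

lemma stereo_norm_identity:
  "q \<noteq> 0 \<Longrightarrow> (2 * q - 1) / q\<^sup>2 + (1 - 1 / q)\<^sup>2 = 1" for q :: real
  by (simp add: power2_eq_square divide_simps) (simp add: algebra_simps)

lemma stereo_inv_conf:
  "stereo s x = Abs_usphere (x /\<^sub>R inv_conf x, s * (1 - 1 / inv_conf x))"
proof -
  have "2 / (1 + (norm x)\<^sup>2) = inverse (inv_conf x)"
    "s * ((norm x)\<^sup>2 - 1) / (1 + (norm x)\<^sup>2) = s * (1 - 1 / inv_conf x)"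
    unfolding one_plus_norm_sq norm_sq_inv_conf by (simp_all add: field_simps)
  then show ?thesis by (simp only: stereo_def)
qed

lemma Rep_stereo:
  assumes "s \<in> {1, -1}"
  shows "Rep_usphere (stereo s x) = (x /\<^sub>R inv_conf x, s * (1 - 1 / inv_conf x))"
  unfolding stereo_inv_conf
proof (rule Abs_usphere_inverse)
  have "s\<^sup>2 = 1" using assms by auto
  then have "(norm (x /\<^sub>R inv_conf x, s * (1 - 1 / inv_conf x)))\<^sup>2 = (norm x)\<^sup>2 / (inv_conf x)\<^sup>2 + (1 - 1 / inv_conf x)\<^sup>2"
    by (simp add: norm_Pair power_mult_distrib power_inverse divide_inverse)
  also have "\<dots> = 1"
    unfolding norm_sq_inv_conf by (rule stereo_norm_identity) simp
  finally have "norm (x /\<^sub>R inv_conf x, s * (1 - 1 / inv_conf x)) = 1"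
    using power2_eq_imp_eq[of "norm (x /\<^sub>R inv_conf x, s * (1 - 1 / inv_conf x))" 1] by simp
  then show "(x /\<^sub>R inv_conf x, s * (1 - 1 / inv_conf x)) \<in> sphere 0 1"
    by simp
qed

lemma stereo_inj:
  assumes "s \<in> {1, -1}" "stereo s x = stereo s y"
  shows "x = y"
proof -
  have "Rep_usphere (stereo s x) = Rep_usphere (stereo s y)" using assms by simp
  then have *: "x /\<^sub>R inv_conf x = y /\<^sub>R inv_conf y" "1 / inv_conf x = 1 / inv_conf y"
    using assms(1) by (auto simp: Rep_stereo)
  from *(2) have "inv_conf x = inv_conf y" by simp
  with *(1) show ?thesis by simp
qed

lemma stereo_1_neq_pole: "stereo 1 x \<noteq> stereo (-1) 0"
proof
  assume "stereo 1 x = stereo (-1) 0"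
  then have "Rep_usphere (stereo 1 x) = Rep_usphere (stereo (-1) 0)" by simp
  then have "1 - 1 / inv_conf x = 1"
    by (simp add: Rep_stereo inv_conf_def)
  then show False by simp
qed

text \<open>The chart \<open>s = 1\<close> omits only the north pole, which is the origin of the chart \<open>s = -1\<close>.\<close>
lemma stereo_cover_pole: "(\<exists>x. p = stereo 1 x) \<or> p = stereo (-1) 0"
proof -
  obtain a b where ab: "Rep_usphere p = (a, b)" by fastforce
  then have "norm (a, b) = 1" using Rep_usphere[of p] by simp
  then have n: "(norm a)\<^sup>2 + b\<^sup>2 = 1"
    by (simp add: norm_Pair)
  show ?thesis
  proof (cases "b = 1")
    case True
    with n have "a = 0" by simp
    then have "Rep_usphere p = Rep_usphere (stereo (-1) 0)"
      using ab True by (simp add: Rep_stereo inv_conf_def)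
    then show ?thesis by (simp add: Rep_usphere_inject)
  next
    case False
    define x where "x = a /\<^sub>R (1 - b)"
    have "(norm x)\<^sup>2 = (norm a)\<^sup>2 / (1 - b)\<^sup>2"
      by (simp add: x_def power_mult_distrib field_simps)
    also have "\<dots> = (1 - b\<^sup>2) / (1 - b)\<^sup>2" using n by (simp add: algebra_simps)
    also have "\<dots> = (1 + b) / (1 - b)"
    proof -
      have "1 - b\<^sup>2 = (1 - b) * (1 + b)" by (simp add: power2_eq_square algebra_simps)
      then show ?thesis using False by (simp add: power2_eq_square)
    qed
    finally have "inv_conf x = 1 / (1 - b)"
      using False by (simp add: inv_conf_def field_simps)
    then have "Rep_usphere (stereo 1 x) = (a, b)"
      using False by (simp add: Rep_stereo x_def)
    then show ?thesis using ab by (metis Rep_usphere_inject)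
  qed
qed

lemma stereo_cover:
  obtains s x where "s \<in> {1, -1}" "p = stereo s x"
  using stereo_cover_pole[of p] by blast

definition inversion :: "real^'m::finite \<Rightarrow> real^'m" where
  "inversion x = x /\<^sub>R (norm x)\<^sup>2"

lemma norm_inversion: "norm (inversion x) = inverse (norm x)"
  by (cases "x = 0") (simp_all add: inversion_def power2_eq_square field_simps)

lemma inv_conf_inversion: "x \<noteq> 0 \<Longrightarrow> inv_conf (inversion x) = inv_conf x / (norm x)\<^sup>2"
  by (simp add: inv_conf_def norm_inversion power2_eq_square field_simps)

text \<open>The transition map between the two charts.\<close>
lemma stereo_inversion:
  assumes "x \<noteq> 0"
  shows "stereo s (inversion x) = stereo (- s) x"
proof -
  have q: "inv_conf x \<noteq> 0" "(norm x)\<^sup>2 \<noteq> 0" using assms by auto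
  have "inversion x /\<^sub>R inv_conf (inversion x) =
      (inverse (inv_conf x / (norm x)\<^sup>2) * inverse ((norm x)\<^sup>2)) *\<^sub>R x"
    unfolding inv_conf_inversion[OF assms] by (simp add: inversion_def)
  also have "\<dots> = x /\<^sub>R inv_conf x"
    using q by (simp add: divide_inverse)
  finally have "inversion x /\<^sub>R inv_conf (inversion x) = x /\<^sub>R inv_conf x" .
  moreover have "1 - 1 / inv_conf (inversion x) = - (1 - 1 / inv_conf x)"
    using q unfolding inv_conf_inversion[OF assms] norm_sq_inv_conf by (simp add: field_simps)
  ultimately show ?thesis
    unfolding stereo_inv_conf by (metis mult_minus_left mult_minus_right)
qed

text \<open>Inversion exchanges the inside and the outside of the unit ball, so the two closed unit balls,
  which are compact, cover the sphere.\<close>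
lemma stereo_cover_ball:
  obtains s x where "s \<in> {1, -1}" "norm x \<le> 1" "p = stereo s x"
proof -
  obtain s x where s: "s \<in> {1, -1}" "p = stereo s x" by (rule stereo_cover)
  show thesis
  proof (cases "norm x \<le> 1")
    case True
    with s that show thesis by blast
  next
    case False
    then have "x \<noteq> 0" by auto
    then have "p = stereo (- s) (inversion x)"
      using s stereo_inversion[of x "- s"] by simp
    moreover have "norm (inversion x) \<le> 1"
      using False by (simp add: norm_inversion inverse_le_1_iff)
    moreover have "- s \<in> {1, -1}" using s by auto
    ultimately show thesis using that by blast
  qed
qed

lemma has_derivative_inv_conf:
  "(inv_conf has_derivative (\<lambda>h. x \<bullet> h)) (at x)"
proof -
  have "((\<lambda>y. (1 + y \<bullet> y) / 2) has_derivative (\<lambda>h. x \<bullet> h)) (at x)"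
    by (auto intro!: derivative_eq_intros simp: inner_commute)
  then show ?thesis by (simp add: inv_conf_def[abs_def] power2_norm_eq_inner)
qed

lemma partial_Rep_stereo:
  assumes "s \<in> {1, -1}"
  shows "partial i (\<lambda>y. Rep_usphere (stereo s y)) x =
    (axis i 1 /\<^sub>R inv_conf x - (x $ i / (inv_conf x)\<^sup>2) *\<^sub>R x, s * (x $ i / (inv_conf x)\<^sup>2))"
proof -
  have "((\<lambda>y. (y /\<^sub>R inv_conf y, s * (1 - 1 / inv_conf y))) has_derivative
     (\<lambda>h. (h /\<^sub>R inv_conf x - ((x \<bullet> h) / (inv_conf x)\<^sup>2) *\<^sub>R x, s * ((x \<bullet> h) / (inv_conf x)\<^sup>2)))) (at x)"
    by (auto intro!: derivative_eq_intros has_derivative_inv_conf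
             simp: fun_eq_iff power2_eq_square divide_inverse)
  from partial_eq[OF this, of i] show ?thesis
    using assms by (simp add: Rep_stereo inner_axis)
qed

text \<open>The terms with \<open>x\<^sub>i x\<^sub>j\<close> that come from the horizontal and from the vertical part of the
  parametrization cancel because \<open>\<bar>x\<bar>\<^sup>2 = 2 inv_conf x - 1\<close>.\<close>
lemma round_metric_eq:
  assumes "s \<in> {1, -1}"
  shows "round_metric s x = (\<chi> i j. if i = j then 1 / (inv_conf x)\<^sup>2 else 0)"
proof -
  have "inner (partial i (\<lambda>y. Rep_usphere (stereo s y)) x) (partial j (\<lambda>y. Rep_usphere (stereo s y)) x)
     = (if i = j then 1 / (inv_conf x)\<^sup>2 else 0)" for i j
  proof -
    have ss: "s * s = 1" using assms by auto
    have xx: "x \<bullet> x = 2 * inv_conf x - 1" by (metis norm_sq_inv_conf power2_norm_eq_inner)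
    have "inner (partial i (\<lambda>y. Rep_usphere (stereo s y)) x) (partial j (\<lambda>y. Rep_usphere (stereo s y)) x)
      = inverse (inv_conf x) * (inverse (inv_conf x) * (axis i 1 \<bullet> axis j (1::real)))
       - inverse (inv_conf x) * (x $ j / (inv_conf x)\<^sup>2) * (x $ i)
       - (x $ i / (inv_conf x)\<^sup>2) * inverse (inv_conf x) * x $ j
       + (x $ i / (inv_conf x)\<^sup>2) * (x $ j / (inv_conf x)\<^sup>2) * (2 * inv_conf x - 1)
       + (x $ i / (inv_conf x)\<^sup>2) * (x $ j / (inv_conf x)\<^sup>2)"
      by (simp add: partial_Rep_stereo[OF assms] inner_diff_left inner_diff_right xx
          inner_axis inner_axis' ss divide_inverse power2_eq_square algebra_simps)
    also have "\<dots> = (if i = j then 1 / (inv_conf x)\<^sup>2 else 0)"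
      by (simp add: inner_axis_axis field_simps power2_eq_square eval_nat_numeral)
    finally show ?thesis .
  qed
  then show ?thesis by (simp add: round_metric_def)
qed

lemma det_diag:
  fixes d :: "'m::finite \<Rightarrow> real"
  shows "det (\<chi> i j. if i = j then d i else 0) = (\<Prod>i\<in>UNIV. d i)"
  by (subst det_diagonal) auto

lemma matrix_inv_eqI:
  fixes A B :: "real^'m::finite^'m"
  assumes "A ** B = mat 1" "B ** A = mat 1"
  shows "matrix_inv A = B"
proof -
  have "A ** matrix_inv A = mat 1 \<and> matrix_inv A ** A = mat 1"
    unfolding matrix_inv_def by (rule someI[of _ B]) (use assms in auto)
  then have *: "matrix_inv A ** A = mat 1" by blast
  have "matrix_inv A = matrix_inv A ** (A ** B)" by (simp add: assms)
  also have "\<dots> = B" by (simp add: matrix_mul_assoc *)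
  finally show ?thesis .
qed

lemma matrix_inv_diag:
  fixes d :: "'m::finite \<Rightarrow> real"
  assumes "\<And>i. d i \<noteq> 0"
  shows "matrix_inv (\<chi> i j. if i = j then d i else 0) = (\<chi> i j. if i = j then 1 / d i else 0)"
proof (rule matrix_inv_eqI)
  show "(\<chi> i j. if i = j then d i else 0) ** (\<chi> i j. if i = j then 1 / d i else 0) = mat 1"
    using assms by (simp add: matrix_matrix_mult_def mat_def vec_eq_iff if_distrib [of "\<lambda>x. x * _"]
       sum.delta cong: if_cong)
  show "(\<chi> i j. if i = j then 1 / d i else 0) ** (\<chi> i j. if i = j then d i else 0) = mat 1"
    using assms by (simp add: matrix_matrix_mult_def mat_def vec_eq_iff if_distrib [of "\<lambda>x. x * _"]
       sum.delta cong: if_cong)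
qed

lemma sqrt_det_round_metric:
  fixes x :: "real^'n::finite"
  assumes "s \<in> {1, -1}"
  shows "sqrt (det (round_metric s x)) = 1 / inv_conf x ^ CARD('n)"
  unfolding round_metric_eq[OF assms] det_diag
  by (simp add: real_sqrt_power real_sqrt_divide power_one_over order_less_imp_le)

section \<open>The holographic coefficients\<close>

text \<open>The coefficients are determined by the values of the series to the right of \<open>0\<close>, because a
  nonzero power series has isolated zeros. The one-sided version is needed since the variable is
  \<open>r\<^sup>2\<close>.\<close>
lemma powser_eq_0_right:
  fixes a :: "nat \<Rightarrow> real"
  assumes d: "d > 0" and sums: "\<And>t. t \<in> {0<..<d} \<Longrightarrow> (\<lambda>k. a k * t ^ k) sums 0"
  shows "a k = 0"
proof (rule ccontr)
  assume "a k \<noteq> 0"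
  define f where "f t = (\<Sum>k. a k * t ^ k)" for t
  have "summable (\<lambda>k. a k * t ^ k)" if t: "norm t < d" for t
  proof -
    obtain t' where "norm t < t'" "t' < d" using dense[OF t] by blast
    then have "t' \<in> {0<..<d}" using norm_ge_zero[of t] by auto
    with sums[of t'] \<open>norm t < t'\<close> show ?thesis
      by (intro powser_inside[of a t' t]) (auto simp: sums_iff)
  qed
  then have f: "(\<lambda>k. a k * t ^ k) sums f t" if "norm t < d" for t
    using that unfolding f_def by (auto intro: summable_sums)
  have f0: "f t = 0" if "t \<in> {0<..<d}" for t
    using sums[OF that] by (simp add: f_def sums_iff)
  have "(f \<longlongrightarrow> a 0) (at 0)" using powser_limit_0[OF d f] .
  then have "(f \<longlongrightarrow> a 0) (at_right 0)" by (rule filterlim_mono) (simp_all add: at_le)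
  moreover have "\<forall>\<^sub>F t in at_right 0. f t = 0"
    using eventually_at_right_real[OF d] by eventually_elim (rule f0)
  then have "(f \<longlongrightarrow> 0) (at_right 0)" by (simp add: tendsto_eventually)
  ultimately have a0: "a 0 = 0" using tendsto_unique trivial_limit_at_right_real by blast
  with \<open>a k \<noteq> 0\<close> have "k > 0" by (cases k) auto
  moreover have "f 0 = 0" using a0 by (simp add: f_def)
  ultimately obtain s where s: "0 < s" "\<And>z. z \<in> cball 0 s - {0} \<Longrightarrow> f z \<noteq> 0"
    using powser_0_nonzero[OF d, of 0 a f k] f \<open>a k \<noteq> 0\<close> by auto
  have "min s (d/2) \<in> cball 0 s - {0}" "min s (d/2) \<in> {0<..<d}" using s(1) d by auto
  with s(2) f0 show False by blast
qed

text \<open>The conformal factor is constant along the sphere, so \<open>v(r) = (1 - r\<^sup>2/4)\<^sup>n\<close> and the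
  coefficients are binomial.\<close>
lemma holographic_coeff_eq:
  "holographic_coeff k (p :: 'n::finite usphere) = real (CARD('n) choose k) * (-1/4) ^ k"
proof -
  let ?n = "CARD('n)"
  define w0 where "w0 = (\<lambda>k (p :: 'n usphere). real (?n choose k) * (-1/4) ^ k)"
  have ratio: "sqrt (det (h_metric s r x)) / sqrt (det (round_metric s x)) = (1 - r\<^sup>2/4) ^ ?n"
    if "s \<in> {1, -1}" "r \<in> {0<..<1}" for s r and x :: "real^'n"
  proof -
    have r: "0 < 1 - r\<^sup>2/4" using that power_le_one[of r 2] by auto
    have "h_metric s r x = (\<chi> i j. if i = j then (1 - r\<^sup>2/4)\<^sup>2 / (inv_conf x)\<^sup>2 else 0)"
      by (simp add: h_metric_def round_metric_eq[OF that(1)] vec_eq_iff)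
    then have "sqrt (det (h_metric s r x)) = ((1 - r\<^sup>2/4) / inv_conf x) ^ ?n"
      using r inv_conf_pos[of x]
      by (simp add: det_diag real_sqrt_power real_sqrt_divide order_less_imp_le)
    then show ?thesis
      using that by (simp add: sqrt_det_round_metric power_divide)
  qed
  have w0: "(\<lambda>k. w0 k p * r ^ (2 * k)) sums ((1 - r\<^sup>2/4) ^ ?n)" for r p
  proof -
    have "(1 - r\<^sup>2/4) ^ ?n = (\<Sum>k\<le>?n. real (?n choose k) * (- r\<^sup>2/4) ^ k)"
      using binomial_ring[of "- r\<^sup>2/4" "1::real" ?n] by simp
    also have "\<dots> = (\<Sum>k\<le>?n. w0 k p * r ^ (2 * k))"
    proof (rule sum.cong)
      fix k
      have "- r\<^sup>2/4 = (-1/4) * r\<^sup>2" by simp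
      then show "real (?n choose k) * (- r\<^sup>2/4) ^ k = w0 k p * r ^ (2 * k)"
        unfolding w0_def by (simp only: power_mult_distrib power_mult mult.assoc)
    qed simp
    finally show ?thesis
      using sums_finite[of "{..?n}" "\<lambda>k. w0 k p * r ^ (2 * k)"] by (simp add: w0_def)
  qed
  have "holographic_coeff = w0"
    unfolding holographic_coeff_def
  proof (rule the_equality)
    show "\<exists>\<epsilon>>0. \<forall>s\<in>{1, -1}. \<forall>x::real^'n. \<forall>r\<in>{0<..<\<epsilon>}.
        (\<lambda>k. w0 k (stereo s x) * r ^ (2 * k)) sums
          (sqrt (det (h_metric s r x)) / sqrt (det (round_metric s x)))"
      using ratio w0 by (intro exI[of _ 1]) simp
  next
    fix w assume "\<exists>\<epsilon>>0. \<forall>s\<in>{1, -1}. \<forall>x::real^'n. \<forall>r\<in>{0<..<\<epsilon>}.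
        (\<lambda>k. w k (stereo s x) * r ^ (2 * k)) sums
          (sqrt (det (h_metric s r x)) / sqrt (det (round_metric s x)))"
    then obtain \<epsilon> where e: "\<epsilon> > 0" and w: "\<And>s x r. s \<in> {1, -1} \<Longrightarrow> r \<in> {0<..<\<epsilon>} \<Longrightarrow>
       (\<lambda>k. w k (stereo s x) * r ^ (2 * k)) sums
          (sqrt (det (h_metric s r x)) / sqrt (det (round_metric s (x::real^'n))))" by blast
    have "(\<lambda>k. w k p) = (\<lambda>k. w0 k p)" for p
    proof -
      obtain s x where p: "s \<in> {1, -1}" "p = stereo s x" by (rule stereo_cover)
      \<comment> \<open>The ratio of volume densities is known for \<open>r < 1\<close>, and the expansion for \<open>r < \<epsilon>\<close>.\<close>
      define d where "d = (min \<epsilon> 1)\<^sup>2"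
      have d: "d > 0" using e by (simp add: d_def)
      have *: "(\<lambda>k. (w k p - w0 k p) * t ^ k) sums 0" if "t \<in> {0<..<d}" for t
      proof -
        have "sqrt t < min \<epsilon> 1"
          using that e real_sqrt_less_mono[of t "(min \<epsilon> 1)\<^sup>2"] by (simp add: d_def)
        then have t: "sqrt t \<in> {0<..<\<epsilon>}" "sqrt t \<in> {0<..<1}" "(sqrt t)\<^sup>2 = t"
          using that by auto
        have "(\<lambda>k. w k p * sqrt t ^ (2 * k)) sums ((1 - (sqrt t)\<^sup>2/4) ^ ?n)"
          using w[OF p(1) t(1), of x] unfolding ratio[OF p(1) t(2)] p(2) .
        from sums_diff[OF this w0[of p "sqrt t"]] show ?thesis
          by (simp only: power_mult t(3) left_diff_distrib diff_self)
      qed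
      have "w k p - w0 k p = 0" for k
        using powser_eq_0_right[OF d *] .
      then show ?thesis by (auto simp: fun_eq_iff)
    qed
    then show "w = w0" by (auto simp: fun_eq_iff)
  qed
  then have "holographic_coeff k p = w0 k p" by (rule fun_cong[OF fun_cong])
  then show ?thesis by (simp only: w0_def)
qed

section \<open>The Laplacian of the sphere\<close>

text \<open>The Laplacian of the metric \<open>q\<^sup>-\<^sup>2 \<delta>\<close>, \<open>q = inv_conf\<close>, in non-divergence form; the gradient
  of \<open>q\<close> is \<open>x\<close>.\<close>
definition chart_lap :: "(real^'m::finite \<Rightarrow> complex) \<Rightarrow> real^'m \<Rightarrow> complex" where
  "chart_lap F x = (complex_of_real (inv_conf x))\<^sup>2 * (\<Sum>i\<in>UNIV. partial i (partial i F) x)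
     - (of_nat CARD('m) - 2) * (complex_of_real (inv_conf x) * (\<Sum>i\<in>UNIV. complex_of_real (x $ i) * partial i F x))"

lemma C_k_chart_lap:
  assumes "C_k (Suc (Suc k)) F"
  shows "C_k k (chart_lap F)"
proof -
  have *: "chart_lap F = (\<lambda>x. (complex_of_real (inv_conf x) * complex_of_real (inv_conf x)) * (\<Sum>i\<in>UNIV. partial i (partial i F) x)
     + (- (of_nat CARD('a) - 2)) * (complex_of_real (inv_conf x) * (\<Sum>i\<in>UNIV. complex_of_real (x $ i) * partial i F x)))"
    by (simp add: chart_lap_def power2_eq_square fun_eq_iff algebra_simps)
  have "C_k k (partial i F)" "C_k k (partial i (partial i F))" for i
    using assms C_k_Suc_imp C_k_partial by blast+
  then show ?thesis unfolding *
    by (intro C_k_add C_k_mult C_k_sum C_k_const C_k_inv_conf C_k_of_real_coord) auto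
qed

lemma frechet_derivative_coords:
  fixes G :: "real^'m::finite \<Rightarrow> complex"
  assumes "G differentiable (at z)"
  shows "frechet_derivative G (at z) h = (\<Sum>k\<in>UNIV. complex_of_real (h $ k) * partial k G z)"
proof -
  have lin: "linear (frechet_derivative G (at z))"
    using assms linear_frechet_derivative by blast
  have "frechet_derivative G (at z) h = frechet_derivative G (at z) (\<Sum>k\<in>UNIV. h $ k *\<^sub>R axis k 1)"
    using basis_expansion[of h] by (simp add: scalar_mult_eq_scaleR)
  also have "\<dots> = (\<Sum>k\<in>UNIV. complex_of_real (h $ k) * partial k G z)"
    by (simp add: linear_sum[OF lin] linear_cmul[OF lin] partial_def) (simp add: scaleR_conv_of_real)
  finally show ?thesis .
qed

text \<open>The Jacobian matrix of the inversion.\<close>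
definition inv_jac :: "'m::finite \<Rightarrow> 'm \<Rightarrow> real^'m \<Rightarrow> real" where
  "inv_jac i k x = (if i = k then 1 else 0) / (norm x)\<^sup>2 - 2 * (x $ i * x $ k) / ((norm x)\<^sup>2)\<^sup>2"

lemma axis_1_nth: "axis i (1::real) $ k = (if i = k then 1 else 0)"
  by (simp add: axis_def)

lemma has_derivative_inversion:
  assumes "x \<noteq> 0"
  shows "(inversion has_derivative (\<lambda>h. h /\<^sub>R (norm x)\<^sup>2 - (2 * (x \<bullet> h) / ((norm x)\<^sup>2)\<^sup>2) *\<^sub>R x)) (at x)"
  unfolding inversion_def[abs_def] power2_norm_eq_inner using assms
  by (auto intro!: derivative_eq_intros simp: fun_eq_iff power2_eq_square divide_inverse inner_commute algebra_simps)

lemma partial_inversion: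
  fixes G :: "real^'m::finite \<Rightarrow> complex"
  assumes "x \<noteq> 0" "G differentiable (at (inversion x))"
  shows "partial i (\<lambda>y. G (inversion y)) x
    = (\<Sum>k\<in>UNIV. complex_of_real (inv_jac i k x) * partial k G (inversion x))"
    and "(\<lambda>y. G (inversion y)) differentiable (at x)"
proof -
  let ?D = "\<lambda>h. h /\<^sub>R (norm x)\<^sup>2 - (2 * (x \<bullet> h) / ((norm x)\<^sup>2)\<^sup>2) *\<^sub>R x"
  have D: "((\<lambda>y. G (inversion y)) has_derivative (\<lambda>h. frechet_derivative G (at (inversion x)) (?D h))) (at x)"
    using diff_chain_at[OF has_derivative_inversion[OF assms(1)] frechet_derivative_worksI[OF assms(2)]]
    by (simp add: o_def)
  then show "(\<lambda>y. G (inversion y)) differentiable (at x)"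
    unfolding differentiable_def by blast
  have "?D (axis i 1) $ k = inv_jac i k x" for k
    by (simp add: inv_jac_def inner_axis axis_1_nth divide_inverse)
  with partial_eq[OF D, of i] show "partial i (\<lambda>y. G (inversion y)) x
    = (\<Sum>k\<in>UNIV. complex_of_real (inv_jac i k x) * partial k G (inversion x))"
    by (simp only: frechet_derivative_coords[OF assms(2)])
qed

lemma has_derivative_inv_jac:
  assumes "x \<noteq> 0"
  shows "((\<lambda>y. complex_of_real (inv_jac i k y)) has_derivative
     (\<lambda>h. complex_of_real (- (if i = k then 1 else 0) * (2 * (x \<bullet> h)) / ((norm x)\<^sup>2)\<^sup>2
        - 2 * (h $ i * x $ k + x $ i * h $ k) / ((norm x)\<^sup>2)\<^sup>2
        + 8 * (x $ i * x $ k) * (x \<bullet> h) / ((norm x)\<^sup>2)^3))) (at x)"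
proof -
  have c: "((\<lambda>y. y $ j) has_derivative (\<lambda>h. h $ j)) (at x)" for j
    by (intro bounded_linear_imp_has_derivative bounded_linear_vec_nth)
  have "(inv_jac i k has_derivative
     (\<lambda>h. - (if i = k then 1 else 0) * (2 * (x \<bullet> h)) / ((norm x)\<^sup>2)\<^sup>2
        - 2 * (h $ i * x $ k + x $ i * h $ k) / ((norm x)\<^sup>2)\<^sup>2
        + 8 * (x $ i * x $ k) * (x \<bullet> h) / ((norm x)\<^sup>2)^3)) (at x)"
    unfolding inv_jac_def[abs_def] power2_norm_eq_inner using assms
    by (auto intro!: derivative_eq_intros c simp: fun_eq_iff)
       (simp_all add: divide_simps eval_nat_numeral inner_commute algebra_simps)
  from bounded_linear.has_derivative[OF bounded_linear_of_real this] show ?thesis .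
qed

text \<open>The inversion is conformal with factor \<open>\<bar>x\<bar>\<^sup>-\<^sup>2\<close>.\<close>
lemma sum_inv_jac_mult:
  assumes "x \<noteq> 0"
  shows "(\<Sum>i\<in>UNIV. inv_jac i k x * inv_jac i l x) = (if k = l then 1 / ((norm x)\<^sup>2)\<^sup>2 else 0)"
proof -
  define m where "m = (norm x)\<^sup>2"
  have m: "m \<noteq> 0" using assms by (simp add: m_def)
  have "inv_jac i k x * inv_jac i l x =
     (if i = k then (if i = l then 1 else 0) / m\<^sup>2 - 2 * (x $ i * x $ l) / m^3 else 0)
      - (if i = l then 2 * (x $ i * x $ k) / m^3 else 0)
      + (x $ i)\<^sup>2 * (4 * (x $ k * x $ l) / m^4)" for i
    using m unfolding inv_jac_def m_def[symmetric]
    by (simp add: divide_simps) (simp add: algebra_simps eval_nat_numeral)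
  moreover have "(\<Sum>i\<in>UNIV. (x $ i)\<^sup>2) = m" by (simp add: m_def norm_sq_sum)
  ultimately have "(\<Sum>i\<in>UNIV. inv_jac i k x * inv_jac i l x) =
     ((if k = l then 1 else 0) / m\<^sup>2 - 2 * (x $ k * x $ l) / m^3) - 2 * (x $ l * x $ k) / m^3
      + m * (4 * (x $ k * x $ l) / m^4)"
    by (simp add: sum.distrib sum_subtractf sum.delta sum_distrib_right[symmetric] sum_divide_distrib[symmetric])
  also have "\<dots> = (if k = l then 1 / m\<^sup>2 else 0)"
    using m by (simp add: divide_simps) (simp add: algebra_simps eval_nat_numeral)
  finally show ?thesis by (simp add: m_def)
qed

text \<open>The flat Laplacian of the components of the inversion.\<close>
lemma sum_partial_inv_jac:
  fixes x :: "real^'m::finite"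
  assumes "x \<noteq> 0"
  shows "(\<Sum>i\<in>UNIV. partial i (\<lambda>y. complex_of_real (inv_jac i k y)) x)
     = complex_of_real ((4 - 2 * real CARD('m)) * x $ k / ((norm x)\<^sup>2)\<^sup>2)"
proof -
  define m where "m = (norm x)\<^sup>2"
  have m: "m \<noteq> 0" using assms by (simp add: m_def)
  have "partial i (\<lambda>y. complex_of_real (inv_jac i k y)) x = complex_of_real
     ((if i = k then - 4 * x $ i / m\<^sup>2 else 0) - 2 * x $ k / m\<^sup>2 + (x $ i)\<^sup>2 * (8 * x $ k / m ^ 3))" for i
    using partial_eq[OF has_derivative_inv_jac[OF assms], of i i k]
    unfolding m_def[symmetric] by (simp add: inner_axis axis_1_nth power2_eq_square diff_divide_distrib)
  then have total: "(\<Sum>i\<in>UNIV. partial i (\<lambda>y. complex_of_real (inv_jac i k y)) x) = complex_of_real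
     (\<Sum>i\<in>UNIV. (if i = k then - 4 * x $ i / m\<^sup>2 else 0) - 2 * x $ k / m\<^sup>2 + (x $ i)\<^sup>2 * (8 * x $ k / m ^ 3))"
    by (simp only: of_real_sum)
  have "(\<Sum>i\<in>UNIV. (x $ i)\<^sup>2) = m" by (simp add: m_def norm_sq_sum)
  then have "(\<Sum>i\<in>UNIV. (if i = k then - 4 * x $ i / m\<^sup>2 else 0) - 2 * x $ k / m\<^sup>2 + (x $ i)\<^sup>2 * (8 * x $ k / m ^ 3))
    = - 4 * x $ k / m\<^sup>2 - real CARD('m) * (2 * x $ k / m\<^sup>2) + m * (8 * x $ k / m ^ 3)"
    by (simp add: sum.distrib sum_subtractf sum.delta sum_distrib_right[symmetric] sum_divide_distrib[symmetric])
  also have "\<dots> = (4 - 2 * real CARD('m)) * x $ k / m\<^sup>2"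
    using m by (simp add: divide_simps) (simp add: algebra_simps eval_nat_numeral)
  finally show ?thesis unfolding total unfolding m_def by simp
qed

lemma sum_coord_inv_jac:
  assumes "x \<noteq> 0"
  shows "(\<Sum>i\<in>UNIV. x $ i * inv_jac i k x) = - x $ k / (norm x)\<^sup>2"
proof -
  define m where "m = (norm x)\<^sup>2"
  have m: "m \<noteq> 0" using assms by (simp add: m_def)
  have "x $ i * inv_jac i k x = (if i = k then x $ i / m else 0) - (x $ i)\<^sup>2 * (2 * x $ k / m\<^sup>2)" for i
    unfolding inv_jac_def m_def[symmetric] by (simp add: power2_eq_square algebra_simps)
  moreover have "(\<Sum>i\<in>UNIV. (x $ i)\<^sup>2) = m" by (simp add: m_def norm_sq_sum)
  ultimately have "(\<Sum>i\<in>UNIV. x $ i * inv_jac i k x) = x $ k / m - m * (2 * x $ k / m\<^sup>2)"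
    by (simp add: sum_subtractf sum.delta sum_distrib_right[symmetric] sum_divide_distrib[symmetric])
  also have "\<dots> = - x $ k / m"
    using m by (simp add: divide_simps power2_eq_square)
  finally show ?thesis by (simp add: m_def)
qed

text \<open>Inversion reverses rays from the origin, hence changes the sign of the Euler vector field.\<close>
lemma radial_derivative_inversion:
  fixes G :: "real^'m::finite \<Rightarrow> complex"
  assumes "x \<noteq> 0" "G differentiable (at (inversion x))"
  shows "(\<Sum>i\<in>UNIV. complex_of_real (x $ i) * partial i (\<lambda>y. G (inversion y)) x)
    = - (\<Sum>k\<in>UNIV. complex_of_real (inversion x $ k) * partial k G (inversion x))"
proof -
  have "(\<Sum>i\<in>UNIV. complex_of_real (x $ i) * partial i (\<lambda>y. G (inversion y)) x)
     = (\<Sum>i\<in>UNIV. \<Sum>k\<in>UNIV. complex_of_real (x $ i * inv_jac i k x) * partial k G (inversion x))"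
    by (simp add: partial_inversion[OF assms] sum_distrib_left mult.assoc)
  also have "\<dots> = (\<Sum>k\<in>UNIV. complex_of_real (\<Sum>i\<in>UNIV. x $ i * inv_jac i k x) * partial k G (inversion x))"
    by (subst sum.swap) (simp only: of_real_sum sum_distrib_right)
  also have "\<dots> = - (\<Sum>k\<in>UNIV. complex_of_real (inversion x $ k) * partial k G (inversion x))"
    unfolding sum_coord_inv_jac[OF assms(1)]
    by (simp add: inversion_def sum_negf divide_inverse mult_ac)
  finally show ?thesis .
qed

text \<open>Chain rule of second order: the conformality of the inversion removes the mixed second
  derivatives, and its failure to be harmonic (for \<open>n \<noteq> 2\<close>) leaves a first-order term.\<close>
lemma flat_lap_inversion:
  fixes G :: "real^'m::finite \<Rightarrow> complex"
  assumes G: "C_k 2 G" and x: "x \<noteq> 0"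
  shows "(\<Sum>i\<in>UNIV. partial i (partial i (\<lambda>y. G (inversion y))) x)
    = (\<Sum>k\<in>UNIV. partial k (partial k G) (inversion x)) / (of_real ((norm x)\<^sup>2))\<^sup>2
     + (4 - 2 * of_nat CARD('m)) / (of_real ((norm x)\<^sup>2))\<^sup>2 *
         (\<Sum>k\<in>UNIV. complex_of_real (x $ k) * partial k G (inversion x))"
proof -
  have G1: "G differentiable (at z)" "partial k G differentiable (at z)" for z k
    using G by (auto simp: numeral_2_eq_2)
  have "partial i (partial i (\<lambda>y. G (inversion y))) x =
      (\<Sum>k\<in>UNIV. complex_of_real (inv_jac i k x) *
          (\<Sum>l\<in>UNIV. complex_of_real (inv_jac i l x) * partial l (partial k G) (inversion x))
        + partial i (\<lambda>y. complex_of_real (inv_jac i k y)) x * partial k G (inversion x))" for i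
  proof -
    have "\<forall>\<^sub>F y in nhds x. y \<noteq> 0" using x t1_space_nhds by blast
    then have "\<forall>\<^sub>F y in nhds x. partial i (\<lambda>y. G (inversion y)) y =
        (\<Sum>k\<in>UNIV. complex_of_real (inv_jac i k y) * partial k G (inversion y))"
      by eventually_elim (rule partial_inversion(1)[OF _ G1(1)])
    then have "partial i (partial i (\<lambda>y. G (inversion y))) x =
       partial i (\<lambda>y. \<Sum>k\<in>UNIV. complex_of_real (inv_jac i k y) * partial k G (inversion y)) x"
      by (rule partial_cong)
    also have "\<dots> = (\<Sum>k\<in>UNIV. partial i (\<lambda>y. complex_of_real (inv_jac i k y) * partial k G (inversion y)) x)"
      using has_derivative_inv_jac[OF x] partial_inversion(2)[OF x G1(2)]
      by (intro partial_sum differentiable_mult) (auto simp: differentiable_def)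
    also have "\<dots> = (\<Sum>k\<in>UNIV. complex_of_real (inv_jac i k x) * partial i (\<lambda>y. partial k G (inversion y)) x
       + partial i (\<lambda>y. complex_of_real (inv_jac i k y)) x * partial k G (inversion x))"
      using has_derivative_inv_jac[OF x] partial_inversion(2)[OF x G1(2)]
      by (intro sum.cong partial_mult) (auto simp: differentiable_def)
    finally show ?thesis by (simp only: partial_inversion(1)[OF x G1(2)])
  qed
  then have "(\<Sum>i\<in>UNIV. partial i (partial i (\<lambda>y. G (inversion y))) x) =
      (\<Sum>i\<in>UNIV. \<Sum>k\<in>UNIV. \<Sum>l\<in>UNIV. complex_of_real (inv_jac i k x * inv_jac i l x) * partial l (partial k G) (inversion x))
     + (\<Sum>i\<in>UNIV. \<Sum>k\<in>UNIV. partial i (\<lambda>y. complex_of_real (inv_jac i k y)) x * partial k G (inversion x))"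
    by (simp add: sum.distrib sum_distrib_left mult.assoc)
  also have "(\<Sum>i\<in>UNIV. \<Sum>k\<in>UNIV. \<Sum>l\<in>UNIV. complex_of_real (inv_jac i k x * inv_jac i l x) * partial l (partial k G) (inversion x))
     = (\<Sum>k\<in>UNIV. \<Sum>i\<in>UNIV. \<Sum>l\<in>UNIV. complex_of_real (inv_jac i k x * inv_jac i l x) * partial l (partial k G) (inversion x))"
    by (rule sum.swap)
  also have "\<dots> = (\<Sum>k\<in>UNIV. \<Sum>l\<in>UNIV. \<Sum>i\<in>UNIV. complex_of_real (inv_jac i k x * inv_jac i l x) * partial l (partial k G) (inversion x))"
    by (rule sum.cong[OF refl], rule sum.swap)
  also have "\<dots> = (\<Sum>k\<in>UNIV. \<Sum>l\<in>UNIV. (if k = l then 1 / (of_real ((norm x)\<^sup>2))\<^sup>2 else 0) * partial l (partial k G) (inversion x))"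
    unfolding sum_distrib_right[symmetric] of_real_sum[symmetric] sum_inv_jac_mult[OF x]
    by (intro sum.cong) auto
  also have "\<dots> = (\<Sum>k\<in>UNIV. \<Sum>l\<in>UNIV. if k = l then 1 / (of_real ((norm x)\<^sup>2))\<^sup>2 * partial l (partial k G) (inversion x) else 0)"
    by (intro sum.cong) auto
  also have "\<dots> = (\<Sum>k\<in>UNIV. partial k (partial k G) (inversion x)) / (of_real ((norm x)\<^sup>2))\<^sup>2"
    by (simp add: sum_divide_distrib)
  also have "(\<Sum>i\<in>UNIV. \<Sum>k\<in>UNIV. partial i (\<lambda>y. complex_of_real (inv_jac i k y)) x * partial k G (inversion x))
    = (\<Sum>k\<in>UNIV. \<Sum>i\<in>UNIV. partial i (\<lambda>y. complex_of_real (inv_jac i k y)) x * partial k G (inversion x))"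
    by (rule sum.swap)
  also have "\<dots> = (4 - 2 * of_nat CARD('m)) / (of_real ((norm x)\<^sup>2))\<^sup>2 *
         (\<Sum>k\<in>UNIV. complex_of_real (x $ k) * partial k G (inversion x))"
    unfolding sum_distrib_right[symmetric] sum_partial_inv_jac[OF x]
    by (simp add: sum_distrib_left sum_divide_distrib mult_ac)
  finally show ?thesis .
qed

text \<open>The inversion is an isometry of the round metric, so it preserves the Laplacian. In coordinates
  the first-order term of \<open>flat_lap_inversion\<close> combines with the one of \<open>chart_lap\<close> by means of
  \<open>\<bar>x\<bar>\<^sup>2 = 2 q - 1\<close>.\<close>
lemma chart_lap_inversion:
  fixes G :: "real^'m::finite \<Rightarrow> complex"
  assumes G: "C_k 2 G" and x: "x \<noteq> 0"
  shows "chart_lap (\<lambda>y. G (inversion y)) x = chart_lap G (inversion x)"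
proof -
  define m where "m = complex_of_real ((norm x)\<^sup>2)"
  define S where "S = (\<Sum>k\<in>UNIV. complex_of_real (x $ k) * partial k G (inversion x))"
  define L where "L = (\<Sum>k\<in>UNIV. partial k (partial k G) (inversion x))"
  define q where "q = complex_of_real (inv_conf x)"
  have m: "m \<noteq> 0" using x by (simp add: m_def)
  have "2 * inv_conf x = 1 + (norm x)\<^sup>2" by (simp add: inv_conf_def)
  then have "complex_of_real (2 * inv_conf x) = complex_of_real (1 + (norm x)\<^sup>2)" by simp
  then have mq: "m = 2 * q - 1" by (simp add: m_def q_def)
  have G1: "G differentiable (at z)" for z
    using G by (auto simp: numeral_2_eq_2)
  have S': "(\<Sum>k\<in>UNIV. complex_of_real (inversion x $ k) * partial k G (inversion x)) = S / m"
    by (simp add: inversion_def S_def m_def sum_distrib_left divide_inverse mult_ac)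
  have q': "complex_of_real (inv_conf (inversion x)) = q / m"
    unfolding inv_conf_inversion[OF x] by (simp add: q_def m_def)
  have "chart_lap (\<lambda>y. G (inversion y)) x =
     q\<^sup>2 * (L / m\<^sup>2 + (4 - 2 * of_nat CARD('m)) / m\<^sup>2 * S) - (of_nat CARD('m) - 2) * (q * - (S / m))"
    unfolding chart_lap_def flat_lap_inversion[OF G x] radial_derivative_inversion[OF x G1] S'
    unfolding L_def S_def m_def q_def ..
  also have "\<dots> = (q / m)\<^sup>2 * L - (of_nat CARD('m) - 2) * (q / m * (S / m))"
    using m by (simp add: divide_simps power2_eq_square) (simp add: mq algebra_simps)
  also have "\<dots> = chart_lap G (inversion x)"
    unfolding chart_lap_def S' q' L_def ..
  finally show ?thesis .
qed

lemma chart_lap_cong: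
  assumes "\<forall>\<^sub>F y in nhds x. F y = G y"
  shows "chart_lap F x = chart_lap G x"
proof -
  have "partial i F x = partial i G x" for i using partial_cong[OF assms] .
  moreover have "partial i (partial i F) x = partial i (partial i G) x" for i
  proof (rule partial_cong)
    show "\<forall>\<^sub>F y in nhds x. partial i F y = partial i G y"
      using eventually_eventually[THEN iffD2, OF assms] by eventually_elim (rule partial_cong)
  qed
  ultimately show ?thesis by (simp add: chart_lap_def)
qed

text \<open>The chart \<open>s = 1\<close> is used wherever it applies; \<open>sphere_lap_stereo\<close> shows that the choice does
  not matter for smooth functions.\<close>
definition sphere_lap :: "('n::finite usphere \<Rightarrow> complex) \<Rightarrow> 'n usphere \<Rightarrow> complex" where
  "sphere_lap f p =
     (if p = stereo (-1) 0 then chart_lap (\<lambda>y. f (stereo (-1) y)) 0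
      else chart_lap (\<lambda>y. f (stereo 1 y)) (THE x. p = stereo 1 x))"

lemma smooth_C_k: "f \<in> smooth_on_sphere \<Longrightarrow> s \<in> {1, -1} \<Longrightarrow> C_k k (\<lambda>x. f (stereo s x))"
  by (auto simp: smooth_on_sphere_def)

lemma sphere_lap_stereo:
  assumes f: "f \<in> smooth_on_sphere" and s: "s \<in> {1, -1}"
  shows "sphere_lap f (stereo s x) = chart_lap (\<lambda>y. f (stereo s y)) x"
proof -
  have 1: "sphere_lap f (stereo 1 z) = chart_lap (\<lambda>y. f (stereo 1 y)) z" for z
  proof -
    have "(THE x. stereo 1 z = stereo 1 x) = z"
      using stereo_inj[of 1] by (intro the_equality) auto
    then show ?thesis using stereo_1_neq_pole[of z] by (simp add: sphere_lap_def)
  qed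
  show ?thesis
  proof (cases "s = 1")
    case False
    then have s: "s = -1" using s by auto
    show ?thesis
    proof (cases "x = 0")
      case True
      then show ?thesis by (simp add: sphere_lap_def s)
    next
      case False
      have "\<forall>\<^sub>F y in nhds x. y \<noteq> 0" using False t1_space_nhds by blast
      then have "\<forall>\<^sub>F y in nhds x. f (stereo (-1) y) = f (stereo 1 (inversion y))"
        by eventually_elim (simp add: stereo_inversion)
      then have "chart_lap (\<lambda>y. f (stereo (-1) y)) x = chart_lap (\<lambda>y. f (stereo 1 (inversion y))) x"
        by (rule chart_lap_cong)
      also have "\<dots> = chart_lap (\<lambda>y. f (stereo 1 y)) (inversion x)"
        using smooth_C_k[OF f] False by (intro chart_lap_inversion) auto
      also have "\<dots> = sphere_lap f (stereo (-1) x)"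
        using stereo_inversion[OF False, of 1] by (simp add: 1[symmetric])
      finally show ?thesis by (simp add: s)
    qed
  qed (simp add: 1)
qed

lemma smooth_sphere_lap:
  assumes "f \<in> smooth_on_sphere"
  shows "sphere_lap f \<in> smooth_on_sphere"
  unfolding smooth_on_sphere_def mem_Collect_eq
proof (intro ballI allI)
  fix s :: real and k assume s: "s \<in> {1, -1}"
  have "C_k k (chart_lap (\<lambda>y. f (stereo s y)))"
    by (intro C_k_chart_lap smooth_C_k[OF assms s])
  then show "C_k k (\<lambda>x. sphere_lap f (stereo s x))"
    unfolding sphere_lap_stereo[OF assms s] .
qed

lemma smooth_const: "(\<lambda>_. c) \<in> smooth_on_sphere"
  by (simp add: smooth_on_sphere_def C_k_const)

lemma smooth_add: "f \<in> smooth_on_sphere \<Longrightarrow> g \<in> smooth_on_sphere \<Longrightarrow> (\<lambda>p. f p + g p) \<in> smooth_on_sphere"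
  by (simp add: smooth_on_sphere_def C_k_add)

lemma smooth_mult: "f \<in> smooth_on_sphere \<Longrightarrow> g \<in> smooth_on_sphere \<Longrightarrow> (\<lambda>p. f p * g p) \<in> smooth_on_sphere"
  by (simp add: smooth_on_sphere_def C_k_mult)

lemma smooth_cnj: "f \<in> smooth_on_sphere \<Longrightarrow> (\<lambda>p. cnj (f p)) \<in> smooth_on_sphere"
  by (simp add: smooth_on_sphere_def C_k_cnj)

section \<open>The Laplacian of the Poincare-Einstein metric\<close>

text \<open>Writing the derivative with \<open>f x ^ n\<close> instead of \<open>f x ^ (n - 1)\<close> avoids a case distinction
  on \<open>n\<close>.\<close>
lemma DERIV_power_div:
  fixes f :: "real \<Rightarrow> real"
  assumes "(f has_field_derivative D) (at x)" "f x \<noteq> 0"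
  shows "((\<lambda>x. f x ^ n) has_field_derivative real n * f x ^ n / f x * D) (at x)"
proof (cases n)
  case (Suc m)
  have "((\<lambda>x. f x ^ Suc m) has_field_derivative (1 + of_nat m) * (D * f x ^ m)) (at x)"
    using DERIV_power_Suc[OF assms(1)] .
  then show ?thesis using assms(2) by (simp add: Suc mult_ac)
qed simp

lemma has_derivative_inv_conf_ratio:
  "((\<lambda>y. complex_of_real ((inv_conf y)\<^sup>2 / inv_conf y ^ n)) has_derivative
     (\<lambda>h. complex_of_real ((2 - real n) * inv_conf x / inv_conf x ^ n * (x \<bullet> h)))) (at x)"
proof -
  have "((\<lambda>q. q\<^sup>2 / q ^ n) has_field_derivative (2 - real n) * q / q ^ n) (at q)" if "q \<noteq> 0" for q :: real
  proof -
    have "((real 2 * q\<^sup>2 / q * 1) * q ^ n - q\<^sup>2 * (real n * q ^ n / q * 1)) / (q ^ n * q ^ n)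
        = (2 - real n) * q / q ^ n"
      using that by (simp add: power2_eq_square divide_simps) (simp add: algebra_simps)
    with that DERIV_divide[OF DERIV_power_div[OF DERIV_ident, of q 2] DERIV_power_div[OF DERIV_ident, of q n]]
    show ?thesis by simp
  qed
  from diff_chain_at[OF has_derivative_inv_conf[of x] this[unfolded has_field_derivative_def]]
  have "((\<lambda>y. (inv_conf y)\<^sup>2 / inv_conf y ^ n) has_derivative
     (\<lambda>h. (2 - real n) * inv_conf x / inv_conf x ^ n * (x \<bullet> h))) (at x)"
    by (simp add: o_def)
  from bounded_linear.has_derivative[OF bounded_linear_of_real this] show ?thesis .
qed

text \<open>The divergence form of \<open>chart_lap\<close>. The weight \<open>q\<^sup>2\<^sup>-\<^sup>n\<close> is written as a quotient because
  \<open>2 - n\<close> may be positive (\<open>n = 1\<close>) or negative.\<close>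
lemma chart_lap_divergence:
  fixes F :: "real^'m::finite \<Rightarrow> complex"
  assumes F: "C_k 2 F"
  shows "(\<Sum>i\<in>UNIV. partial i (\<lambda>y. complex_of_real ((inv_conf y)\<^sup>2 / inv_conf y ^ CARD('m)) * partial i F y) x)
    = chart_lap F x / complex_of_real (inv_conf x ^ CARD('m))"
proof -
  define q where "q = complex_of_real (inv_conf x)"
  have q: "q \<noteq> 0" by (simp add: q_def)
  have F1: "partial k F differentiable (at z)" for z k
    using F by (auto simp: numeral_2_eq_2)
  have "partial i (\<lambda>y. complex_of_real ((inv_conf y)\<^sup>2 / inv_conf y ^ CARD('m)) * partial i F y) x
    = q\<^sup>2 / q ^ CARD('m) * partial i (partial i F) x
      + (2 - of_nat CARD('m)) * q / q ^ CARD('m) * (complex_of_real (x $ i) * partial i F x)" for i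
  proof -
    have "(\<lambda>y. complex_of_real ((inv_conf y)\<^sup>2 / inv_conf y ^ CARD('m))) differentiable (at x)"
      using has_derivative_inv_conf_ratio[of "CARD('m)" x] unfolding differentiable_def by blast
    from partial_mult[OF this F1] show ?thesis
      by (simp only: partial_eq[OF has_derivative_inv_conf_ratio]) (simp add: q_def inner_axis)
  qed
  then have "(\<Sum>i\<in>UNIV. partial i (\<lambda>y. complex_of_real ((inv_conf y)\<^sup>2 / inv_conf y ^ CARD('m)) * partial i F y) x)
    = q\<^sup>2 / q ^ CARD('m) * (\<Sum>i\<in>UNIV. partial i (partial i F) x)
      + (2 - of_nat CARD('m)) * q / q ^ CARD('m) * (\<Sum>i\<in>UNIV. complex_of_real (x $ i) * partial i F x)"
    by (simp add: sum.distrib sum_distrib_left)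
  also have "\<dots> = chart_lap F x / complex_of_real (inv_conf x ^ CARD('m))"
    unfolding chart_lap_def q_def[symmetric] of_real_power using q
    by (simp add: divide_simps algebra_simps)
  finally show ?thesis .
qed

lemma bounded_linear_r_coord: "bounded_linear r_coord"
  unfolding r_coord_def[abs_def] by (rule bounded_linear_vec_nth)

lemma bounded_linear_x_coord: "bounded_linear (x_coord :: real^('n::finite option) \<Rightarrow> real^'n)"
  unfolding linear_conv_bounded_linear[symmetric]
  by (rule linearI) (simp_all add: x_coord_def vec_eq_iff)

lemma r_coord_collar [simp]: "r_coord (collar_point x r) = r"
  by (simp add: r_coord_def collar_point_def)

lemma x_coord_collar [simp]: "x_coord (collar_point x r) = x"
  by (simp add: x_coord_def collar_point_def)

lemma coords_axis [simp]:
  "r_coord (axis None 1) = 1" "x_coord (axis None 1) = 0"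
  "r_coord (axis (Some i) 1) = 0" "x_coord (axis (Some i) 1) = axis i 1"
  by (simp_all add: r_coord_def x_coord_def axis_def vec_eq_iff)

text \<open>Both the eigenfunction candidates and their fluxes for \<open>g\<^sub>+\<close> are sums of products of a function
  of \<open>r\<close> and a function on the sphere. This rule therefore serves for the inner and for the outer
  derivative in the Laplacian.\<close>
lemma partial_separated:
  fixes y :: "real^('n::finite option)"
  assumes "finite J" "\<And>j. j \<in> J \<Longrightarrow> (\<phi> j has_vector_derivative \<phi>' j) (at (r_coord y))"
    "\<And>j. j \<in> J \<Longrightarrow> A j differentiable (at (x_coord y))"
  shows "partial None (\<lambda>y. \<Sum>j\<in>J. \<phi> j (r_coord y) * A j (x_coord y) :: complex) y
       = (\<Sum>j\<in>J. \<phi>' j * A j (x_coord y))"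
    and "partial (Some i) (\<lambda>y. \<Sum>j\<in>J. \<phi> j (r_coord y) * A j (x_coord y)) y
       = (\<Sum>j\<in>J. \<phi> j (r_coord y) * partial i (A j) (x_coord y))"
proof -
  have r: "((\<lambda>y. \<phi> j (r_coord y)) has_derivative (\<lambda>h. r_coord h *\<^sub>R \<phi>' j)) (at y)" if "j \<in> J" for j
    using diff_chain_at[OF bounded_linear_imp_has_derivative[OF bounded_linear_r_coord]
       assms(2)[OF that, unfolded has_vector_derivative_def]] by (simp add: o_def)
  have x: "((\<lambda>y. A j (x_coord y)) has_derivative (\<lambda>h. frechet_derivative (A j) (at (x_coord y)) (x_coord h))) (at y)"
    if "j \<in> J" for j
    using diff_chain_at[OF bounded_linear_imp_has_derivative[OF bounded_linear_x_coord]
       frechet_derivative_worksI[OF assms(3)[OF that]]] by (simp add: o_def)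
  have "((\<lambda>y. \<Sum>j\<in>J. \<phi> j (r_coord y) * A j (x_coord y)) has_derivative
     (\<lambda>h. \<Sum>j\<in>J. \<phi> j (r_coord y) * frechet_derivative (A j) (at (x_coord y)) (x_coord h)
         + (r_coord h *\<^sub>R \<phi>' j) * A j (x_coord y))) (at y)"
    by (intro has_derivative_sum has_derivative_mult r x)
  note D = partial_eq[OF this]
  have "frechet_derivative (A j) (at (x_coord y)) 0 = 0" if "j \<in> J" for j
    using linear_0 linear_frechet_derivative[OF assms(3)[OF that]] by blast
  then show "partial None (\<lambda>y. \<Sum>j\<in>J. \<phi> j (r_coord y) * A j (x_coord y) :: complex) y
       = (\<Sum>j\<in>J. \<phi>' j * A j (x_coord y))"
    unfolding D by (intro sum.cong) auto
  show "partial (Some i) (\<lambda>y. \<Sum>j\<in>J. \<phi> j (r_coord y) * A j (x_coord y)) y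
       = (\<Sum>j\<in>J. \<phi> j (r_coord y) * partial i (A j) (x_coord y))"
    unfolding D by (intro sum.cong) (auto simp: partial_def)
qed

definition collar_scale :: "real \<Rightarrow> real" where "collar_scale r = 1 - r\<^sup>2 / 4"

lemma collar_scale_pos: "0 < r \<Longrightarrow> r < 2 \<Longrightarrow> collar_scale r > 0"
proof -
  assume "0 < r" "r < 2"
  then have "r * r < 2 * 2" by (intro mult_strict_mono) auto
  then show ?thesis by (simp add: collar_scale_def power2_eq_square)
qed

definition g_plus_diag :: "real^('n::finite option) \<Rightarrow> 'n option \<Rightarrow> real" where
  "g_plus_diag y a = (case a of None \<Rightarrow> 1 / (r_coord y)\<^sup>2
     | Some i \<Rightarrow> (collar_scale (r_coord y))\<^sup>2 / ((inv_conf (x_coord y))\<^sup>2 * (r_coord y)\<^sup>2))"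

lemma g_plus_eq_diag:
  assumes "s \<in> {1, -1}"
  shows "g_plus s y = (\<chi> a b. if a = b then g_plus_diag y a else 0)"
  by (auto simp: g_plus_def vec_eq_iff g_plus_diag_def h_metric_def round_metric_eq[OF assms] collar_scale_def
      split: option.splits)

lemma sum_UNIV_option: "(\<Sum>a\<in>UNIV. f a) = f None + (\<Sum>i\<in>UNIV. f (Some i))"
  for f :: "'n::finite option \<Rightarrow> 'b::comm_monoid_add"
  by (simp add: UNIV_option_conv sum.reindex)

lemma prod_UNIV_option: "(\<Prod>a\<in>UNIV. f a) = f None * (\<Prod>i\<in>UNIV. f (Some i))"
  for f :: "'n::finite option \<Rightarrow> 'b::comm_monoid_mult"
  by (simp add: UNIV_option_conv prod.reindex)

lemma sqrt_det_g_plus: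
  fixes y :: "real^('n::finite option)"
  assumes "s \<in> {1, -1}" "0 < r_coord y" "r_coord y < 2"
  shows "sqrt (det (g_plus s y)) =
     collar_scale (r_coord y) ^ CARD('n) / (r_coord y ^ Suc CARD('n) * inv_conf (x_coord y) ^ CARD('n))"
  using assms collar_scale_pos[OF assms(2,3)] inv_conf_pos[of "x_coord y"]
  unfolding g_plus_eq_diag[OF assms(1)] det_diag prod_UNIV_option
  by (simp add: g_plus_diag_def real_sqrt_power real_sqrt_divide real_sqrt_mult order_less_imp_le
      power_divide power_mult_distrib mult_ac)

text \<open>As \<open>g\<^sub>+\<close> is diagonal in these coordinates, each component of the flux involves only one
  derivative.\<close>
lemma g_plus_flux:
  fixes y :: "real^('n::finite option)"
  assumes s: "s \<in> {1, -1}" and r: "0 < r_coord y" "r_coord y < 2"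
  shows "(\<Sum>b\<in>UNIV. (c * matrix_inv (g_plus s y) $ a $ b) *\<^sub>R D b)
    = (c / g_plus_diag y a) *\<^sub>R (D a :: complex)"
proof -
  have "g_plus_diag y a \<noteq> 0" for a
    using r collar_scale_pos[OF r] by (auto simp: g_plus_diag_def split: option.splits)
  then have "matrix_inv (g_plus s y) = (\<chi> a b. if a = b then 1 / g_plus_diag y a else 0)"
    unfolding g_plus_eq_diag[OF s] by (intro matrix_inv_diag) auto
  then have "(\<Sum>b\<in>UNIV. (c * matrix_inv (g_plus s y) $ a $ b) *\<^sub>R D b)
     = (\<Sum>b\<in>UNIV. if a = b then (c / g_plus_diag y a) *\<^sub>R D b else 0)"
    by (intro sum.cong) auto
  then show ?thesis by simp
qed

lemma eventually_collar:
  assumes "0 < r" "r < 2"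
  shows "\<forall>\<^sub>F y in nhds (collar_point x r). 0 < r_coord y \<and> r_coord y < 2"
proof -
  have "open {y :: real^('n::finite option). 0 < r_coord y \<and> r_coord y < 2}"
    unfolding r_coord_def by (intro open_Collect_conj open_Collect_less continuous_intros)
  then show ?thesis using assms by (auto simp: eventually_nhds)
qed

text \<open>The radial part of \<open>sqrt (det g\<^sub>+) g\<^sub>+\<^sup>r\<^sup>r\<close>; the remaining factor is \<open>inv_conf\<^sup>-\<^sup>n\<close>.\<close>
definition radial_weight :: "nat \<Rightarrow> real \<Rightarrow> real" where "radial_weight n r = collar_scale r ^ n * r\<^sup>2 / r ^ Suc n"

text \<open>Separation of variables: with the weight \<open>w = radial_weight\<close>, the Laplacian of \<open>\<phi>(r) a(x)\<close> is
  \<open>r\<^sup>n\<^sup>+\<^sup>1 (1 - r\<^sup>2/4)\<^sup>-\<^sup>n (w \<phi>')' a + r\<^sup>2 (1 - r\<^sup>2/4)\<^sup>-\<^sup>2 \<phi> \<Delta>a\<close>. The derivative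
  \<open>\<psi>' = (w \<phi>')'\<close> is left to the caller.\<close>
lemma laplace_g_plus_separated:
  fixes x :: "real^'n::finite" and a :: "'j \<Rightarrow> 'n usphere \<Rightarrow> complex" and \<phi> \<phi>' :: "'j \<Rightarrow> real \<Rightarrow> complex"
    and \<psi>' :: "'j \<Rightarrow> complex"
  assumes s: "s \<in> {1, -1}" and r: "0 < r" "r < 2" and J: "finite J"
    and A: "\<And>j. j \<in> J \<Longrightarrow> C_k 2 (\<lambda>x. a j (stereo s x))"
    and \<phi>: "\<And>j t. j \<in> J \<Longrightarrow> 0 < t \<Longrightarrow> (\<phi> j has_vector_derivative \<phi>' j t) (at t)"
    and \<psi>: "\<And>j. j \<in> J \<Longrightarrow> ((\<lambda>t. radial_weight CARD('n) t * \<phi>' j t) has_vector_derivative \<psi>' j) (at r)"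
  shows "laplace_g_plus s (\<lambda>p r. \<Sum>j\<in>J. \<phi> j r * a j p) x r =
     (\<Sum>j\<in>J. r ^ Suc CARD('n) / collar_scale r ^ CARD('n) * \<psi>' j * a j (stereo s x)
        + r\<^sup>2 / (collar_scale r)\<^sup>2 * \<phi> j r * chart_lap (\<lambda>x. a j (stereo s x)) x)"
proof -
  let ?n = "CARD('n)"
  define A' where "A' j = (\<lambda>x. a j (stereo s x))" for j
  define U where "U = (\<lambda>y::real^('n option). \<Sum>j\<in>J. \<phi> j (r_coord y) * A' j (x_coord y))"
  have A1: "A' j differentiable (at z)" "partial i (A' j) differentiable (at z)" if "j \<in> J" for j i z
    using A[OF that] by (auto simp: numeral_2_eq_2 A'_def)
  define V where "V a = (\<lambda>y. \<Sum>b\<in>UNIV. (sqrt (det (g_plus s y)) * matrix_inv (g_plus s y) $ a $ b) *\<^sub>R partial b U y)" for a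
  let ?y = "collar_point x r"
  have "V None y = (\<Sum>j\<in>J. (radial_weight ?n (r_coord y) * \<phi>' j (r_coord y)) * (complex_of_real (1 / inv_conf (x_coord y) ^ ?n) * A' j (x_coord y)))"
    if y: "0 < r_coord y \<and> r_coord y < 2" for y
  proof -
    have "partial None U y = (\<Sum>j\<in>J. \<phi>' j (r_coord y) * A' j (x_coord y))"
      unfolding U_def using J \<phi> A1 y by (intro partial_separated) auto
    moreover have "sqrt (det (g_plus s y)) / g_plus_diag y None = radial_weight ?n (r_coord y) / inv_conf (x_coord y) ^ ?n"
      using y sqrt_det_g_plus[OF s, of y] by (simp add: g_plus_diag_def radial_weight_def mult_ac)
    ultimately show ?thesis
      unfolding V_def g_plus_flux[OF s conjunct1[OF y] conjunct2[OF y]]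
      by (simp add: sum_distrib_left sum_divide_distrib scaleR_conv_of_real mult_ac)
  qed
  then have "\<forall>\<^sub>F y in nhds ?y. V None y = (\<Sum>j\<in>J. (radial_weight ?n (r_coord y) * \<phi>' j (r_coord y)) * (complex_of_real (1 / inv_conf (x_coord y) ^ ?n) * A' j (x_coord y)))"
    using eventually_collar[OF r] by (rule eventually_mono[rotated])
  then have "partial None (V None) ?y = partial None (\<lambda>y. \<Sum>j\<in>J. (radial_weight ?n (r_coord y) * \<phi>' j (r_coord y)) * (complex_of_real (1 / inv_conf (x_coord y) ^ ?n) * A' j (x_coord y))) ?y"
    by (rule partial_cong)
  also have "\<dots> = (\<Sum>j\<in>J. \<psi>' j * (complex_of_real (1 / inv_conf x ^ ?n) * A' j x))"
  proof -
    have q: "(\<lambda>z. complex_of_real (1 / inv_conf z ^ ?n)) differentiable (at z)" for z :: "real^'n"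
    proof -
      have "(inv_conf has_derivative (\<lambda>h. z \<bullet> h)) (at z)" by (rule has_derivative_inv_conf)
      then have "(\<lambda>z. 1 / inv_conf z ^ ?n) differentiable (at z)"
        by (intro differentiable_divide differentiable_power differentiable_const)
           (auto simp: differentiable_def)
      then show ?thesis
        using bounded_linear.has_derivative[OF bounded_linear_of_real] unfolding differentiable_def by blast
    qed
    show ?thesis
      using J \<psi> differentiable_mult[OF q A1(1)]
      by (subst partial_separated(1)[where \<phi> = "\<lambda>j t. radial_weight ?n t * \<phi>' j t" and \<phi>' = \<psi>']) auto
  qed
  finally have VN: "partial None (V None) ?y = (\<Sum>j\<in>J. \<psi>' j * (complex_of_real (1 / inv_conf x ^ ?n) * A' j x))" .

  have "V (Some i) y = (\<Sum>j\<in>J. (complex_of_real (radial_weight ?n (r_coord y) / (collar_scale (r_coord y))\<^sup>2) * \<phi> j (r_coord y)) *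
       (complex_of_real ((inv_conf (x_coord y))\<^sup>2 / inv_conf (x_coord y) ^ ?n) * partial i (A' j) (x_coord y)))"
    if y: "0 < r_coord y \<and> r_coord y < 2" for y i
  proof -
    have "partial (Some i) U y = (\<Sum>j\<in>J. \<phi> j (r_coord y) * partial i (A' j) (x_coord y))"
      unfolding U_def using J \<phi> A1 y by (intro partial_separated(2)[where \<phi>' = "\<lambda>j. \<phi>' j (r_coord y)"]) auto
    moreover have "sqrt (det (g_plus s y)) / g_plus_diag y (Some i) =
        radial_weight ?n (r_coord y) / (collar_scale (r_coord y))\<^sup>2 * ((inv_conf (x_coord y))\<^sup>2 / inv_conf (x_coord y) ^ ?n)"
      using y sqrt_det_g_plus[OF s, of y] by (simp add: g_plus_diag_def radial_weight_def mult_ac)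
    ultimately show ?thesis
      unfolding V_def g_plus_flux[OF s conjunct1[OF y] conjunct2[OF y]]
      by (simp add: sum_distrib_left sum_divide_distrib scaleR_conv_of_real mult_ac)
  qed
  then have "\<forall>\<^sub>F y in nhds ?y. V (Some i) y = (\<Sum>j\<in>J. (complex_of_real (radial_weight ?n (r_coord y) / (collar_scale (r_coord y))\<^sup>2) * \<phi> j (r_coord y)) *
       (complex_of_real ((inv_conf (x_coord y))\<^sup>2 / inv_conf (x_coord y) ^ ?n) * partial i (A' j) (x_coord y)))" for i
    using eventually_collar[OF r] by (rule eventually_mono[rotated])
  then have "partial (Some i) (V (Some i)) ?y = partial (Some i) (\<lambda>y. \<Sum>j\<in>J. (complex_of_real (radial_weight ?n (r_coord y) / (collar_scale (r_coord y))\<^sup>2) * \<phi> j (r_coord y)) *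
       (complex_of_real ((inv_conf (x_coord y))\<^sup>2 / inv_conf (x_coord y) ^ ?n) * partial i (A' j) (x_coord y))) ?y" for i
    by (rule partial_cong)
  also have "\<dots> i = (\<Sum>j\<in>J. (complex_of_real (radial_weight ?n r / (collar_scale r)\<^sup>2) * \<phi> j r) *
       partial i (\<lambda>x. complex_of_real ((inv_conf x)\<^sup>2 / inv_conf x ^ ?n) * partial i (A' j) x) x)" for i
  proof -
    have "(\<lambda>z. radial_weight ?n z / (collar_scale z)\<^sup>2) differentiable (at r)"
      unfolding radial_weight_def collar_scale_def using r collar_scale_pos[OF r]
      by (intro differentiable_divide differentiable_mult differentiable_power differentiable_diff
           differentiable_const differentiable_ident) (auto simp: collar_scale_def)
    then obtain w' where w': "((\<lambda>z. radial_weight ?n z / (collar_scale z)\<^sup>2) has_real_derivative w') (at r)"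
      by (rule real_differentiableE)
    have "((\<lambda>z. complex_of_real (radial_weight ?n z / (collar_scale z)\<^sup>2) * \<phi> j z) has_vector_derivative
        (complex_of_real (radial_weight ?n r / (collar_scale r)\<^sup>2) * \<phi>' j r + of_real w' * \<phi> j r)) (at r)" if "j \<in> J" for j
      using that r by (intro has_vector_derivative_mult has_vector_derivative_of_real w' \<phi>)
    moreover have "(\<lambda>x. complex_of_real ((inv_conf x)\<^sup>2 / inv_conf x ^ ?n) * partial i (A' j) x) differentiable (at x)" if "j \<in> J" for j
      using has_derivative_inv_conf_ratio[of ?n x] A1(2)[OF that]
      by (intro differentiable_mult) (auto simp: differentiable_def)
    ultimately show ?thesis
      using J by (subst partial_separated(2)[where \<phi>' = "\<lambda>j. complex_of_real (radial_weight ?n r / (collar_scale r)\<^sup>2) * \<phi>' j r + of_real (w' ) * \<phi> j r"]) auto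
  qed
  finally have "(\<Sum>i\<in>UNIV. partial (Some i) (V (Some i)) ?y) = (\<Sum>i\<in>UNIV. \<Sum>j\<in>J. (complex_of_real (radial_weight ?n r / (collar_scale r)\<^sup>2) * \<phi> j r) *
       partial i (\<lambda>x. complex_of_real ((inv_conf x)\<^sup>2 / inv_conf x ^ ?n) * partial i (A' j) x) x)"
    by (rule sum.cong[OF refl])
  also have "\<dots> = (\<Sum>j\<in>J. (complex_of_real (radial_weight ?n r / (collar_scale r)\<^sup>2) * \<phi> j r) *
       (\<Sum>i\<in>UNIV. partial i (\<lambda>x. complex_of_real ((inv_conf x)\<^sup>2 / inv_conf x ^ ?n) * partial i (A' j) x) x))"
    by (subst sum.swap) (simp only: sum_distrib_left)
  also have "\<dots> = (\<Sum>j\<in>J. (complex_of_real (radial_weight ?n r / (collar_scale r)\<^sup>2) * \<phi> j r) *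
       (chart_lap (A' j) x / complex_of_real (inv_conf x ^ ?n)))"
    using A by (intro sum.cong arg_cong2[where f = "(*)"] chart_lap_divergence) (auto simp: A'_def)
  finally have VS: "(\<Sum>i\<in>UNIV. partial (Some i) (V (Some i)) ?y) = (\<Sum>j\<in>J. (complex_of_real (radial_weight ?n r / (collar_scale r)\<^sup>2) * \<phi> j r) *
       (chart_lap (A' j) x / complex_of_real (inv_conf x ^ ?n)))" .
  have U: "(\<lambda>y. (\<lambda>p r. \<Sum>j\<in>J. \<phi> j r * a j p) (stereo s (x_coord y)) (r_coord y)) = U"
    by (simp add: U_def A'_def)
  have "laplace_g_plus s (\<lambda>p r. \<Sum>j\<in>J. \<phi> j r * a j p) x r =
     (\<Sum>a\<in>UNIV. partial a (V a) ?y) /\<^sub>R sqrt (det (g_plus s ?y))"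
    unfolding laplace_g_plus_def laplace_beltrami_def U V_def ..
  also have "\<dots> = (r ^ Suc ?n * inv_conf x ^ ?n / collar_scale r ^ ?n) *\<^sub>R
     ((\<Sum>j\<in>J. \<psi>' j * (complex_of_real (1 / inv_conf x ^ ?n) * A' j x)) +
      (\<Sum>j\<in>J. (complex_of_real (radial_weight ?n r / (collar_scale r)\<^sup>2) * \<phi> j r) *
       (chart_lap (A' j) x / complex_of_real (inv_conf x ^ ?n))))"
    unfolding sum_UNIV_option VN VS using s r by (simp add: sqrt_det_g_plus)
  also have "\<dots> = (\<Sum>j\<in>J. r ^ Suc ?n / collar_scale r ^ ?n * \<psi>' j * A' j x
        + r\<^sup>2 / (collar_scale r)\<^sup>2 * \<phi> j r * chart_lap (A' j) x)"
    unfolding sum.distrib[symmetric] scaleR_sum_right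
  proof (rule sum.cong[OF refl])
    fix j
    have nz: "complex_of_real r \<noteq> 0" "complex_of_real (collar_scale r) \<noteq> 0" "complex_of_real (inv_conf x) \<noteq> 0"
      using r collar_scale_pos[OF r] by auto
    then show "(r ^ Suc ?n * inv_conf x ^ ?n / collar_scale r ^ ?n) *\<^sub>R
      (\<psi>' j * (complex_of_real (1 / inv_conf x ^ ?n) * A' j x) +
       (complex_of_real (radial_weight ?n r / (collar_scale r)\<^sup>2) * \<phi> j r) *
       (chart_lap (A' j) x / complex_of_real (inv_conf x ^ ?n))) =
      r ^ Suc ?n / collar_scale r ^ ?n * \<psi>' j * A' j x
        + r\<^sup>2 / (collar_scale r)\<^sup>2 * \<phi> j r * chart_lap (A' j) x"
      unfolding scaleR_conv_of_real radial_weight_def of_real_mult of_real_divide of_real_power of_real_1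
      by (simp add: divide_simps algebra_simps)
  qed
  finally show ?thesis by (simp add: A'_def)
qed

lemma has_vector_derivative_powr:
  assumes "0 < t"
  shows "((\<lambda>t. complex_of_real t powr \<nu>) has_vector_derivative \<nu> * complex_of_real t powr (\<nu> - 1)) (at t)"
proof -
  have "((\<lambda>z. z powr \<nu>) has_field_derivative \<nu> * complex_of_real t powr (\<nu> - 1)) (at (complex_of_real t))"
    using assms by (intro has_field_derivative_powr) (simp add: complex_nonpos_Reals_iff)
  from field_vector_diff_chain_at[OF has_vector_derivative_of_real[OF DERIV_ident] this]
  show ?thesis by (simp add: o_def)
qed

lemma has_real_derivative_radial_weight:
  assumes "0 < r" "r < 2"
  shows "(radial_weight n has_real_derivative radial_weight n r * ((1 - real n) / r - real n * r / (2 * collar_scale r))) (at r)"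
proof -
  have nz: "collar_scale r \<noteq> 0" "r \<noteq> 0" using collar_scale_pos[OF assms] assms by auto
  have "(collar_scale has_field_derivative (- r / 2)) (at r)"
    unfolding collar_scale_def by (auto intro!: derivative_eq_intros)
  from DERIV_divide[OF DERIV_mult[OF DERIV_power_div[OF this, of n] DERIV_power_div[OF DERIV_ident, of r 2]]
       DERIV_power_div[OF DERIV_ident, of r "Suc n"]]
  have "(radial_weight n has_real_derivative
      ((real n * collar_scale r ^ n / collar_scale r * (- r / 2) * r\<^sup>2 + real 2 * r\<^sup>2 / r * 1 * collar_scale r ^ n) * r ^ Suc n
        - collar_scale r ^ n * r\<^sup>2 * (real (Suc n) * r ^ Suc n / r * 1)) / (r ^ Suc n * r ^ Suc n)) (at r)"
    unfolding radial_weight_def[abs_def] using nz by simp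
  also have "((real n * collar_scale r ^ n / collar_scale r * (- r / 2) * r\<^sup>2 + real 2 * r\<^sup>2 / r * 1 * collar_scale r ^ n) * r ^ Suc n
        - collar_scale r ^ n * r\<^sup>2 * (real (Suc n) * r ^ Suc n / r * 1)) / (r ^ Suc n * r ^ Suc n)
     = radial_weight n r * ((1 - real n) / r - real n * r / (2 * collar_scale r))"
    unfolding radial_weight_def using nz by (simp add: field_simps power2_eq_square)
  finally show ?thesis .
qed

lemma laplace_g_plus_partial_sol:
  fixes x :: "real^'n::finite"
  assumes s: "s \<in> {1, -1}" and r: "0 < r" "r < 2" and a: "\<And>j. a j \<in> smooth_on_sphere"
  shows "laplace_g_plus s (partial_sol \<mu> a M) x r =
     (\<Sum>j\<le>M. complex_of_real r powr (\<mu> + 2 * of_nat j) *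
        (((\<mu> + 2 * of_nat j) * (\<mu> + 2 * of_nat j - of_nat CARD('n))
            - of_nat CARD('n) * (\<mu> + 2 * of_nat j) * of_real (r\<^sup>2) / (2 * of_real (collar_scale r))) * a j (stereo s x)
         + of_real (r\<^sup>2) / (of_real (collar_scale r))\<^sup>2 * sphere_lap (a j) (stereo s x)))"
proof -
  let ?n = "CARD('n)"
  define \<nu> where "\<nu> j = \<mu> + 2 * of_nat j" for j
  define \<psi>' where "\<psi>' j = radial_weight ?n r * (\<nu> j * ((\<nu> j - 1) * complex_of_real r powr (\<nu> j - 1 - 1)))
     + of_real (radial_weight ?n r * ((1 - real ?n) / r - real ?n * r / (2 * collar_scale r))) * (\<nu> j * complex_of_real r powr (\<nu> j - 1))" for j
  have \<psi>: "((\<lambda>t. radial_weight ?n t * (\<nu> j * complex_of_real t powr (\<nu> j - 1))) has_vector_derivative \<psi>' j) (at r)" for j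
    unfolding \<psi>'_def
    by (intro has_vector_derivative_mult has_vector_derivative_of_real has_real_derivative_radial_weight r
        has_vector_derivative_mult_right has_vector_derivative_powr)
  have "laplace_g_plus s (partial_sol \<mu> a M) x r =
     laplace_g_plus s (\<lambda>p r. \<Sum>j\<in>{..M}. complex_of_real r powr \<nu> j * a j p) x r"
    by (simp add: partial_sol_def[abs_def] \<nu>_def)
  also have "\<dots> = (\<Sum>j\<le>M. r ^ Suc ?n / collar_scale r ^ ?n * \<psi>' j * a j (stereo s x)
        + r\<^sup>2 / (collar_scale r)\<^sup>2 * complex_of_real r powr \<nu> j * chart_lap (\<lambda>x. a j (stereo s x)) x)"
    by (rule laplace_g_plus_separated[OF s r _ smooth_C_k[OF a s] has_vector_derivative_powr \<psi>]) auto
  also have "\<dots> = (\<Sum>j\<le>M. complex_of_real r powr \<nu> j *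
        ((\<nu> j * (\<nu> j - of_nat ?n)
            - of_nat ?n * \<nu> j * of_real (r\<^sup>2) / (2 * of_real (collar_scale r))) * a j (stereo s x)
         + of_real (r\<^sup>2) / (of_real (collar_scale r))\<^sup>2 * sphere_lap (a j) (stereo s x)))"
  proof (rule sum.cong[OF refl])
    fix j
    define R K where "R = complex_of_real r" and "K = complex_of_real (collar_scale r)"
    have nz: "R \<noteq> 0" "K \<noteq> 0"
      using r collar_scale_pos[OF r] by (auto simp: R_def K_def)
    have p1: "R powr (\<nu> j - 1) = R powr \<nu> j / R" "R powr (\<nu> j - 1 - 1) = R powr \<nu> j / R\<^sup>2"
      using nz by (simp_all add: powr_diff power2_eq_square)
    have "r ^ Suc ?n / collar_scale r ^ ?n * \<psi>' j = R powr \<nu> j * (\<nu> j * (\<nu> j - of_nat ?n)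
            - of_nat ?n * \<nu> j * R\<^sup>2 / (2 * K))"
      unfolding \<psi>'_def radial_weight_def of_real_mult of_real_divide of_real_power of_real_diff of_real_1 of_real_of_nat_eq
        of_real_numeral R_def[symmetric] K_def[symmetric] p1
      using nz by (simp add: divide_simps) (simp add: algebra_simps power2_eq_square)
    from this show "r ^ Suc ?n / collar_scale r ^ ?n * \<psi>' j * a j (stereo s x)
        + r\<^sup>2 / (collar_scale r)\<^sup>2 * complex_of_real r powr \<nu> j * chart_lap (\<lambda>x. a j (stereo s x)) x
      = complex_of_real r powr \<nu> j *
        ((\<nu> j * (\<nu> j - of_nat ?n)
            - of_nat ?n * \<nu> j * of_real (r\<^sup>2) / (2 * of_real (collar_scale r))) * a j (stereo s x)
         + of_real (r\<^sup>2) / (of_real (collar_scale r))\<^sup>2 * sphere_lap (a j) (stereo s x))"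
      by (simp only: sphere_lap_stereo[OF a s] R_def K_def of_real_power of_real_divide)
         (simp only: distrib_left mult_ac)
  qed
  finally show ?thesis unfolding \<nu>_def .
qed

section \<open>Formal eigenfunctions\<close>

text \<open>Let \<open>t = r\<^sup>2\<close>. Multiplied by \<open>r\<^sup>-\<^sup>\<mu> (1 - t/4)\<^sup>2\<close>, the eigenvalue defect of
  \<open>r\<^sup>\<mu>\<^sup>+\<^sup>2\<^sup>j a\<^sub>j\<close> is a polynomial in \<open>t\<close>, and only \<open>t\<^sup>j\<close>, \<open>t\<^sup>j\<^sup>+\<^sup>1\<close> and \<open>t\<^sup>j\<^sup>+\<^sup>2\<close> occur. The following
  three functions are the coefficients of \<open>a\<^sub>j\<close> in front of these powers, while the Laplacian of
  \<open>a\<^sub>j\<close> enters at \<open>t\<^sup>j\<^sup>+\<^sup>1\<close> only. Here \<open>n\<close> is a complex number, the dimension.\<close>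
definition indicial :: "complex \<Rightarrow> complex \<Rightarrow> nat \<Rightarrow> complex" where
  "indicial n \<mu> j = - (2 * of_nat j * (2 * \<mu> + 2 * of_nat j - n))"

definition first_shift :: "complex \<Rightarrow> complex \<Rightarrow> nat \<Rightarrow> complex" where
  "first_shift n \<mu> j = n / 2 * (\<mu> + 2 * of_nat j) - indicial n \<mu> j / 2"

definition second_shift :: "complex \<Rightarrow> complex \<Rightarrow> nat \<Rightarrow> complex" where
  "second_shift n \<mu> j = indicial n \<mu> j / 16 - n / 8 * (\<mu> + 2 * of_nat j)"

text \<open>\<open>residual n \<mu> a L k\<close> is the coefficient of \<open>t\<^sup>k\<close> in the defect of the whole series, and
  \<open>subleading\<close> collects what earlier coefficients contribute to it. The argument \<open>L j\<close> stands for
  the Laplacian of \<open>a j\<close>, at a point or, later, after integration. At \<open>k = 0\<close> there is no condition,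
  since \<open>\<mu>\<close> is an indicial root.\<close>
fun subleading :: "complex \<Rightarrow> complex \<Rightarrow> (nat \<Rightarrow> complex) \<Rightarrow> (nat \<Rightarrow> complex) \<Rightarrow> nat \<Rightarrow> complex" where
  "subleading n \<mu> a L 0 = first_shift n \<mu> 0 * a 0 - L 0"
| "subleading n \<mu> a L (Suc k) = first_shift n \<mu> (Suc k) * a (Suc k) - L (Suc k) + second_shift n \<mu> k * a k"

fun residual :: "complex \<Rightarrow> complex \<Rightarrow> (nat \<Rightarrow> complex) \<Rightarrow> (nat \<Rightarrow> complex) \<Rightarrow> nat \<Rightarrow> complex" where
  "residual n \<mu> a L 0 = 0"
| "residual n \<mu> a L (Suc k) = indicial n \<mu> (Suc k) * a (Suc k) + subleading n \<mu> a L k"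

lemma indicial_0 [simp]: "indicial n \<mu> 0 = 0"
  by (simp add: indicial_def)

text \<open>Truncation at \<open>M\<close> spoils only the powers beyond \<open>t\<^sup>M\<close>.\<close>
lemma residual_expansion:
  "(\<Sum>j\<le>M. t ^ j * (indicial n \<mu> j * a j + (first_shift n \<mu> j * a j - L j) * t + second_shift n \<mu> j * a j * t\<^sup>2))
   = (\<Sum>k\<le>M. residual n \<mu> a L k * t ^ k)
     + t ^ Suc M * (subleading n \<mu> a L M + second_shift n \<mu> M * a M * t)"
proof (induction M)
  case (Suc M)
  then show ?case by (simp add: algebra_simps power2_eq_square)
qed (simp add: algebra_simps power2_eq_square)

lemma eigen_defect:
  fixes x :: "real^'n::finite" and n :: complex
  assumes s: "s \<in> {1, -1}" and r: "0 < r" "r < 2" and a: "\<And>j. a j \<in> smooth_on_sphere"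
  defines "n \<equiv> of_nat CARD('n)"
  shows "- laplace_g_plus s (partial_sol \<mu> a M) x r
              - \<mu> * (of_nat CARD('n) - \<mu>) * partial_sol \<mu> a M (stereo s x) r
    = complex_of_real r powr \<mu> / (complex_of_real (collar_scale r))\<^sup>2 *
      ((\<Sum>k\<le>M. residual n \<mu> (\<lambda>j. a j (stereo s x)) (\<lambda>j. sphere_lap (a j) (stereo s x)) k * complex_of_real (r\<^sup>2) ^ k)
     + complex_of_real (r\<^sup>2) ^ Suc M *
        (subleading n \<mu> (\<lambda>j. a j (stereo s x)) (\<lambda>j. sphere_lap (a j) (stereo s x)) M
          + second_shift n \<mu> M * a M (stereo s x) * complex_of_real (r\<^sup>2)))"
proof -
  define t K where "t = complex_of_real (r\<^sup>2)" and "K = complex_of_real (collar_scale r)"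
  define A L where "A j = a j (stereo s x)" and "L j = sphere_lap (a j) (stereo s x)" for j
  have K: "K = 1 - t / 4" "K \<noteq> 0"
    using collar_scale_pos[OF r] by (simp_all only: K_def of_real_eq_0_iff) (simp_all add: t_def collar_scale_def)
  have pow: "complex_of_real r powr (\<mu> + 2 * of_nat j) = complex_of_real r powr \<mu> * t ^ j" for j
  proof -
    have "complex_of_real r powr (2 * of_nat j) = complex_of_real r powr (of_nat (2 * j))" by simp
    also have "\<dots> = complex_of_real r ^ (2 * j)"
      using r by (subst powr_nat') auto
    finally show ?thesis by (simp add: powr_add t_def power_mult)
  qed
  have "- laplace_g_plus s (partial_sol \<mu> a M) x r
              - \<mu> * (of_nat CARD('n) - \<mu>) * partial_sol \<mu> a M (stereo s x) r
    = (\<Sum>j\<le>M. complex_of_real r powr \<mu> / K\<^sup>2 *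
        (t ^ j * (indicial n \<mu> j * A j + (first_shift n \<mu> j * A j - L j) * t + second_shift n \<mu> j * A j * t\<^sup>2)))"
    unfolding laplace_g_plus_partial_sol[OF s r a] partial_sol_def pow
      sum_negf[symmetric] sum_distrib_left sum_subtractf[symmetric]
  proof (rule sum.cong[OF refl])
    fix j
    define P where "P = complex_of_real r powr \<mu>"
    have "- (((\<mu> + 2 * of_nat j) * (\<mu> + 2 * of_nat j - n)
            - n * (\<mu> + 2 * of_nat j) * t / (2 * K)) * A j
         + t / K\<^sup>2 * L j) - \<mu> * (n - \<mu>) * A j =
        (indicial n \<mu> j * A j * K\<^sup>2 + n / 2 * (\<mu> + 2 * of_nat j) * t * K * A j - L j * t) / K\<^sup>2"
      using K(2) unfolding indicial_def by (simp add: divide_simps) (simp add: algebra_simps power2_eq_square)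
    also have "\<dots> = (indicial n \<mu> j * A j + (first_shift n \<mu> j * A j - L j) * t + second_shift n \<mu> j * A j * t\<^sup>2) / K\<^sup>2"
      by (intro arg_cong2[where f = "(/)"] refl)
        (simp add: first_shift_def second_shift_def K(1) field_simps power2_eq_square)
    finally have *: "- (((\<mu> + 2 * of_nat j) * (\<mu> + 2 * of_nat j - n)
            - n * (\<mu> + 2 * of_nat j) * t / (2 * K)) * A j
         + t / K\<^sup>2 * L j) - \<mu> * (n - \<mu>) * A j = \<dots>" .
    have "- (P * t ^ j *
        (((\<mu> + 2 * of_nat j) * (\<mu> + 2 * of_nat j - n)
            - n * (\<mu> + 2 * of_nat j) * t / (2 * K)) * A j
         + t / K\<^sup>2 * L j)) - \<mu> * (n - \<mu>) * (P * t ^ j * A j)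
      = P * t ^ j * (- (((\<mu> + 2 * of_nat j) * (\<mu> + 2 * of_nat j - n)
            - n * (\<mu> + 2 * of_nat j) * t / (2 * K)) * A j
         + t / K\<^sup>2 * L j) - \<mu> * (n - \<mu>) * A j)"
      by (simp add: algebra_simps)
    also have "\<dots> = P / K\<^sup>2 *
        (t ^ j * (indicial n \<mu> j * A j + (first_shift n \<mu> j * A j - L j) * t + second_shift n \<mu> j * A j * t\<^sup>2))"
      unfolding * by simp
    finally show "- (complex_of_real r powr \<mu> * t ^ j *
        (((\<mu> + 2 * of_nat j) * (\<mu> + 2 * of_nat j - of_nat CARD('n))
            - of_nat CARD('n) * (\<mu> + 2 * of_nat j) * of_real (r\<^sup>2) / (2 * of_real (collar_scale r))) * a j (stereo s x)
         + of_real (r\<^sup>2) / (of_real (collar_scale r))\<^sup>2 * sphere_lap (a j) (stereo s x)))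
       - \<mu> * (of_nat CARD('n) - \<mu>) * (complex_of_real r powr \<mu> * t ^ j * a j (stereo s x))
      = complex_of_real r powr \<mu> / K\<^sup>2 *
        (t ^ j * (indicial n \<mu> j * A j + (first_shift n \<mu> j * A j - L j) * t + second_shift n \<mu> j * A j * t\<^sup>2))"
      unfolding P_def t_def K_def A_def L_def n_def .
  qed
  also have "\<dots> = complex_of_real r powr \<mu> / K\<^sup>2 * ((\<Sum>k\<le>M. residual n \<mu> A L k * t ^ k)
     + t ^ Suc M * (subleading n \<mu> A L M + second_shift n \<mu> M * A M * t))"
    unfolding sum_distrib_left[symmetric] residual_expansion ..
  finally show ?thesis unfolding t_def K_def A_def[abs_def] L_def[abs_def] .
qed

lemma norm_powr_step:
  assumes "0 < r"
  shows "norm (complex_of_real r powr (\<mu> + 2 * of_nat M + 2)) = norm (complex_of_real r powr \<mu>) * r ^ (2 * Suc M)"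
proof -
  have "\<mu> + 2 * of_nat M + 2 = \<mu> + of_nat (2 * Suc M)" by simp
  moreover have "complex_of_real r powr of_nat (2 * Suc M) = complex_of_real r ^ (2 * Suc M)"
    using assms by (subst powr_nat') auto
  ultimately show ?thesis
    using assms by (simp only: powr_add norm_mult norm_power norm_of_real abs_of_pos)
qed

text \<open>The factor \<open>(1 - r\<^sup>2/4)\<^sup>-\<^sup>2\<close> is bounded near \<open>r = 0\<close>, and \<open>r\<^sup>\<mu>\<close> occurs on both sides.\<close>
lemma bigo_of_high_order:
  "(\<lambda>r. complex_of_real r powr \<mu> / (complex_of_real (collar_scale r))\<^sup>2 *
      (complex_of_real (r\<^sup>2) ^ Suc M * (b + g * complex_of_real (r\<^sup>2))))
    \<in> O[at_right 0](\<lambda>r. complex_of_real r powr (\<mu> + 2 * of_nat M + 2))"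
proof (rule bigoI)
  have "\<forall>\<^sub>F r::real in at_right 0. r \<in> {0<..<1}"
    by (rule eventually_at_right_real) simp
  then show "\<forall>\<^sub>F r in at_right 0. norm (complex_of_real r powr \<mu> / (complex_of_real (collar_scale r))\<^sup>2 *
      (complex_of_real (r\<^sup>2) ^ Suc M * (b + g * complex_of_real (r\<^sup>2))))
    \<le> (4 * (norm b + norm g)) * norm (complex_of_real r powr (\<mu> + 2 * of_nat M + 2))"
  proof eventually_elim
    fix r :: real assume "r \<in> {0<..<1}"
    then have r: "0 < r" "r < 1" by auto
    then have r2: "r\<^sup>2 \<le> 1" by (simp add: power_le_one)
    then have "1/2 \<le> collar_scale r" by (simp add: collar_scale_def)
    then have "(1/2)\<^sup>2 \<le> (collar_scale r)\<^sup>2" by (intro power_mono) auto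
    then have k: "1 / (collar_scale r)\<^sup>2 \<le> 4" by (simp add: power2_eq_square field_simps)
    have "norm (b + g * complex_of_real (r\<^sup>2)) \<le> norm b + norm g * r\<^sup>2"
      using norm_triangle_ineq[of b "g * complex_of_real (r\<^sup>2)"] by (simp add: norm_mult norm_power)
    also have "\<dots> \<le> norm b + norm g"
      using r2 by (simp add: mult_left_le)
    finally have bg: "norm (b + g * complex_of_real (r\<^sup>2)) \<le> norm b + norm g" .
    have "norm (complex_of_real r powr \<mu> / (complex_of_real (collar_scale r))\<^sup>2 *
      (complex_of_real (r\<^sup>2) ^ Suc M * (b + g * complex_of_real (r\<^sup>2))))
      = (norm (complex_of_real r powr \<mu>) * r ^ (2 * Suc M)) * (1 / (collar_scale r)\<^sup>2 * norm (b + g * complex_of_real (r\<^sup>2)))"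
      using r by (simp add: norm_mult norm_divide norm_power power_mult) (simp add: power2_eq_square)
    also have "\<dots> \<le> (norm (complex_of_real r powr \<mu>) * r ^ (2 * Suc M)) * (4 * (norm b + norm g))"
      using r k bg by (intro mult_left_mono mult_mono) auto
    finally show "norm (complex_of_real r powr \<mu> / (complex_of_real (collar_scale r))\<^sup>2 *
      (complex_of_real (r\<^sup>2) ^ Suc M * (b + g * complex_of_real (r\<^sup>2))))
    \<le> (4 * (norm b + norm g)) * norm (complex_of_real r powr (\<mu> + 2 * of_nat M + 2))"
      unfolding norm_powr_step[OF r(1)] by (simp add: mult_ac)
  qed
qed

text \<open>Dividing by \<open>r\<^sup>\<mu>\<^sup>+\<^sup>2\<^sup>M\<close> and letting \<open>r\<close> tend to \<open>0\<close> isolates \<open>c\<close>.\<close>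
lemma leading_coeff_zero:
  assumes E: "E \<in> O[at_right 0](\<lambda>r. complex_of_real r powr (\<mu> + 2 * of_nat M + 2))"
    and E_eq: "\<And>r. 0 < r \<Longrightarrow> r < 2 \<Longrightarrow> E r = complex_of_real r powr \<mu> / (complex_of_real (collar_scale r))\<^sup>2 *
      (c * complex_of_real (r\<^sup>2) ^ M + complex_of_real (r\<^sup>2) ^ Suc M * (b + g * complex_of_real (r\<^sup>2)))"
  shows "c = 0"
proof -
  obtain C where C: "C > 0" "\<forall>\<^sub>F r in at_right 0. norm (E r) \<le> C * norm (complex_of_real r powr (\<mu> + 2 * of_nat M + 2))"
    using landau_o.bigE[OF E] by blast
  have "\<forall>\<^sub>F r::real in at_right 0. r \<in> {0<..<1}"
    by (rule eventually_at_right_real) simp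
  with C(2) have ev: "\<forall>\<^sub>F r in at_right 0. norm (c + complex_of_real (r\<^sup>2) * (b + g * complex_of_real (r\<^sup>2))) \<le> C * r\<^sup>2"
  proof eventually_elim
    case (elim r)
    then have r: "0 < r" "r < 1" by auto
    then have "r\<^sup>2 \<le> 1" by (simp add: power_le_one)
    then have k: "0 < collar_scale r" "(collar_scale r)\<^sup>2 \<le> 1" by (simp_all add: collar_scale_def power_le_one)
    define N where "N = norm (c + complex_of_real (r\<^sup>2) * (b + g * complex_of_real (r\<^sup>2)))"
    define P where "P = norm (complex_of_real r powr \<mu>) * r ^ (2 * M)"
    have P: "P > 0" using r by (simp add: P_def)
    have "E r = complex_of_real r powr \<mu> / (complex_of_real (collar_scale r))\<^sup>2 *
       (complex_of_real (r\<^sup>2) ^ M * (c + complex_of_real (r\<^sup>2) * (b + g * complex_of_real (r\<^sup>2))))"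
      using r by (subst E_eq) (simp_all add: algebra_simps)
    then have "norm (E r) = P / (collar_scale r)\<^sup>2 * N"
      using r by (simp add: norm_mult norm_divide norm_power power_mult P_def N_def)
    moreover have "norm (E r) \<le> C * (P * r\<^sup>2)"
      using elim(1) unfolding norm_powr_step[OF r(1)] P_def by (simp add: mult_ac power2_eq_square)
    ultimately have "P / (collar_scale r)\<^sup>2 * N \<le> C * (P * r\<^sup>2)" by simp
    then have "P * N \<le> P * (C * r\<^sup>2 * (collar_scale r)\<^sup>2)"
      using k by (simp add: field_simps)
    then have "N \<le> C * r\<^sup>2 * (collar_scale r)\<^sup>2" using P by simp
    also have "\<dots> \<le> C * r\<^sup>2" using k C(1) by (simp add: mult_left_le)
    finally show ?case unfolding N_def .
  qed
  have "((\<lambda>r. norm (c + complex_of_real (r\<^sup>2) * (b + g * complex_of_real (r\<^sup>2))))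
     \<longlongrightarrow> norm (c + complex_of_real (0\<^sup>2) * (b + g * complex_of_real (0\<^sup>2)))) (at_right 0)"
    by (intro tendsto_intros)
  moreover have "((\<lambda>r. C * r\<^sup>2) \<longlongrightarrow> C * 0\<^sup>2) (at_right 0)"
    by (intro tendsto_intros)
  ultimately have "norm c \<le> 0"
    using tendsto_le[OF trivial_limit_at_right_real _ _ ev] by fastforce
  then show ?thesis by simp
qed

text \<open>The order conditions in \<open>formal_solution\<close> amount to a recursion for the coefficients: once the
  residuals below \<open>M\<close> vanish, the condition on the \<open>M\<close>-th partial sum forces the next one to
  vanish.\<close>
lemma formal_solution_iff_residual:
  fixes f :: "'n::finite usphere \<Rightarrow> complex"
  shows "formal_solution \<mu> f a \<longleftrightarrow> a 0 = f \<and> (\<forall>j. a j \<in> smooth_on_sphere) \<and>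
     (\<forall>k p. residual (of_nat CARD('n)) \<mu> (\<lambda>j. a j p) (\<lambda>j. sphere_lap (a j) p) k = 0)"
proof (cases "\<forall>j. a j \<in> smooth_on_sphere")
  case a: True
  let ?n = "of_nat CARD('n) :: complex"
  let ?E = "\<lambda>M s x r. - laplace_g_plus s (partial_sol \<mu> a M) x r
              - \<mu> * (of_nat CARD('n) - \<mu>) * partial_sol \<mu> a M (stereo s x) r"
  let ?res = "\<lambda>k p. residual ?n \<mu> (\<lambda>j. a j p) (\<lambda>j. sphere_lap (a j) p) k"
  let ?O = "\<lambda>M. O[at_right 0](\<lambda>r. complex_of_real r powr (\<mu> + 2 * of_nat M + 2))"
  have "(\<forall>M. \<forall>s\<in>{1, -1}. \<forall>x. ?E M s x \<in> ?O M) \<longleftrightarrow> (\<forall>k p. ?res k p = 0)"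
  proof
    assume res: "\<forall>k p. ?res k p = 0"
    show "\<forall>M. \<forall>s\<in>{1, -1}. \<forall>x. ?E M s x \<in> ?O M"
    proof (intro allI ballI)
      fix M s x assume s: "s \<in> {1, -1::real}"
      have "\<forall>\<^sub>F r::real in at_right 0. r \<in> {0<..<2}"
        by (rule eventually_at_right_real) simp
      then have "\<forall>\<^sub>F r in at_right 0. ?E M s x r = complex_of_real r powr \<mu> / (complex_of_real (collar_scale r))\<^sup>2 *
        (complex_of_real (r\<^sup>2) ^ Suc M *
        (subleading ?n \<mu> (\<lambda>j. a j (stereo s x)) (\<lambda>j. sphere_lap (a j) (stereo s x)) M
          + second_shift ?n \<mu> M * a M (stereo s x) * complex_of_real (r\<^sup>2)))"
      proof eventually_elim
        case (elim r)
        then show ?case using a res by (subst eigen_defect[OF s]) auto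
      qed
      then show "?E M s x \<in> ?O M"
        by (rule landau_o.big.in_cong[THEN iffD2]) (rule bigo_of_high_order)
    qed
  next
    assume E: "\<forall>M. \<forall>s\<in>{1, -1}. \<forall>x. ?E M s x \<in> ?O M"
    have "?res M p = 0" for M p
    proof (induction M rule: less_induct)
      case (less M)
      obtain s x where s: "s \<in> {1, -1}" and p: "p = stereo s x" by (rule stereo_cover)
      show ?case
      proof (rule leading_coeff_zero)
        show "?E M s x \<in> ?O M" using E s by blast
      next
        fix r :: real assume r: "0 < r" "r < 2"
        have "(\<Sum>k\<le>M. ?res k p * complex_of_real (r\<^sup>2) ^ k) = ?res M p * complex_of_real (r\<^sup>2) ^ M"
          using less by (simp add: lessThan_Suc_atMost[symmetric])
        then show "?E M s x r = complex_of_real r powr \<mu> / (complex_of_real (collar_scale r))\<^sup>2 *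
          (?res M p * complex_of_real (r\<^sup>2) ^ M + complex_of_real (r\<^sup>2) ^ Suc M *
        (subleading ?n \<mu> (\<lambda>j. a j p) (\<lambda>j. sphere_lap (a j) p) M
          + second_shift ?n \<mu> M * a M p * complex_of_real (r\<^sup>2)))"
          using a by (subst eigen_defect[OF s r]) (auto simp: p)
      qed
    qed
    then show "\<forall>k p. ?res k p = 0" by blast
  qed
  then show ?thesis using a by (simp add: formal_solution_def)
qed (auto simp: formal_solution_def)

text \<open>The recursion solved for its highest term. Sums are written without subtraction so that
  smoothness follows from closure under sums, products and \<open>sphere_lap\<close>.\<close>
fun frobenius_sol :: "complex \<Rightarrow> ('n::finite usphere \<Rightarrow> complex) \<Rightarrow> nat \<Rightarrow> 'n usphere \<Rightarrow> complex" where
  "frobenius_sol \<mu> f 0 = f"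
| "frobenius_sol \<mu> f (Suc 0) = (\<lambda>p. - (1 / indicial (of_nat CARD('n)) \<mu> 1) *
      (first_shift (of_nat CARD('n)) \<mu> 0 * f p + (-1) * sphere_lap f p))"
| "frobenius_sol \<mu> f (Suc (Suc k)) = (\<lambda>p. - (1 / indicial (of_nat CARD('n)) \<mu> (Suc (Suc k))) *
      ((first_shift (of_nat CARD('n)) \<mu> (Suc k) * frobenius_sol \<mu> f (Suc k) p + (-1) * sphere_lap (frobenius_sol \<mu> f (Suc k)) p)
        + second_shift (of_nat CARD('n)) \<mu> k * frobenius_sol \<mu> f k p))"

lemma frobenius_sol_Suc:
  "frobenius_sol \<mu> f (Suc k) p = - (1 / indicial (of_nat CARD('n)) \<mu> (Suc k)) *
     subleading (of_nat CARD('n)) \<mu> (\<lambda>j. frobenius_sol \<mu> f j p) (\<lambda>j. sphere_lap (frobenius_sol \<mu> f j) p) k"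
  for p :: "'n::finite usphere"
  by (cases k) simp_all

lemma smooth_frobenius_sol:
  assumes "f \<in> smooth_on_sphere"
  shows "frobenius_sol \<mu> f k \<in> smooth_on_sphere"
  using assms
proof (induction \<mu> f k rule: frobenius_sol.induct)
  case (1 \<mu> f)
  then show ?case by simp
next
  case (2 \<mu> f)
  then show ?case unfolding frobenius_sol.simps
    by (intro smooth_mult smooth_add smooth_const smooth_sphere_lap)
next
  case (3 \<mu> f k)
  then show ?case unfolding frobenius_sol.simps
    by (intro smooth_mult smooth_add smooth_const smooth_sphere_lap) auto
qed

text \<open>Genericity says that no exponent \<open>\<mu> + 2j\<close>, \<open>j \<ge> 1\<close>, is the second root of the indicial
  equation.\<close>
lemma generic_imp_indicial_nonzero:
  assumes "generic m \<mu>"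
  shows "indicial (of_nat m) \<mu> (Suc k) \<noteq> 0"
proof
  assume "indicial (of_nat m) \<mu> (Suc k) = 0"
  moreover have "2 * of_nat (Suc k) \<noteq> (0::complex)" by (simp del: of_nat_Suc)
  ultimately have "2 * \<mu> + 2 * of_nat (Suc k) - of_nat m = 0"
    unfolding indicial_def neg_equal_0_iff_equal mult_eq_0_iff by blast
  then have "\<mu> + 2 * of_nat (Suc k) = of_nat m - \<mu>" by (simp add: algebra_simps)
  with assms show False unfolding generic_def by (metis le_add1 plus_1_eq_Suc)
qed

lemma formal_solution_iff_frobenius_sol:
  fixes f :: "'n::finite usphere \<Rightarrow> complex"
  assumes g: "generic CARD('n) \<mu>" and f: "f \<in> smooth_on_sphere"
  shows "formal_solution \<mu> f a \<longleftrightarrow> a = frobenius_sol \<mu> f"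
proof
  assume "a = frobenius_sol \<mu> f"
  moreover have "residual (of_nat CARD('n)) \<mu> (\<lambda>j. frobenius_sol \<mu> f j p) (\<lambda>j. sphere_lap (frobenius_sol \<mu> f j) p) k = 0" for k p
    using generic_imp_indicial_nonzero[OF g] by (cases k) (simp_all add: frobenius_sol_Suc)
  ultimately show "formal_solution \<mu> f a"
    using smooth_frobenius_sol[OF f] by (simp add: formal_solution_iff_residual)
next
  assume "formal_solution \<mu> f a"
  then have a0: "a 0 = f"
    and res: "\<And>k p. residual (of_nat CARD('n)) \<mu> (\<lambda>j. a j p) (\<lambda>j. sphere_lap (a j) p) k = 0"
    by (auto simp: formal_solution_iff_residual)
  have "a k = frobenius_sol \<mu> f k" for k
  proof (induction k rule: less_induct)
    case (less k)
    show ?case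
    proof (cases k)
      case (Suc m)
      have sub: "subleading (of_nat CARD('n)) \<mu> (\<lambda>j. a j p) (\<lambda>j. sphere_lap (a j) p) m
          = subleading (of_nat CARD('n)) \<mu> (\<lambda>j. frobenius_sol \<mu> f j p) (\<lambda>j. sphere_lap (frobenius_sol \<mu> f j) p) m" for p
        using less[of m] less[of "m - 1"] Suc by (cases m) simp_all
      have "indicial (of_nat CARD('n)) \<mu> (Suc m) * a (Suc m) p
         = - subleading (of_nat CARD('n)) \<mu> (\<lambda>j. frobenius_sol \<mu> f j p) (\<lambda>j. sphere_lap (frobenius_sol \<mu> f j) p) m" for p
        using res[of p "Suc m"] by (simp add: sub eq_neg_iff_add_eq_0)
      then show ?thesis
        using generic_imp_indicial_nonzero[OF g, of m] by (auto simp: Suc fun_eq_iff frobenius_sol_Suc field_simps)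
    qed (simp add: a0)
  qed
  then show "a = frobenius_sol \<mu> f" by (rule ext)
qed

lemma T_op_eq_frobenius_sol:
  fixes f :: "'n::finite usphere \<Rightarrow> complex"
  assumes "generic CARD('n) \<mu>" "f \<in> smooth_on_sphere"
  shows "T_op j \<mu> f = frobenius_sol \<mu> f j"
  unfolding T_op_def formal_solution_iff_frobenius_sol[OF assms] by simp

section \<open>Integration over the sphere\<close>

lemma integrable_inverse_1_plus_sq: "integrable lborel (\<lambda>t::real. 1 / (1 + t\<^sup>2))"
  using integrable_inverse_1_plus_square by (simp add: set_integrable_def inverse_eq_divide)

lemma prod_1_plus_sq_le:
  fixes x :: "real^'n::finite"
  shows "(\<Prod>i\<in>UNIV. 1 + (x $ i)\<^sup>2) \<le> (2 * inv_conf x) ^ CARD('n)"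
proof -
  have "(x $ i)\<^sup>2 \<le> (norm x)\<^sup>2" for i
    unfolding norm_sq_sum by (rule member_le_sum) auto
  then have "(\<Prod>i\<in>UNIV. 1 + (x $ i)\<^sup>2) \<le> (\<Prod>i\<in>(UNIV::'n set). 2 * inv_conf x)"
    by (intro prod_mono) (simp add: add_nonneg_nonneg one_plus_norm_sq[symmetric])
  then show ?thesis by simp
qed

lemma continuous_on_inv_conf: "continuous_on S inv_conf"
  unfolding inv_conf_def[abs_def] by (intro continuous_intros) auto

text \<open>By \<open>\<Prod>\<^sub>i (1 + x\<^sub>i\<^sup>2) \<le> (1 + \<bar>x\<bar>\<^sup>2)\<^sup>n\<close>, the volume density in the chart is dominated by a
  product of integrable functions of one variable.\<close>
lemma integrable_volume_density: "integrable lborel (\<lambda>x::real^'n::finite. 1 / inv_conf x ^ CARD('n))"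
proof (rule Bochner_Integration.integrable_bound)
  let ?f = "\<lambda>x::real^'n. \<Prod>b\<in>Basis. 1 / (1 + (x \<bullet> b)\<^sup>2)"
  have meas: "?f \<in> borel_measurable borel"
    by (intro borel_measurable_continuous_onI continuous_intros) (auto simp: add_nonneg_eq_0_iff)
  have "(\<integral>\<^sup>+x. ennreal (?f x) \<partial>lborel) = (\<integral>\<^sup>+x. (\<Prod>b\<in>Basis. ennreal (1 / (1 + ((x::real^'n) \<bullet> b)\<^sup>2))) \<partial>lborel)"
    by (intro nn_integral_cong) (simp add: prod_ennreal)
  also have "\<dots> = (\<Prod>b\<in>(Basis::(real^'n) set). (\<integral>\<^sup>+t. ennreal (1 / (1 + t\<^sup>2)) \<partial>lborel))"
    by (rule nn_integral_lborel_prod) auto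
  also have "\<dots> < \<infinity>"
    using integrable_inverse_1_plus_sq
    by (auto simp: integrable_iff_bounded ennreal_prod_eq_top less_top power_less_top_ennreal)
  finally show "integrable lborel (\<lambda>x. 2 ^ CARD('n) * ?f x)"
    using meas by (intro integrable_mult_right) (auto simp: integrable_iff_bounded abs_prod)
  show "AE x in lborel. norm (1 / inv_conf x ^ CARD('n)) \<le> norm (2 ^ CARD('n) * ?f x)"
  proof (intro AE_I2)
    fix x :: "real^'n"
    have "?f x = 1 / (\<Prod>i\<in>UNIV. 1 + (x $ i)\<^sup>2)"
      unfolding Basis_vec_def by (simp add: UNION_singleton_eq_range prod.reindex inj_on_def axis_eq_axis
          cart_eq_inner_axis prod_dividef)
    moreover have "1 / (2 * inv_conf x) ^ CARD('n) \<le> 1 / (\<Prod>i\<in>UNIV. 1 + (x $ i)\<^sup>2)"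
      by (intro divide_left_mono prod_1_plus_sq_le mult_pos_pos prod_pos zero_less_power)
        (auto intro: add_pos_nonneg)
    moreover have "0 \<le> ?f x" by (intro prod_nonneg) auto
    ultimately show "norm (1 / inv_conf x ^ CARD('n)) \<le> norm (2 ^ CARD('n) * ?f x)"
      by (simp add: field_simps power_mult_distrib abs_mult order_less_imp_le)
  qed
qed (auto intro!: borel_measurable_continuous_onI continuous_intros continuous_on_inv_conf)

lemma sphere_integral_eq:
  fixes F :: "'n::finite usphere \<Rightarrow> complex"
  shows "sphere_integral F = (LINT x|lborel. complex_of_real (1 / inv_conf x ^ CARD('n)) * F (stereo 1 x))"
  unfolding sphere_integral_def by (simp add: sqrt_det_round_metric scaleR_conv_of_real)

lemma bounded_on_ball:
  fixes g :: "real^'n::finite \<Rightarrow> complex"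
  assumes "continuous_on UNIV g"
  shows "\<exists>B\<ge>0. \<forall>x. norm x \<le> R \<longrightarrow> norm (g x) \<le> B"
proof -
  have "continuous_on (cball 0 R) g"
    using assms by (rule continuous_on_subset) simp
  then have "bounded (g ` cball 0 R)"
    by (intro compact_imp_bounded compact_continuous_image) simp_all
  then obtain B where B: "\<And>x. x \<in> cball 0 R \<Longrightarrow> norm (g x) \<le> B"
    unfolding bounded_iff by (meson image_eqI)
  then have "\<forall>x. norm x \<le> R \<longrightarrow> norm (g x) \<le> max B 0"
    by (simp add: le_max_iff_disj)
  then show ?thesis by (intro exI[of _ "max B 0"]) simp
qed

lemma smooth_bounded:
  assumes "f \<in> smooth_on_sphere"
  shows "\<exists>B. \<forall>p. norm (f p) \<le> B"
proof -
  obtain B C where B: "\<And>x. norm x \<le> 1 \<Longrightarrow> norm (f (stereo 1 x)) \<le> B"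
    and C: "\<And>x. norm x \<le> 1 \<Longrightarrow> norm (f (stereo (-1) x)) \<le> C"
    using bounded_on_ball[OF C_k_continuous[OF smooth_C_k[OF assms, of 1]], of 1]
      bounded_on_ball[OF C_k_continuous[OF smooth_C_k[OF assms, of "-1"]], of 1] by auto
  have "norm (f p) \<le> max B C" for p
  proof -
    obtain s x where "s \<in> {1, -1}" "norm x \<le> 1" "p = stereo s x" by (rule stereo_cover_ball)
    then show ?thesis using B[of x] C[of x] by (auto simp: le_max_iff_disj)
  qed
  then show ?thesis by blast
qed

lemma continuous_smooth_chart:
  assumes "f \<in> smooth_on_sphere" "s \<in> {1, -1}"
  shows "continuous_on UNIV (\<lambda>x. f (stereo s x))"
  using C_k_continuous smooth_C_k[OF assms, of 0] by blast

lemma integrable_smooth: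
  fixes f :: "'n::finite usphere \<Rightarrow> complex"
  assumes "f \<in> smooth_on_sphere"
  shows "integrable lborel (\<lambda>x. complex_of_real (1 / inv_conf x ^ CARD('n)) * f (stereo 1 x))"
proof -
  obtain B where B: "\<And>p. norm (f p) \<le> B" using smooth_bounded[OF assms] by blast
  show ?thesis
  proof (rule Bochner_Integration.integrable_bound)
    show "integrable lborel (\<lambda>x::real^'n. B * (1 / inv_conf x ^ CARD('n)))"
      by (intro integrable_mult_right integrable_volume_density)
    show "AE x in lborel. norm (complex_of_real (1 / inv_conf x ^ CARD('n)) * f (stereo 1 x))
        \<le> norm (B * (1 / inv_conf x ^ CARD('n)))"
    proof (intro AE_I2)
      fix x :: "real^'n"
      have "0 \<le> B" using B[of "stereo 1 x"] norm_ge_zero order_trans by blast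
      then show "norm (complex_of_real (1 / inv_conf x ^ CARD('n)) * f (stereo 1 x))
        \<le> norm (B * (1 / inv_conf x ^ CARD('n)))"
        using B[of "stereo 1 x"] by (simp add: norm_mult norm_divide norm_power divide_right_mono order_less_imp_le)
    qed
    have "continuous_on UNIV (\<lambda>x. complex_of_real (1 / inv_conf x ^ CARD('n)) * f (stereo 1 x))"
      by (intro continuous_intros continuous_on_inv_conf continuous_smooth_chart assms) auto
    then show "(\<lambda>x. complex_of_real (1 / inv_conf x ^ CARD('n)) * f (stereo 1 x)) \<in> borel_measurable lborel"
      by (simp add: borel_measurable_continuous_onI)
  qed
qed

text \<open>Used for translations and for the reflection \<open>x \<mapsto> -x\<close>.\<close>
lemma integral_affine_isometry:
  fixes f :: "real^'n::finite \<Rightarrow> complex"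
  assumes "f \<in> borel_measurable borel" "\<bar>c\<bar> = 1"
  shows "(LINT x|lborel. f (t + c *\<^sub>R x)) = (LINT x|lborel. f x)"
proof -
  have c: "c \<noteq> 0" using assms(2) by auto
  have "lborel = distr lborel borel (\<lambda>x::real^'n. t + c *\<^sub>R x)"
    using lborel_affine[OF c, of t] assms(2) by (simp add: density_1)
  then have "(LINT x|lborel. f x) = (LINT x|distr lborel borel (\<lambda>x::real^'n. t + c *\<^sub>R x). f x)" by simp
  also have "\<dots> = (LINT x|lborel. f (t + c *\<^sub>R x))"
    using assms(1) by (intro integral_distr) auto
  finally show ?thesis by simp
qed

lemma integrable_compact_support:
  fixes g :: "real^'n::finite \<Rightarrow> complex"
  assumes "continuous_on UNIV g" "\<And>x. norm x > R \<Longrightarrow> g x = 0"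
  shows "integrable lborel g"
proof -
  have "integrable lborel (\<lambda>x. indicator (cball 0 R) x *\<^sub>R g x)"
    by (intro borel_integrable_compact continuous_on_subset[OF assms(1)]) auto
  also have "(\<lambda>x. indicator (cball 0 R) x *\<^sub>R g x) = g"
    using assms(2) by (auto simp: fun_eq_iff indicator_def not_le)
  finally show ?thesis .
qed

lemma bounded_compact_support:
  fixes g :: "real^'n::finite \<Rightarrow> complex"
  assumes "continuous_on UNIV g" "\<And>x. norm x > R \<Longrightarrow> g x = 0"
  shows "\<exists>B\<ge>0. \<forall>x. norm (g x) \<le> B"
proof -
  obtain B where B: "B \<ge> 0" "\<And>x. norm x \<le> R \<Longrightarrow> norm (g x) \<le> B"
    using bounded_on_ball[OF assms(1)] by blast
  have "norm (g x) \<le> B" for x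
    using B assms(2)[of x] by (cases "norm x \<le> R") auto
  with B(1) show ?thesis by blast
qed

lemma has_vector_derivative_line:
  fixes \<phi> :: "real^'n::finite \<Rightarrow> complex"
  assumes "\<And>x. \<phi> differentiable (at x)"
  shows "((\<lambda>t. \<phi> (x + t *\<^sub>R axis i 1)) has_vector_derivative partial i \<phi> (x + t *\<^sub>R axis i 1)) (at t)"
proof -
  let ?z = "x + t *\<^sub>R axis i 1"
  have "((\<lambda>t. x + t *\<^sub>R axis i (1::real)) has_derivative (\<lambda>h. h *\<^sub>R axis i 1)) (at t)"
    by (auto intro!: derivative_eq_intros)
  from diff_chain_at[OF this frechet_derivative_worksI[OF assms]]
  have "((\<lambda>t. \<phi> (x + t *\<^sub>R axis i 1)) has_derivative (\<lambda>h. frechet_derivative \<phi> (at ?z) (h *\<^sub>R axis i 1))) (at t)"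
    by (simp add: o_def)
  moreover have "frechet_derivative \<phi> (at ?z) (h *\<^sub>R axis i 1) = h *\<^sub>R partial i \<phi> ?z" for h
    using linear_cmul[OF linear_frechet_derivative[OF assms]] by (simp add: partial_def)
  ultimately show ?thesis by (simp add: has_vector_derivative_def)
qed

text \<open>The integral of a difference quotient vanishes because Lebesgue measure is translation
  invariant, and difference quotients of a \<open>C\<^sup>1\<close> function of compact support converge boundedly.\<close>
lemma integral_partial_compact_support:
  fixes \<phi> :: "real^'n::finite \<Rightarrow> complex"
  assumes d: "\<And>x. \<phi> differentiable (at x)" and c: "continuous_on UNIV (partial i \<phi>)"
    and supp: "\<And>x. norm x > R \<Longrightarrow> \<phi> x = 0"
  shows "integrable lborel (partial i \<phi>)" "(LINT x|lborel. partial i \<phi> x) = 0"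
proof -
  have supp': "partial i \<phi> x = 0" if "norm x > R" for x
  proof -
    have "open {y::real^'n. R < norm y}" by (intro open_Collect_less continuous_intros)
    then have "\<forall>\<^sub>F y in nhds x. \<phi> y = 0"
      using that supp by (auto simp: eventually_nhds)
    then show ?thesis using partial_cong[of \<phi> "\<lambda>_. 0" x i] by simp
  qed
  show int: "integrable lborel (partial i \<phi>)"
    by (rule integrable_compact_support[OF c supp'])
  obtain B where B: "B \<ge> 0" "\<And>x. norm (partial i \<phi> x) \<le> B"
    using bounded_compact_support[OF c supp'] by blast
  have cont: "continuous_on UNIV \<phi>"
    using d by (auto simp: continuous_on_eq_continuous_at intro: differentiable_imp_continuous_within)
  have int\<phi>: "integrable lborel \<phi>"
    by (rule integrable_compact_support[OF cont supp])
  define h where "h k = 1 / real (Suc k)" for k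
  have h: "0 < h k" "h k \<le> 1" for k by (auto simp: h_def field_simps)
  have h0: "h \<longlonglongrightarrow> 0" unfolding h_def[abs_def] using LIMSEQ_inverse_real_of_nat by (simp add: inverse_eq_divide)
  define D where "D k x = (\<phi> (x + h k *\<^sub>R axis i 1) - \<phi> x) /\<^sub>R h k" for k x
  have "(\<lambda>k. LINT x|lborel. D k x) \<longlonglongrightarrow> (LINT x|lborel. partial i \<phi> x)"
  proof (rule integral_dominated_convergence[where w = "\<lambda>x. indicator (cball 0 (R + 1)) x * B"])
    show "partial i \<phi> \<in> borel_measurable lborel"
      using c by (simp add: borel_measurable_continuous_onI)
    show "D k \<in> borel_measurable lborel" for k
      unfolding D_def using cont
      by (auto intro!: borel_measurable_continuous_onI continuous_intros continuous_on_compose2[OF cont])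
    show "integrable lborel (\<lambda>x::real^'n. indicator (cball 0 (R + 1)) x * B)"
      by (intro integrable_mult_left integrable_real_indicator) (auto intro!: emeasure_bounded_finite[unfolded infinity_ennreal_def])
    show "AE x in lborel. (\<lambda>k. D k x) \<longlonglongrightarrow> partial i \<phi> x"
    proof (intro AE_I2)
      fix x
      have "((\<lambda>t. \<phi> (x + t *\<^sub>R axis i 1)) has_vector_derivative partial i \<phi> x) (at 0)"
        using has_vector_derivative_line[OF d, of x i 0] by simp
      then have "(\<lambda>t. norm (\<phi> (x + t *\<^sub>R axis i 1) - \<phi> x - t *\<^sub>R partial i \<phi> x) / norm t) \<midarrow>0\<rightarrow> 0"
        by (simp add: has_vector_derivative_def has_derivative_at)
      also have "?this \<longleftrightarrow> (\<lambda>t. norm ((\<phi> (x + t *\<^sub>R axis i 1) - \<phi> x) /\<^sub>R t - partial i \<phi> x)) \<midarrow>0\<rightarrow> 0"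
      proof (rule Lim_cong_within)
        fix t :: real assume t: "t \<noteq> 0"
        have "(\<phi> (x + t *\<^sub>R axis i 1) - \<phi> x) /\<^sub>R t - partial i \<phi> x
          = (\<phi> (x + t *\<^sub>R axis i 1) - \<phi> x - t *\<^sub>R partial i \<phi> x) /\<^sub>R t"
          using t by (simp add: scaleR_diff_right)
        then show "norm (\<phi> (x + t *\<^sub>R axis i 1) - \<phi> x - t *\<^sub>R partial i \<phi> x) / norm t
          = norm ((\<phi> (x + t *\<^sub>R axis i 1) - \<phi> x) /\<^sub>R t - partial i \<phi> x)"
          by (simp add: divide_inverse mult.commute)
      qed auto
      finally have "((\<lambda>t. (\<phi> (x + t *\<^sub>R axis i 1) - \<phi> x) /\<^sub>R t) \<longlongrightarrow> partial i \<phi> x) (at 0)"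
        by (simp add: tendsto_norm_zero_iff Lim_null[symmetric])
      moreover have "filterlim h (at 0) sequentially"
        using h0 h by (auto simp: filterlim_at order.strict_implies_not_eq[symmetric])
      ultimately show "(\<lambda>k. D k x) \<longlonglongrightarrow> partial i \<phi> x"
        unfolding D_def by (rule filterlim_compose)
    qed
    show "AE x in lborel. norm (D k x) \<le> indicator (cball 0 (R + 1)) x * B" for k
    proof (intro AE_I2)
      fix x
      show "norm (D k x) \<le> indicator (cball 0 (R + 1)) x * B"
      proof (cases "norm x \<le> R + 1")
        case True
        have "norm (\<phi> (x + h k *\<^sub>R axis i 1) - \<phi> (x + 0 *\<^sub>R axis i 1)) \<le> B * norm (h k - 0)"
        proof (rule differentiable_bound[where S = "{0..h k}" and f' = "\<lambda>t d. d *\<^sub>R partial i \<phi> (x + t *\<^sub>R axis i 1)"])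
          show "((\<lambda>t. \<phi> (x + t *\<^sub>R axis i 1)) has_derivative (\<lambda>d. d *\<^sub>R partial i \<phi> (x + t *\<^sub>R axis i 1))) (at t within {0..h k})" for t
            using has_vector_derivative_line[OF d] unfolding has_vector_derivative_def
            by (rule has_derivative_at_withinI)
          show "onorm (\<lambda>d. d *\<^sub>R partial i \<phi> (x + t *\<^sub>R axis i 1)) \<le> B" for t
            using B by (intro onorm_le) (simp add: mult.commute[of B] mult_left_mono)
        qed (use h in \<open>auto simp: order_less_imp_le\<close>)
        then have "norm (D k x) \<le> B"
          using h[of k] by (simp only: D_def norm_scaleR) (simp add: field_simps)
        then show ?thesis using True by simp
      next
        case False
        have "norm x - norm (h k *\<^sub>R axis i (1::real) :: real^'n) \<le> norm (x + h k *\<^sub>R axis i 1)"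
          using norm_diff_ineq by blast
        then have "norm (x + h k *\<^sub>R axis i 1) > R" "norm x > R"
          using False h[of k] by auto
        then show ?thesis using supp False by (simp add: D_def)
      qed
    qed
  qed
  moreover have "(LINT x|lborel. D k x) = 0" for k
  proof -
    have meas: "\<phi> \<in> borel_measurable borel" using cont by (simp add: borel_measurable_continuous_onI)
    have eq: "(LINT x|lborel. \<phi> (x + h k *\<^sub>R axis i 1)) = (LINT x|lborel. \<phi> x)"
      using integral_affine_isometry[OF meas, of 1 "h k *\<^sub>R axis i 1"] by (simp add: add.commute)
    have "integrable lborel (\<lambda>x. \<phi> (x + h k *\<^sub>R axis i 1))"
    proof (rule integrable_compact_support[where R = "R + 1"])
      show "continuous_on UNIV (\<lambda>x. \<phi> (x + h k *\<^sub>R axis i 1))"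
        by (intro continuous_on_compose2[OF cont] continuous_intros) auto
      fix x :: "real^'n" assume "norm x > R + 1"
      moreover have "norm x - norm (h k *\<^sub>R axis i (1::real) :: real^'n) \<le> norm (x + h k *\<^sub>R axis i 1)"
        using norm_diff_ineq by blast
      ultimately show "\<phi> (x + h k *\<^sub>R axis i 1) = 0" using supp h[of k] by auto
    qed
    then show ?thesis
      unfolding D_def using int\<phi> eq by simp
  qed
  ultimately show "(LINT x|lborel. partial i \<phi> x) = 0"
    by (simp add: LIMSEQ_const_iff)
qed

lemma C1_lipschitz_unit_ball:
  fixes H :: "real^'n::finite \<Rightarrow> complex"
  assumes H: "C_k 1 H"
  shows "\<exists>B\<ge>0. \<forall>y z. norm y \<le> 1 \<longrightarrow> norm z \<le> 1 \<longrightarrow> norm (H y - H z) \<le> B * norm (y - z)"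
proof -
  have "\<forall>k. \<exists>b\<ge>0. \<forall>x. norm x \<le> 1 \<longrightarrow> norm (partial k H x) \<le> b"
    using H by (intro allI bounded_on_ball) simp
  from choice[OF this] obtain b
    where bb: "\<forall>k. b k \<ge> 0 \<and> (\<forall>x. norm x \<le> 1 \<longrightarrow> norm (partial k H x) \<le> b k)" ..
  then have b: "\<And>k x. norm x \<le> 1 \<Longrightarrow> norm (partial k H x) \<le> b k" and b0: "\<And>k. b k \<ge> 0"
    by simp_all
  have "norm (H y - H z) \<le> (\<Sum>k\<in>UNIV. b k) * norm (y - z)" if "norm y \<le> 1" "norm z \<le> 1" for y z
  proof (rule differentiable_bound[where S = "cball 0 1" and f' = "\<lambda>x. frechet_derivative H (at x)"])
    show "(H has_derivative frechet_derivative H (at x)) (at x within cball 0 1)" for x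
      by (rule has_derivative_at_withinI, rule frechet_derivative_worksI) (use H in auto)
    show "onorm (frechet_derivative H (at x)) \<le> (\<Sum>k\<in>UNIV. b k)" if "x \<in> cball 0 1" for x
    proof (rule onorm_le)
      fix h
      have "norm (frechet_derivative H (at x) h) \<le> (\<Sum>k\<in>UNIV. norm (complex_of_real (h $ k) * partial k H x))"
        using H by (subst frechet_derivative_coords) (auto intro: norm_sum)
      also have "\<dots> \<le> (\<Sum>k\<in>UNIV. norm h * b k)"
        using b[of x] that component_le_norm_cart[of h]
        by (intro sum_mono) (auto simp: norm_mult intro!: mult_mono)
      finally show "norm (frechet_derivative H (at x) h) \<le> (\<Sum>k\<in>UNIV. b k) * norm h"
        by (simp add: sum_distrib_left mult.commute)
    qed
  qed (use that in auto)
  moreover have "0 \<le> (\<Sum>k\<in>UNIV. b k)"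
    by (intro sum_nonneg b0)
  ultimately show ?thesis by blast
qed

section \<open>The Laplacian has mean zero\<close>

text \<open>The derivative along the Euler vector field \<open>x \<cdot> \<nabla>\<close>.\<close>
definition euler_deriv :: "(real^'n::finite \<Rightarrow> complex) \<Rightarrow> real^'n \<Rightarrow> complex" where
  "euler_deriv F x = (\<Sum>i\<in>UNIV. complex_of_real (x $ i) * partial i F x)"

lemma norm_sum_coords_le:
  fixes y :: "real^'n::finite"
  assumes "\<And>k. norm (c k :: complex) \<le> b k"
  shows "norm (\<Sum>k\<in>UNIV. complex_of_real (y $ k) * c k) \<le> norm y * (\<Sum>k\<in>UNIV. b k)"
proof -
  have "norm (\<Sum>k\<in>UNIV. complex_of_real (y $ k) * c k) \<le> (\<Sum>k\<in>UNIV. norm (complex_of_real (y $ k) * c k))"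
    by (rule norm_sum)
  also have "\<dots> \<le> (\<Sum>k\<in>UNIV. norm y * b k)"
    using assms component_le_norm_cart[of y]
    by (intro sum_mono) (auto simp: norm_mult intro!: mult_mono)
  finally show ?thesis by (simp add: sum_distrib_left)
qed

text \<open>Near infinity the derivative equals \<open>- y \<cdot> \<nabla>G(y)\<close> with \<open>y\<close> the inverted point and \<open>G\<close> the
  function in the other chart. This is only of first order in \<open>y\<close>, but its even part is of second
  order, which is the decay of \<open>1 / inv_conf\<close>.\<close>
lemma euler_deriv_symmetrized_bound:
  fixes f :: "'n::finite usphere \<Rightarrow> complex"
  assumes f: "f \<in> smooth_on_sphere"
  shows "\<exists>C\<ge>0. \<forall>x. norm (euler_deriv (\<lambda>y. f (stereo 1 y)) x + euler_deriv (\<lambda>y. f (stereo 1 y)) (- x)) \<le> C / inv_conf x"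
proof -
  define F where "F = (\<lambda>y. f (stereo 1 y))"
  define G where "G = (\<lambda>y. f (stereo (-1) y))"
  have F: "C_k k F" and G: "C_k k G" for k
    using smooth_C_k[OF f] by (auto simp: F_def G_def)
  have "C_k 0 (euler_deriv F)"
    unfolding euler_deriv_def[abs_def] using F[of 1]
    by (intro C_k_sum C_k_mult C_k_of_real_coord) auto
  then have "continuous_on UNIV (euler_deriv F)" by simp
  then obtain B where B: "B \<ge> 0" "\<And>x. norm x \<le> 1 \<Longrightarrow> norm (euler_deriv F x) \<le> B"
    using bounded_on_ball by blast
  have "\<forall>k. \<exists>b\<ge>0. \<forall>y z. norm y \<le> 1 \<longrightarrow> norm z \<le> 1 \<longrightarrow>
      norm (partial k G y - partial k G z) \<le> b * norm (y - z)"
    using C_k_partial[OF G] by (intro allI C1_lipschitz_unit_ball) simp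
  from choice[OF this] obtain b where "\<forall>k. b k \<ge> 0 \<and> (\<forall>y z. norm y \<le> 1 \<longrightarrow> norm z \<le> 1 \<longrightarrow>
      norm (partial k G y - partial k G z) \<le> b k * norm (y - z))" ..
  then have b: "\<And>k. b k \<ge> 0" "\<And>k y z. norm y \<le> 1 \<Longrightarrow> norm z \<le> 1 \<Longrightarrow>
      norm (partial k G y - partial k G z) \<le> b k * norm (y - z)"
    by simp_all
  define C where "C = 2 * B + (\<Sum>k\<in>UNIV. b k * 2)"
  have C: "2 * B \<le> C" "(\<Sum>k\<in>UNIV. b k * 2) \<le> C" "0 \<le> C"
    using B(1) b(1) by (auto simp: C_def intro!: sum_nonneg add_nonneg_nonneg)
  have "norm (euler_deriv F x + euler_deriv F (- x)) \<le> C / inv_conf x" for x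
  proof (cases "norm x \<le> 1")
    case True
    have "(norm x)\<^sup>2 \<le> 1" using True by (simp add: power_le_one)
    then have "inv_conf x \<le> 1" by (simp add: inv_conf_def)
    then have "C \<le> C / inv_conf x" using C(3) inv_conf_pos[of x] by (simp add: field_simps mult_left_le)
    moreover have "norm (euler_deriv F x + euler_deriv F (- x)) \<le> 2 * B"
      using norm_triangle_ineq[of "euler_deriv F x" "euler_deriv F (- x)"] B(2)[of x] B(2)[of "- x"] True by simp
    ultimately show ?thesis using C(1) by linarith
  next
    case False
    then have x: "x \<noteq> 0" "- x \<noteq> 0" by auto
    have rad: "euler_deriv F z = - (\<Sum>k\<in>UNIV. complex_of_real (inversion z $ k) * partial k G (inversion z))"
      if z: "z \<noteq> 0" for z
    proof -
      have "\<forall>\<^sub>F y in nhds z. y \<noteq> 0" using z t1_space_nhds by blast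
      then have "\<forall>\<^sub>F y in nhds z. F y = G (inversion y)"
        by eventually_elim (simp add: F_def G_def stereo_inversion)
      then have "partial i F z = partial i (\<lambda>y. G (inversion y)) z" for i by (rule partial_cong)
      moreover have "G differentiable (at (inversion z))" using G[of 1] by simp
      ultimately show ?thesis
        unfolding euler_deriv_def by (simp only: radial_derivative_inversion[OF z])
    qed
    define y where "y = inversion x"
    have y': "inversion (- x) = - y" by (simp add: y_def inversion_def)
    have ny: "norm y \<le> 1" using False by (simp add: y_def norm_inversion inverse_le_1_iff)
    have "euler_deriv F x + euler_deriv F (- x) = - (\<Sum>k\<in>UNIV. complex_of_real (y $ k) * (partial k G y - partial k G (- y)))"
      unfolding rad[OF x(1)] rad[OF x(2)] y' y_def[symmetric]
      by (simp add: sum_subtractf sum_negf algebra_simps)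
    then have "norm (euler_deriv F x + euler_deriv F (- x)) = norm (\<Sum>k\<in>UNIV. complex_of_real (y $ k) * (partial k G y - partial k G (- y)))"
      by (simp only: norm_minus_cancel)
    also have "\<dots> \<le> norm y * (\<Sum>k\<in>UNIV. b k * norm (y - - y))"
      using ny by (intro norm_sum_coords_le b(2)) auto
    also have "norm (y - - y) = 2 * norm y"
      using norm_scaleR[of 2 y] by (simp add: scaleR_2)
    also have "norm y * (\<Sum>k\<in>UNIV. b k * (2 * norm y)) = (\<Sum>k\<in>UNIV. b k * 2) * (norm y)\<^sup>2"
      by (simp add: sum_distrib_left sum_distrib_right power2_eq_square mult_ac)
    also have "\<dots> \<le> C * (norm y)\<^sup>2"
      using C(2) by (rule mult_right_mono) simp
    also have "\<dots> \<le> C * (1 / inv_conf x)"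
    proof (rule mult_left_mono)
      have "1 \<le> (norm x)\<^sup>2" using False by (simp add: one_le_power)
      then have "inv_conf x \<le> (norm x)\<^sup>2" by (simp add: inv_conf_def)
      then show "(norm y)\<^sup>2 \<le> 1 / inv_conf x"
        using inv_conf_pos[of x] by (simp add: y_def norm_inversion power_inverse inverse_eq_divide[symmetric] le_imp_inverse_le)
    qed (rule C(3))
    finally show ?thesis by simp
  qed
  with C(3) show ?thesis unfolding F_def by blast
qed

text \<open>Its square is a \<open>C\<^sup>1\<close> cutoff function with support in the ball of radius \<open>R\<close>. Since it is
  radial, its gradient pairs with a flux to a multiple of the Euler derivative.\<close>
definition cutoff :: "real \<Rightarrow> real^'n::finite \<Rightarrow> real" where
  "cutoff R x = max 0 (1 - (norm x)\<^sup>2 / R\<^sup>2)"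

lemma DERIV_pos_part_sq: "((\<lambda>t::real. (max 0 t)\<^sup>2) has_real_derivative 2 * max 0 t) (at t)"
proof -
  consider "t > 0" | "t < 0" | "t = 0" by linarith
  then show ?thesis
  proof cases
    case 1
    have "((\<lambda>t. t\<^sup>2) has_real_derivative 2 * t) (at t)" by (auto intro!: derivative_eq_intros)
    then have "((\<lambda>t. (max 0 t)\<^sup>2) has_real_derivative 2 * t) (at t)"
      by (rule has_field_derivative_transform_within_open[where S = "{0<..}"]) (use 1 in auto)
    then show ?thesis using 1 by simp
  next
    case 2
    have "((\<lambda>t. 0) has_real_derivative 0) (at t)" by simp
    then have "((\<lambda>t. (max 0 t)\<^sup>2) has_real_derivative 0) (at t)"
      by (rule has_field_derivative_transform_within_open[where S = "{..<0}"]) (use 2 in auto)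
    then show ?thesis using 2 by simp
  next
    case 3
    have "((\<lambda>h::real. (max 0 h)\<^sup>2 / h) \<longlongrightarrow> 0) (at 0)"
    proof (rule Lim_null_comparison)
      show "\<forall>\<^sub>F h in at 0. norm ((max 0 h)\<^sup>2 / h) \<le> \<bar>h\<bar>"
        by (intro always_eventually) (auto simp: max_def power2_eq_square)
      show "((\<lambda>h::real. \<bar>h\<bar>) \<longlongrightarrow> 0) (at 0)"
        by (rule tendsto_rabs_zero) (rule tendsto_ident_at)
    qed
    then show ?thesis unfolding 3 has_field_derivative_iff by simp
  qed
qed

lemma has_derivative_cutoff_sq:
  assumes "R > 0"
  shows "((\<lambda>y. complex_of_real ((cutoff R y)\<^sup>2)) has_derivative
     (\<lambda>h. complex_of_real (- (4 / R\<^sup>2) * cutoff R x * (x \<bullet> h)))) (at x)"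
proof -
  have "((\<lambda>y. 1 - (norm y)\<^sup>2 / R\<^sup>2) has_derivative (\<lambda>h. - (2 * (x \<bullet> h) / R\<^sup>2))) (at x)"
    unfolding power2_norm_eq_inner divide_inverse
    by (auto intro!: derivative_eq_intros simp: inner_commute)
  from diff_chain_at[OF this DERIV_pos_part_sq[unfolded has_field_derivative_def]]
  have "((\<lambda>y. (cutoff R y)\<^sup>2) has_derivative (\<lambda>h. - (4 / R\<^sup>2) * cutoff R x * (x \<bullet> h))) (at x)"
    by (simp add: o_def cutoff_def mult_ac)
  from bounded_linear.has_derivative[OF bounded_linear_of_real this] show ?thesis .
qed

lemma continuous_on_cutoff: "continuous_on S (cutoff R)"
  unfolding cutoff_def[abs_def] divide_inverse by (intro continuous_intros continuous_on_max)

lemma cutoff_bounds: "0 \<le> cutoff R x" "cutoff R x \<le> 1"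
  by (auto simp: cutoff_def)

lemma cutoff_eq_0:
  assumes "R > 0" "norm x > R"
  shows "cutoff R x = 0"
proof -
  have "R\<^sup>2 \<le> (norm x)\<^sup>2" using assms by (intro power_mono) auto
  then show ?thesis using assms by (simp add: cutoff_def field_simps)
qed

text \<open>Integration by parts moves the divergence in \<open>chart_lap\<close> onto the cutoff.\<close>
lemma cutoff_divergence:
  fixes f :: "'n::finite usphere \<Rightarrow> complex"
  assumes f: "f \<in> smooth_on_sphere" and R: "R > 0"
  shows "(LINT x|lborel. complex_of_real ((cutoff R x)\<^sup>2) * (chart_lap (\<lambda>y. f (stereo 1 y)) x / complex_of_real (inv_conf x ^ CARD('n))))
     = (LINT x|lborel. complex_of_real (4 / R\<^sup>2 * cutoff R x * ((inv_conf x)\<^sup>2 / inv_conf x ^ CARD('n))) * euler_deriv (\<lambda>y. f (stereo 1 y)) x)"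
proof -
  define F where "F = (\<lambda>y. f (stereo 1 y))"
  have F: "C_k k F" for k using smooth_C_k[OF f] by (auto simp: F_def)
  define V where "V i y = complex_of_real ((inv_conf y)\<^sup>2 / inv_conf y ^ CARD('n)) * partial i F y" for i y
  have F1: "partial k F differentiable (at z)" for z k
    using F[of 2] by (auto simp: numeral_2_eq_2)
  \<comment> \<open>By \<open>chart_lap_divergence\<close>, the fields \<open>V i\<close> have the weighted Laplacian as divergence.\<close>
  have w: "(\<lambda>y::real^'n. complex_of_real ((inv_conf y)\<^sup>2 / inv_conf y ^ CARD('n))) differentiable (at x)" for x
    using has_derivative_inv_conf_ratio[of "CARD('n)" x] unfolding differentiable_def by blast
  have V1: "V i differentiable (at x)" for i x
    unfolding V_def by (intro differentiable_mult w F1)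
  have contF: "continuous_on UNIV (partial i F)" "continuous_on UNIV (partial i (partial j F))" for i j
    using F[of 2] by (auto simp: numeral_2_eq_2 continuous_on_eq_continuous_at intro: differentiable_imp_continuous_within)
  have partial_V: "partial i (V i) y = complex_of_real ((inv_conf y)\<^sup>2 / inv_conf y ^ CARD('n)) * partial i (partial i F) y
     + complex_of_real ((2 - real CARD('n)) * inv_conf y / inv_conf y ^ CARD('n) * y $ i) * partial i F y" for i y
    unfolding V_def[abs_def] partial_mult[OF w F1] partial_eq[OF has_derivative_inv_conf_ratio] by (simp add: inner_axis)
  have contV: "continuous_on UNIV (partial i (V i))" for i
    unfolding partial_V[abs_def] by (intro continuous_intros continuous_on_inv_conf contF) auto
  have contV0: "continuous_on UNIV (V i)" for i
    unfolding V_def[abs_def] by (intro continuous_intros continuous_on_inv_conf contF) auto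
  define \<eta> where "\<eta> x = complex_of_real ((cutoff R x)\<^sup>2)" for x :: "real^'n"
  have \<eta>1: "\<eta> differentiable (at x)" for x
    using has_derivative_cutoff_sq[OF R, of x] unfolding differentiable_def \<eta>_def[abs_def] by blast
  have partial_\<eta>: "partial i \<eta> x = complex_of_real (- (4 / R\<^sup>2) * cutoff R x * x $ i)" for i x
    using partial_eq[OF has_derivative_cutoff_sq[OF R], of i x] by (simp add: \<eta>_def[abs_def] inner_axis)
  have partial_prod: "partial i (\<lambda>x. \<eta> x * V i x) x = \<eta> x * partial i (V i) x + partial i \<eta> x * V i x" for i x
    by (rule partial_mult[OF \<eta>1 V1])
  have supp: "\<eta> x = 0" "partial i \<eta> x = 0" if "norm x > R" for x i
    using cutoff_eq_0[OF R that] by (simp_all add: \<eta>_def partial_\<eta>)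
  have cont\<eta>: "continuous_on UNIV \<eta>" "continuous_on UNIV (partial i \<eta>)" for i
    unfolding partial_\<eta>[abs_def] by (simp only: \<eta>_def[abs_def]) (intro continuous_intros continuous_on_cutoff)+
  have int0: "integrable lborel (partial i (\<lambda>x. \<eta> x * V i x))" "(LINT x|lborel. partial i (\<lambda>x. \<eta> x * V i x) x) = 0" for i
  proof -
    have "continuous_on UNIV (partial i (\<lambda>x. \<eta> x * V i x))"
      unfolding partial_prod[abs_def] by (intro continuous_intros cont\<eta> contV contV0)
    moreover have "(\<lambda>x. \<eta> x * V i x) differentiable (at x)" for x
      by (intro differentiable_mult \<eta>1 V1)
    ultimately show "integrable lborel (partial i (\<lambda>x. \<eta> x * V i x))" "(LINT x|lborel. partial i (\<lambda>x. \<eta> x * V i x) x) = 0"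
      using integral_partial_compact_support[of "\<lambda>x. \<eta> x * V i x" i R] supp(1) by auto
  qed
  have int1: "integrable lborel (\<lambda>x. partial i \<eta> x * V i x)" for i
    by (rule integrable_compact_support[where R = R])
       (intro continuous_intros cont\<eta> contV0, simp add: supp)
  have "\<eta> x * (chart_lap F x / complex_of_real (inv_conf x ^ CARD('n))) =
      (\<Sum>i\<in>UNIV. partial i (\<lambda>x. \<eta> x * V i x) x - partial i \<eta> x * V i x)" for x
  proof -
    have "chart_lap F x / complex_of_real (inv_conf x ^ CARD('n)) = (\<Sum>i\<in>UNIV. partial i (V i) x)"
      unfolding V_def[abs_def] using chart_lap_divergence[OF F[of 2], of x] by simp
    then show ?thesis by (simp add: partial_prod sum_distrib_left)
  qed
  then have "(LINT x|lborel. \<eta> x * (chart_lap F x / complex_of_real (inv_conf x ^ CARD('n)))) =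
     (LINT x|lborel. (\<Sum>i\<in>UNIV. partial i (\<lambda>x. \<eta> x * V i x) x - partial i \<eta> x * V i x))" by simp
  also have "\<dots> = (\<Sum>i\<in>UNIV. (LINT x|lborel. partial i (\<lambda>x. \<eta> x * V i x) x - partial i \<eta> x * V i x))"
    by (rule Bochner_Integration.integral_sum) (intro Bochner_Integration.integrable_diff int0 int1)
  also have "\<dots> = (\<Sum>i\<in>UNIV. (LINT x|lborel. - (partial i \<eta> x * V i x)))"
    by (rule sum.cong[OF refl]) (simp add: Bochner_Integration.integral_diff[OF int0(1) int1] int0(2))
  also have "\<dots> = (LINT x|lborel. (\<Sum>i\<in>UNIV. - (partial i \<eta> x * V i x)))"
    by (rule Bochner_Integration.integral_sum[symmetric]) (intro integrable_minus int1)
  also have "\<dots> = (LINT x|lborel. complex_of_real (4 / R\<^sup>2 * cutoff R x * ((inv_conf x)\<^sup>2 / inv_conf x ^ CARD('n))) * euler_deriv F x)"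
    unfolding partial_\<eta> V_def euler_deriv_def
    by (intro Bochner_Integration.integral_cong refl) (simp add: sum_distrib_left sum_divide_distrib mult_ac)
  finally show ?thesis unfolding F_def \<eta>_def .
qed

lemma cutoff_weight_bound:
  fixes x :: "real^'n::finite"
  assumes "R \<ge> 1"
  shows "4 / R\<^sup>2 * cutoff R x * inv_conf x \<le> 4"
proof (cases "norm x \<le> R")
  case True
  have "(norm x)\<^sup>2 \<le> R\<^sup>2" "1 \<le> R\<^sup>2" using True assms by (auto intro: power_mono one_le_power)
  then have "inv_conf x \<le> R\<^sup>2" by (simp add: inv_conf_def)
  then have "cutoff R x * inv_conf x \<le> 1 * R\<^sup>2"
    using cutoff_bounds[of R x] by (intro mult_mono) (auto simp: order_less_imp_le)
  then have "4 / R\<^sup>2 * (cutoff R x * inv_conf x) \<le> 4 / R\<^sup>2 * R\<^sup>2"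
    by (intro mult_left_mono) auto
  then show ?thesis using assms by (simp add: mult.assoc)
next
  case False
  then show ?thesis using assms cutoff_eq_0[of R x] by simp
qed

text \<open>With a cutoff of radius \<open>R\<close> the integral of the Laplacian becomes the boundary term of
  \<open>cutoff_divergence\<close>, which has to be shown to vanish as \<open>R \<rightarrow> \<infinity>\<close>. For \<open>n = 1\<close> the decay of the
  gradient alone gives no integrable majorant. The weight is even, however, so the Euler derivative
  may be replaced by its even part; by \<open>euler_deriv_symmetrized_bound\<close> the integrand is then
  dominated by a multiple of the volume density in every dimension, and it tends to \<open>0\<close>
  pointwise.\<close>
lemma sphere_integral_lap:
  fixes f :: "'n::finite usphere \<Rightarrow> complex"
  assumes f: "f \<in> smooth_on_sphere"
  shows "sphere_integral (sphere_lap f) = 0"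
proof -
  let ?n = "CARD('n)"
  define F where "F = (\<lambda>y. f (stereo 1 y))"
  have F: "C_k k F" for k using smooth_C_k[OF f] by (auto simp: F_def)
  have contR: "continuous_on UNIV (euler_deriv F)"
    unfolding euler_deriv_def[abs_def] using F[of 1] by (auto intro!: continuous_intros)
  obtain C where C: "C \<ge> 0" "\<And>x. norm (euler_deriv F x + euler_deriv F (- x)) \<le> C / inv_conf x"
    using euler_deriv_symmetrized_bound[OF f] unfolding F_def by blast
  define R where "R k = real (Suc k)" for k
  have R: "R k \<ge> 1" "R k > 0" for k by (auto simp: R_def)
  have R_lim: "(\<lambda>k. 1 / (R k)\<^sup>2) \<longlonglongrightarrow> 0"
  proof -
    have "(\<lambda>k. (inverse (real (Suc k)))\<^sup>2) \<longlonglongrightarrow> 0\<^sup>2"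
      by (intro tendsto_power LIMSEQ_inverse_real_of_nat)
    then show ?thesis by (simp add: R_def power_inverse inverse_eq_divide power_one_over)
  qed
  have cutoff_lim: "(\<lambda>k. cutoff (R k) x) \<longlonglongrightarrow> 1" for x :: "real^'n"
  proof -
    have "(\<lambda>k. max 0 (1 - (norm x)\<^sup>2 * (1 / (R k)\<^sup>2))) \<longlonglongrightarrow> max 0 (1 - (norm x)\<^sup>2 * 0)"
      by (intro tendsto_intros R_lim)
    then show ?thesis by (simp add: cutoff_def)
  qed
  define I where "I k = (LINT x|lborel. complex_of_real ((cutoff (R k) x)\<^sup>2) * (chart_lap F x / complex_of_real (inv_conf x ^ ?n)))" for k
  define w where "w k x = complex_of_real (4 / (R k)\<^sup>2 * cutoff (R k) x * ((inv_conf x)\<^sup>2 / inv_conf x ^ ?n))" for k and x :: "real^'n"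
  have cont_lap: "continuous_on UNIV (chart_lap F)"
    using C_k_chart_lap[of 0 F] F[of "Suc (Suc 0)"] by simp
  have lap_eq: "complex_of_real (1 / inv_conf x ^ ?n) * sphere_lap f (stereo 1 x) = chart_lap F x / complex_of_real (inv_conf x ^ ?n)" for x
    by (simp add: sphere_lap_stereo[OF f] F_def)
  have int_lap: "integrable lborel (\<lambda>x. chart_lap F x / complex_of_real (inv_conf x ^ ?n))"
    using integrable_smooth[OF smooth_sphere_lap[OF f]] unfolding lap_eq .
  have "I \<longlonglongrightarrow> (LINT x|lborel. chart_lap F x / complex_of_real (inv_conf x ^ ?n))"
    unfolding I_def[abs_def]
  proof (rule integral_dominated_convergence[where w = "\<lambda>x. norm (chart_lap F x / complex_of_real (inv_conf x ^ ?n))"])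
    show "(\<lambda>x. chart_lap F x / complex_of_real (inv_conf x ^ ?n)) \<in> borel_measurable lborel"
      using int_lap by (rule borel_measurable_integrable)
    show "(\<lambda>x. complex_of_real ((cutoff (R k) x)\<^sup>2) * (chart_lap F x / complex_of_real (inv_conf x ^ ?n))) \<in> borel_measurable lborel" for k
      unfolding measurable_lborel2
      by (intro borel_measurable_continuous_onI continuous_intros continuous_on_cutoff continuous_on_inv_conf cont_lap) auto
    show "integrable lborel (\<lambda>x. norm (chart_lap F x / complex_of_real (inv_conf x ^ ?n)))"
      using int_lap by (rule integrable_norm)
    show "AE x in lborel. (\<lambda>k. complex_of_real ((cutoff (R k) x)\<^sup>2) * (chart_lap F x / complex_of_real (inv_conf x ^ ?n)))
        \<longlonglongrightarrow> chart_lap F x / complex_of_real (inv_conf x ^ ?n)"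
    proof (intro AE_I2)
      fix x :: "real^'n"
      have "(\<lambda>k. complex_of_real ((cutoff (R k) x)\<^sup>2) * (chart_lap F x / complex_of_real (inv_conf x ^ ?n)))
        \<longlonglongrightarrow> complex_of_real (1\<^sup>2) * (chart_lap F x / complex_of_real (inv_conf x ^ ?n))"
        by (intro tendsto_intros cutoff_lim)
      then show "(\<lambda>k. complex_of_real ((cutoff (R k) x)\<^sup>2) * (chart_lap F x / complex_of_real (inv_conf x ^ ?n)))
        \<longlonglongrightarrow> chart_lap F x / complex_of_real (inv_conf x ^ ?n)" by simp
    qed
    show "AE x in lborel. norm (complex_of_real ((cutoff (R k) x)\<^sup>2) * (chart_lap F x / complex_of_real (inv_conf x ^ ?n)))
       \<le> norm (chart_lap F x / complex_of_real (inv_conf x ^ ?n))" for k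
    proof (intro AE_I2)
      fix x :: "real^'n"
      have "norm (complex_of_real ((cutoff (R k) x)\<^sup>2)) \<le> 1"
        using cutoff_bounds[of "R k" x] by (simp add: power_le_one norm_power)
      then show "norm (complex_of_real ((cutoff (R k) x)\<^sup>2) * (chart_lap F x / complex_of_real (inv_conf x ^ ?n)))
         \<le> norm (chart_lap F x / complex_of_real (inv_conf x ^ ?n))"
        unfolding norm_mult by (rule mult_left_le_one_le[rotated 2]) auto
    qed
  qed
  moreover have "I \<longlonglongrightarrow> 0"
  proof -
    have cont_w: "continuous_on UNIV (w k)" for k
      unfolding w_def[abs_def] by (intro continuous_intros continuous_on_cutoff continuous_on_inv_conf) auto
    have w_even: "w k (- x) = w k x" for k x
      by (simp add: w_def cutoff_def inv_conf_def)
    have int_w: "integrable lborel (\<lambda>x. w k x * euler_deriv F x)" for k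
      by (rule integrable_compact_support[where R = "R k"])
         (intro continuous_intros cont_w contR, simp add: w_def cutoff_eq_0[OF R(2)])
    have cont_neg: "continuous_on UNIV (\<lambda>x. euler_deriv F (- x))"
      by (intro continuous_on_compose2[OF contR] continuous_intros) auto
    have int_w': "integrable lborel (\<lambda>x. w k x * euler_deriv F (- x))" for k
      by (rule integrable_compact_support[where R = "R k"])
         (intro continuous_intros cont_w cont_neg, simp add: w_def cutoff_eq_0[OF R(2)])
    \<comment> \<open>The boundary term is averaged with its reflection at the origin.\<close>
    have I: "2 * I k = (LINT x|lborel. w k x * (euler_deriv F x + euler_deriv F (- x)))" for k
    proof -
      have I1: "I k = (LINT x|lborel. w k x * euler_deriv F x)"
        using cutoff_divergence[OF f R(2)[of k]] unfolding I_def w_def F_def .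
      have "(LINT x|lborel. w k (0 + (- 1) *\<^sub>R x) * euler_deriv F (0 + (- 1) *\<^sub>R x)) = (LINT x|lborel. w k x * euler_deriv F x)"
        by (rule integral_affine_isometry[where f = "\<lambda>x. w k x * euler_deriv F x"])
           (intro borel_measurable_continuous_onI continuous_intros cont_w contR, simp)
      then have "I k = (LINT x|lborel. w k x * euler_deriv F (- x))"
        by (simp add: I1 w_even)
      then have "2 * I k = (LINT x|lborel. w k x * euler_deriv F x) + (LINT x|lborel. w k x * euler_deriv F (- x))"
        using I1 by simp
      also have "\<dots> = (LINT x|lborel. w k x * (euler_deriv F x + euler_deriv F (- x)))"
        by (subst Bochner_Integration.integral_add[symmetric, OF int_w int_w']) (simp add: distrib_left)
      finally show ?thesis .
    qed
    have "(\<lambda>k. LINT x|lborel. w k x * (euler_deriv F x + euler_deriv F (- x))) \<longlonglongrightarrow> (LINT x|(lborel :: (real^'n) measure). 0)"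
    proof (rule integral_dominated_convergence[where w = "\<lambda>x. 4 * C * (1 / inv_conf x ^ ?n)"])
      show "(\<lambda>x. w k x * (euler_deriv F x + euler_deriv F (- x))) \<in> borel_measurable lborel" for k
        unfolding measurable_lborel2
        by (intro borel_measurable_continuous_onI continuous_intros cont_w contR cont_neg)
      show "integrable lborel (\<lambda>x::real^'n. 4 * C * (1 / inv_conf x ^ ?n))"
        by (intro integrable_mult_right integrable_volume_density)
      show "AE x in lborel. (\<lambda>k. w k x * (euler_deriv F x + euler_deriv F (- x))) \<longlonglongrightarrow> 0"
      proof (intro AE_I2)
        fix x :: "real^'n"
        have "(\<lambda>k. complex_of_real (4 * (1 / (R k)\<^sup>2) * cutoff (R k) x * ((inv_conf x)\<^sup>2 / inv_conf x ^ ?n)) * (euler_deriv F x + euler_deriv F (- x)))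
          \<longlonglongrightarrow> complex_of_real (4 * 0 * 1 * ((inv_conf x)\<^sup>2 / inv_conf x ^ ?n)) * (euler_deriv F x + euler_deriv F (- x))"
          by (intro tendsto_mult tendsto_of_real tendsto_const R_lim cutoff_lim)
        then show "(\<lambda>k. w k x * (euler_deriv F x + euler_deriv F (- x))) \<longlonglongrightarrow> 0"
          by (simp add: w_def)
      qed
      show "AE x in lborel. norm (w k x * (euler_deriv F x + euler_deriv F (- x))) \<le> 4 * C * (1 / inv_conf x ^ ?n)" for k
      proof (intro AE_I2)
        fix x :: "real^'n"
        have "norm (w k x * (euler_deriv F x + euler_deriv F (- x))) \<le>
           (4 / (R k)\<^sup>2 * cutoff (R k) x * ((inv_conf x)\<^sup>2 / inv_conf x ^ ?n)) * (C / inv_conf x)"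
          using cutoff_bounds(1)[of "R k" x] C(2)[of x] unfolding w_def norm_mult norm_of_real
          by (intro mult_mono) (auto simp: abs_mult order_less_imp_le)
        also have "\<dots> = (4 / (R k)\<^sup>2 * cutoff (R k) x * inv_conf x) * (C * (1 / inv_conf x ^ ?n))"
          by (simp add: power2_eq_square)
        also have "\<dots> \<le> 4 * (C * (1 / inv_conf x ^ ?n))"
          using C(1) by (intro mult_right_mono cutoff_weight_bound R) (auto simp: order_less_imp_le)
        finally show "norm (w k x * (euler_deriv F x + euler_deriv F (- x))) \<le> 4 * C * (1 / inv_conf x ^ ?n)"
          by (simp add: mult.assoc)
      qed
    qed auto
    then have "(\<lambda>k. 2 * I k) \<longlonglongrightarrow> 0" by (simp add: I)
    then have "(\<lambda>k. 1 / 2 * (2 * I k)) \<longlonglongrightarrow> 1 / 2 * 0" by (rule tendsto_mult_left)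
    then show ?thesis by simp
  qed
  ultimately have "(LINT x|lborel. chart_lap F x / complex_of_real (inv_conf x ^ ?n)) = 0"
    using LIMSEQ_unique by blast
  then show ?thesis by (simp only: sphere_integral_eq lap_eq)
qed

section \<open>The adjoint operators on constants\<close>

lemma sphere_integral_add:
  assumes "f \<in> smooth_on_sphere" "g \<in> smooth_on_sphere"
  shows "sphere_integral (\<lambda>p. f p + g p) = sphere_integral f + sphere_integral g"
  unfolding sphere_integral_eq distrib_left
  by (intro Bochner_Integration.integral_add integrable_smooth assms)

lemma sphere_integral_cmult:
  fixes f :: "'a::finite usphere \<Rightarrow> complex"
  shows "sphere_integral (\<lambda>p. c * f p) = c * sphere_integral f"
proof -
  have "complex_of_real (1 / inv_conf x ^ CARD('a)) * (c * f (stereo 1 x))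
      = c * (complex_of_real (1 / inv_conf x ^ CARD('a)) * f (stereo 1 x))" for x
    by (rule mult.left_commute)
  then show ?thesis unfolding sphere_integral_eq by (simp only: integral_mult_right_zero)
qed

text \<open>The coefficient of \<open>s\<^sup>k\<close> in the Gauss hypergeometric series \<open>F(a, b; c; s)\<close>.\<close>
definition hyp_coeff :: "complex \<Rightarrow> complex \<Rightarrow> complex \<Rightarrow> nat \<Rightarrow> complex" where
  "hyp_coeff a b c k = pochhammer a k * pochhammer b k / (fact k * pochhammer c k)"

lemma hyp_coeff_0 [simp]: "hyp_coeff a b c 0 = 1"
  by (simp add: hyp_coeff_def)

lemma hyp_coeff_Suc:
  assumes "c + of_nat k \<noteq> 0"
  shows "(of_nat k + 1) * (c + of_nat k) * hyp_coeff a b c (Suc k) = (a + of_nat k) * (b + of_nat k) * hyp_coeff a b c k"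
proof -
  have "hyp_coeff a b c (Suc k) = (a + of_nat k) * (b + of_nat k) * hyp_coeff a b c k / ((of_nat k + 1) * (c + of_nat k))"
    by (simp add: hyp_coeff_def pochhammer_Suc mult_ac)
  moreover have "of_nat k + 1 \<noteq> (0::complex)" by (metis of_nat_Suc of_nat_eq_0_iff add.commute nat.distinct(1))
  ultimately show ?thesis using assms by simp
qed

text \<open>For generic \<open>\<mu>\<close>, the value of \<open>\<T>\<^sub>2\<^sub>k(\<mu>)\<close> on the constant \<open>1\<close>, in dimension \<open>n\<close>.\<close>
definition T_one :: "complex \<Rightarrow> complex \<Rightarrow> nat \<Rightarrow> complex" where
  "T_one n \<mu> k = hyp_coeff \<mu> (n / 2) (\<mu> - n / 2 + 1) k / 4 ^ k"

lemma generic_denominator: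
  assumes "generic m \<mu>"
  shows "\<mu> - of_nat m / 2 + 1 + of_nat k \<noteq> 0"
proof
  assume *: "\<mu> - of_nat m / 2 + 1 + of_nat k = 0"
  have "indicial (of_nat m) \<mu> (Suc k) = - (4 * of_nat (Suc k) * (\<mu> - of_nat m / 2 + 1 + of_nat k))"
    by (simp add: indicial_def algebra_simps)
  with generic_imp_indicial_nonzero[OF assms, of k] show False by (simp add: *)
qed

text \<open>On constants the equation needs to be multiplied by \<open>1 - t/4\<close> only once, which gives a recursion
  with two terms. Its right-hand side factors as \<open>- (\<mu> + k) (n/2 + k)\<close>, the hypergeometric form.\<close>
lemma T_one_rec:
  assumes "\<mu> - n / 2 + 1 + of_nat k \<noteq> 0"
  shows "indicial n \<mu> (Suc k) * T_one n \<mu> (Suc k)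
    = indicial n \<mu> k / 4 * T_one n \<mu> k - n / 2 * (\<mu> + 2 * of_nat k) * T_one n \<mu> k"
proof -
  have "indicial n \<mu> (Suc k) * T_one n \<mu> (Suc k)
     = - ((of_nat k + 1) * (\<mu> - n / 2 + 1 + of_nat k) * hyp_coeff \<mu> (n / 2) (\<mu> - n / 2 + 1) (Suc k)) / 4 ^ k"
    by (simp add: indicial_def T_one_def field_simps)
  also have "\<dots> = - ((\<mu> + of_nat k) * (n / 2 + of_nat k)) * T_one n \<mu> k"
    unfolding hyp_coeff_Suc[OF assms] by (simp add: T_one_def)
  also have "\<dots> = (indicial n \<mu> k / 4 - n / 2 * (\<mu> + 2 * of_nat k)) * T_one n \<mu> k"
    by (rule arg_cong[where f = "\<lambda>z. z * T_one n \<mu> k"]) (simp add: indicial_def field_simps)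
  finally show ?thesis by (simp add: left_diff_distrib)
qed

text \<open>Multiplication by the second factor \<open>1 - t/4\<close> makes the three-term recursion the difference of
  the two-term recursion at one index and a quarter of it at the preceding index.\<close>
lemma T_one_residual:
  assumes "\<And>k. \<mu> - n / 2 + 1 + of_nat k \<noteq> 0"
  shows "indicial n \<mu> (Suc k) * T_one n \<mu> (Suc k) = - subleading n \<mu> (T_one n \<mu>) (\<lambda>_. 0) k"
proof (cases k)
  case 0
  then show ?thesis using T_one_rec[OF assms, of 0] by (simp add: first_shift_def)
next
  case (Suc m)
  let ?c = "T_one n \<mu>"
  have "indicial n \<mu> (Suc (Suc m)) * ?c (Suc (Suc m)) + subleading n \<mu> ?c (\<lambda>_. 0) (Suc m)
    = second_shift n \<mu> m * ?c m - (indicial n \<mu> (Suc m) * ?c (Suc m)) / 4"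
    unfolding T_one_rec[OF assms, of "Suc m"] subleading.simps
    by (simp add: first_shift_def field_simps)
  also have "\<dots> = 0"
    unfolding T_one_rec[OF assms, of m] by (simp add: second_shift_def field_simps)
  finally show ?thesis by (simp only: Suc eq_neg_iff_add_eq_0)
qed

text \<open>Integration of the recursion kills the Laplacians and leaves the recursion of \<open>T_one\<close>.\<close>
lemma sphere_integral_frobenius_sol:
  fixes f :: "'n::finite usphere \<Rightarrow> complex"
  assumes g: "generic CARD('n) \<mu>" and f: "f \<in> smooth_on_sphere"
  shows "sphere_integral (frobenius_sol \<mu> f k) = T_one (of_nat CARD('n)) \<mu> k * sphere_integral f"
proof (induction k rule: less_induct)
  case (less k)
  let ?n = "of_nat CARD('n) :: complex"
  note sm = smooth_frobenius_sol[OF f, of \<mu>]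
  show ?case
  proof (cases k)
    case 0
    then show ?thesis by (simp add: T_one_def)
  next
    case (Suc m)
    have a: "indicial ?n \<mu> (Suc m) \<noteq> 0" by (rule generic_imp_indicial_nonzero[OF g])
    have "sphere_integral (frobenius_sol \<mu> f (Suc m)) = - (1 / indicial ?n \<mu> (Suc m)) *
       subleading ?n \<mu> (\<lambda>j. sphere_integral (frobenius_sol \<mu> f j)) (\<lambda>_. 0) m"
    proof (cases m)
      case 0
      have "sphere_integral (frobenius_sol \<mu> f (Suc 0)) = - (1 / indicial ?n \<mu> 1) *
         (first_shift ?n \<mu> 0 * sphere_integral f + (-1) * sphere_integral (sphere_lap f))"
        unfolding frobenius_sol.simps sphere_integral_cmult
        by (subst sphere_integral_add)
          (intro smooth_mult smooth_const smooth_sphere_lap f, intro smooth_mult smooth_const smooth_sphere_lap f,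
           simp only: sphere_integral_cmult)
      then show ?thesis by (simp add: 0 sphere_integral_lap[OF f])
    next
      case (Suc j)
      have "sphere_integral (frobenius_sol \<mu> f (Suc (Suc j))) = - (1 / indicial ?n \<mu> (Suc (Suc j))) *
         ((first_shift ?n \<mu> (Suc j) * sphere_integral (frobenius_sol \<mu> f (Suc j)) + (-1) * sphere_integral (sphere_lap (frobenius_sol \<mu> f (Suc j))))
          + second_shift ?n \<mu> j * sphere_integral (frobenius_sol \<mu> f j))"
      proof -
        have s1: "(\<lambda>p. first_shift ?n \<mu> (Suc j) * frobenius_sol \<mu> f (Suc j) p) \<in> smooth_on_sphere"
          "(\<lambda>p. (-1) * sphere_lap (frobenius_sol \<mu> f (Suc j)) p) \<in> smooth_on_sphere"
          "(\<lambda>p. second_shift ?n \<mu> j * frobenius_sol \<mu> f j p) \<in> smooth_on_sphere"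
          by (intro smooth_mult smooth_const smooth_sphere_lap sm)+
        show ?thesis
          unfolding frobenius_sol.simps sphere_integral_cmult
            sphere_integral_add[OF smooth_add[OF s1(1,2)] s1(3)] sphere_integral_add[OF s1(1,2)] ..
      qed
      then show ?thesis by (simp add: Suc sphere_integral_lap[OF sm])
    qed
    also have "subleading ?n \<mu> (\<lambda>j. sphere_integral (frobenius_sol \<mu> f j)) (\<lambda>_. 0) m
        = subleading ?n \<mu> (T_one ?n \<mu>) (\<lambda>_. 0) m * sphere_integral f"
    proof -
      have "sphere_integral (frobenius_sol \<mu> f j) = T_one ?n \<mu> j * sphere_integral f" if "j \<le> m" for j
        using less[of j] Suc that by simp
      then show ?thesis by (cases m) (simp_all del: frobenius_sol.simps add: algebra_simps)
    qed
    also have "subleading ?n \<mu> (T_one ?n \<mu>) (\<lambda>_. 0) m = - (indicial ?n \<mu> (Suc m) * T_one ?n \<mu> (Suc m))"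
      using T_one_residual[OF generic_denominator[OF g], of m] by simp
    finally show ?thesis using a by (simp add: Suc)
  qed
qed

lemma continuous_AE_0:
  fixes h :: "real^'n::finite \<Rightarrow> complex"
  assumes h: "continuous_on UNIV h" and ae: "AE x in lborel. h x = 0"
  shows "h x = 0"
proof (rule ccontr)
  assume x: "h x \<noteq> 0"
  have op: "open {x. h x \<noteq> 0}"
    using h by (intro open_Collect_neq continuous_on_const)
  have "{x. h x \<noteq> 0} \<in> null_sets lborel"
    using ae op by (subst (asm) AE_iff_null) auto
  then have "negligible {x. h x \<noteq> 0}"
    by (simp add: negligible_iff_null_sets null_sets_completionI)
  with op x show False using open_not_negligible by blast
qed

text \<open>The chart \<open>s = 1\<close> misses one point, at which the conclusion follows by continuity.\<close>
lemma sphere_integral_norm_eq_0: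
  fixes g :: "'n::finite usphere \<Rightarrow> complex"
  assumes g: "g \<in> smooth_on_sphere" and 0: "sphere_integral (\<lambda>p. cnj (g p) * g p) = 0"
  shows "g p = 0"
proof -
  let ?h = "\<lambda>x. 1 / inv_conf x ^ CARD('n) * (norm (g (stereo 1 x)))\<^sup>2"
  have eq: "complex_of_real (1 / inv_conf x ^ CARD('n)) * (cnj (g (stereo 1 x)) * g (stereo 1 x)) = complex_of_real (?h x)" for x
    by (simp add: complex_norm_square[symmetric] mult.commute[of "cnj _"])
  have "integrable lborel (\<lambda>x. complex_of_real (?h x))"
    using integrable_smooth[OF smooth_mult[OF smooth_cnj[OF g] g]] unfolding eq .
  then have int: "integrable lborel ?h" by (simp only: complex_of_real_integrable_eq)
  have "complex_of_real (LINT x|lborel. ?h x) = 0"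
    using 0 unfolding sphere_integral_eq eq by (simp only: integral_complex_of_real)
  then have "(LINT x|lborel. ?h x) = 0" by (simp only: of_real_eq_0_iff)
  then have "AE x in lborel. ?h x = 0"
    using int by (subst (asm) integral_nonneg_eq_0_iff_AE) (auto simp: order_less_imp_le)
  then have "AE x in lborel. g (stereo 1 x) = 0" by eventually_elim simp
  moreover have "continuous_on UNIV (\<lambda>x. g (stereo 1 x))"
    by (rule continuous_smooth_chart[OF g]) simp
  ultimately have g1: "g (stereo 1 x) = 0" for x
    by (intro continuous_AE_0[where h = "\<lambda>x. g (stereo 1 x)"])
  have "g (stereo (-1) 0) = 0"
  proof (rule tendsto_unique)
    have "continuous_on UNIV (\<lambda>x. g (stereo (-1) x))"
      by (rule continuous_smooth_chart[OF g]) simp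
    then have "isCont (\<lambda>x. g (stereo (-1) x)) 0"
      by (simp add: continuous_on_eq_continuous_at)
    then show "((\<lambda>x. g (stereo (-1) x)) \<longlongrightarrow> g (stereo (-1) 0)) (at 0)"
      by (simp add: isCont_def)
    have "\<forall>\<^sub>F x in at (0 :: real^'n). x \<noteq> 0" by (simp add: eventually_at_filter)
    then have "\<forall>\<^sub>F x in at (0 :: real^'n). g (stereo (-1) x) = 0"
      by eventually_elim (use g1 stereo_inversion[of _ 1] in metis)
    then show "((\<lambda>x. g (stereo (-1) x)) \<longlongrightarrow> 0) (at 0)"
      by (rule tendsto_eventually)
  qed simp
  then show ?thesis using g1 stereo_cover_pole[of p] by auto
qed

text \<open>Uniqueness of the adjoint: the difference \<open>d\<close> of two candidates is orthogonal to all smooth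
  functions, in particular to its complex conjugate, because the pairing is bilinear.\<close>
lemma formal_adjoint_const:
  fixes c :: complex
  assumes g: "generic CARD('n::finite) \<mu>"
  shows "formal_adjoint (T_op j \<mu>) (\<lambda>_::'n usphere. c) = (\<lambda>_. T_one (of_nat CARD('n)) \<mu> j * c)"
  unfolding formal_adjoint_def
proof (rule the_equality)
  let ?b = "\<lambda>_::'n usphere. T_one (of_nat CARD('n)) \<mu> j * c"
  have *: "sphere_integral (\<lambda>p. T_op j \<mu> f p * c) = sphere_integral (\<lambda>p. f p * ?b p)"
    if "f \<in> smooth_on_sphere" for f :: "'n usphere \<Rightarrow> complex"
  proof -
    have "sphere_integral (\<lambda>p. T_op j \<mu> f p * c) = sphere_integral (\<lambda>p. c * frobenius_sol \<mu> f j p)"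
      unfolding T_op_eq_frobenius_sol[OF g that] by (simp only: mult.commute)
    also have "\<dots> = (T_one (of_nat CARD('n)) \<mu> j * c) * sphere_integral f"
      unfolding sphere_integral_cmult sphere_integral_frobenius_sol[OF g that] by (simp only: mult_ac)
    also have "\<dots> = sphere_integral (\<lambda>p. f p * ?b p)"
      unfolding sphere_integral_cmult[symmetric] by (simp only: mult.commute)
    finally show ?thesis .
  qed
  then show "?b \<in> smooth_on_sphere \<and> (\<forall>f\<in>smooth_on_sphere.
      sphere_integral (\<lambda>p. T_op j \<mu> f p * c) = sphere_integral (\<lambda>p. f p * ?b p))"
    using smooth_const by blast
  fix b :: "'n usphere \<Rightarrow> complex"
  assume b: "b \<in> smooth_on_sphere \<and> (\<forall>f\<in>smooth_on_sphere.
      sphere_integral (\<lambda>p. T_op j \<mu> f p * c) = sphere_integral (\<lambda>p. f p * b p))"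
  define d where "d = (\<lambda>p. b p + (-1) * ?b p)"
  have d: "d \<in> smooth_on_sphere"
    unfolding d_def using b by (intro smooth_add smooth_mult smooth_const) auto
  have "sphere_integral (\<lambda>p. cnj (d p) * d p) =
     sphere_integral (\<lambda>p. cnj (d p) * b p + (-1) * (cnj (d p) * ?b p))"
    by (simp add: d_def algebra_simps)
  also have "\<dots> = sphere_integral (\<lambda>p. cnj (d p) * b p) + (-1) * sphere_integral (\<lambda>p. cnj (d p) * ?b p)"
    unfolding sphere_integral_cmult[symmetric] using b
    by (intro sphere_integral_add smooth_mult smooth_cnj smooth_const d) auto
  also have "sphere_integral (\<lambda>p. cnj (d p) * b p) = sphere_integral (\<lambda>p. cnj (d p) * ?b p)"
    using b *[OF smooth_cnj[OF d]] smooth_cnj[OF d] by auto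
  finally have "sphere_integral (\<lambda>p. cnj (d p) * d p) = 0" by simp
  then have "d p = 0" for p by (rule sphere_integral_norm_eq_0[OF d])
  then show "b = ?b" by (auto simp: d_def fun_eq_iff)
qed

section \<open>Euler's transformation\<close>

text \<open>Here \<open>P\<close> stands for \<open>(1 - X)\<^sup>m\<close>, and the indices \<open>1\<close> and \<open>2\<close> mark first and second derivatives.
  If \<open>F\<close> solves the hypergeometric equation with parameters \<open>a\<close>, \<open>b\<close>, \<open>c\<close>, then \<open>F P\<close> solves the one
  with \<open>c - a\<close>, \<open>c - b\<close>, \<open>c\<close>. After multiplication by \<open>1 - X\<close>, which can be cancelled in an integral
  domain, this is a consequence of the premises by polynomial algebra.\<close>
lemma euler_ode:
  fixes X :: "'a::idom"
  assumes P1: "(1 - X) * P1 = - m * P" and P2: "(1 - X) * P2 = P1 - m * P1"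
    and ode: "X * (1 - X) * F2 + (c - (a + b + 1) * X) * F1 - a * b * F = 0"
    and m: "m = a + b - c" and X: "X \<noteq> 1"
  shows "X * (1 - X) * (F2 * P + 2 * (F1 * P1) + F * P2)
     + (c - (c - a + (c - b) + 1) * X) * (F1 * P + F * P1) - (c - a) * (c - b) * (F * P) = 0"
proof -
  have "(1 - X) * (X * (1 - X) * (F2 * P + 2 * (F1 * P1) + F * P2)
     + (c - (c - a + (c - b) + 1) * X) * (F1 * P + F * P1) - (c - a) * (c - b) * (F * P)) = 0"
    using P1 P2 ode m by algebra
  then show ?thesis using X by simp
qed

definition fps_hyp :: "complex \<Rightarrow> complex \<Rightarrow> complex \<Rightarrow> complex fps" where
  "fps_hyp a b c = Abs_fps (hyp_coeff a b c)"

text \<open>Comparison of coefficients translates the hypergeometric equation into the two-term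
  recursion.\<close>
lemma hyp_coeff_ode_iff:
  fixes F :: "complex fps"
  shows "fps_X * (1 - fps_X) * fps_deriv (fps_deriv F)
      + (fps_const c - (fps_const a + fps_const b + 1) * fps_X) * fps_deriv F - fps_const a * fps_const b * F = 0
    \<longleftrightarrow> (\<forall>k. (of_nat k + 1) * (c + of_nat k) * fps_nth F (Suc k) = (a + of_nat k) * (b + of_nat k) * fps_nth F k)"
proof -
  let ?E = "fps_X * fps_deriv (fps_deriv F) - fps_X * (fps_X * fps_deriv (fps_deriv F))
      + fps_const c * fps_deriv F - fps_const (a + b + 1) * (fps_X * fps_deriv F) - fps_const (a * b) * F"
  have "fps_X * (1 - fps_X) * fps_deriv (fps_deriv F)
      + (fps_const c - (fps_const a + fps_const b + 1) * fps_X) * fps_deriv F - fps_const a * fps_const b * F = ?E"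
    by (simp add: algebra_simps flip: fps_const_add fps_const_mult)
  moreover have "fps_nth ?E k = (of_nat k + 1) * (c + of_nat k) * fps_nth F (Suc k) - (a + of_nat k) * (b + of_nat k) * fps_nth F k" for k
  proof -
    consider "k = 0" | "k = 1" | j where "k = Suc (Suc j)" by (metis One_nat_def not0_implies_Suc)
    then show ?thesis by cases (simp_all add: algebra_simps)
  qed
  ultimately show ?thesis by (simp only: fps_eq_iff fps_zero_nth right_minus_eq)
qed

text \<open>Both sides satisfy the same hypergeometric equation, whose power series solutions are determined
  by their constant term when no \<open>c + k\<close> vanishes.\<close>
lemma euler_transformation:
  assumes c: "\<And>k. c + of_nat k \<noteq> 0" and m: "of_nat m = a + b - c"
  shows "fps_hyp a b c * (1 - fps_X) ^ m = fps_hyp (c - a) (c - b) c"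
proof -
  define F where "F = fps_hyp a b c"
  define P where "P = (1 - fps_X :: complex fps) ^ m"
  define G where "G = F * P"
  have P1: "(1 - fps_X) * fps_deriv P = - of_nat m * P"
  proof -
    have "fps_deriv P = - of_nat m * (1 - fps_X) ^ (m - 1)"
      unfolding P_def fps_deriv_power' by simp
    then show ?thesis by (cases m) (simp_all only: P_def, simp_all)
  qed
  have "fps_deriv ((1 - fps_X) * fps_deriv P) = fps_deriv (- of_nat m * P)" by (simp only: P1)
  then have P2: "(1 - fps_X) * fps_deriv (fps_deriv P) = fps_deriv P - of_nat m * fps_deriv P"
    by (simp add: algebra_simps)
  have F_ode: "fps_X * (1 - fps_X) * fps_deriv (fps_deriv F)
      + (fps_const c - (fps_const a + fps_const b + 1) * fps_X) * fps_deriv F - fps_const a * fps_const b * F = 0"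
    unfolding hyp_coeff_ode_iff using hyp_coeff_Suc[OF c] by (simp add: F_def fps_hyp_def)
  have m': "of_nat m = fps_const a + fps_const b - fps_const c"
    unfolding fps_const_add fps_const_sub m[symmetric] by (simp add: fps_of_nat)
  have X1: "fps_X \<noteq> (1 :: complex fps)"
  proof
    assume "fps_X = (1 :: complex fps)"
    then have "fps_nth fps_X 0 = fps_nth (1 :: complex fps) 0" by simp
    then show False by simp
  qed
  have G1: "fps_deriv G = fps_deriv F * P + F * fps_deriv P"
    by (simp add: G_def algebra_simps)
  have G2: "fps_deriv (fps_deriv G) = fps_deriv (fps_deriv F) * P + 2 * (fps_deriv F * fps_deriv P) + F * fps_deriv (fps_deriv P)"
    unfolding G1 by (simp add: algebra_simps)
  have rec: "\<forall>k. (of_nat k + 1) * (c + of_nat k) * fps_nth G (Suc k) = (c - a + of_nat k) * (c - b + of_nat k) * fps_nth G k"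
    unfolding hyp_coeff_ode_iff[symmetric] G2 unfolding G1
    unfolding G_def fps_const_sub[symmetric] by (rule euler_ode[OF P1 P2 F_ode m' X1])
  have init: "fps_nth G 0 = 1"
    by (simp add: G_def F_def P_def fps_hyp_def fps_power_zeroth)
  have "fps_nth G k = hyp_coeff (c - a) (c - b) c k" for k
  proof (induction k)
    case 0
    show ?case by (simp add: init)
  next
    case (Suc k)
    have nz: "(of_nat k + 1) * (c + of_nat k) \<noteq> 0"
      using c[of k] by (metis mult_eq_0_iff of_nat_Suc of_nat_eq_0_iff add.commute nat.distinct(1))
    have "(of_nat k + 1) * (c + of_nat k) * fps_nth G (Suc k) = (of_nat k + 1) * (c + of_nat k) * hyp_coeff (c - a) (c - b) c (Suc k)"
      using Suc rec by (simp only: hyp_coeff_Suc[OF c])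
    with nz show ?case by (simp only: mult_cancel_left) simp
  qed
  then show ?thesis by (simp add: fps_eq_iff fps_hyp_def G_def F_def P_def)
qed

section \<open>The Q-curvature polynomial\<close>

text \<open>The left-hand side is a coefficient of \<open>F(\<mu>, n/2; c; s) (1 - s)\<^sup>n\<close>, \<open>c = \<mu> - n/2 + 1\<close>. Since
  \<open>\<mu> + n/2 - c = n - 1\<close>, Euler's transformation leaves a single factor \<open>1 - s\<close>.\<close>
lemma holographic_sum:
  assumes c: "\<And>k. \<mu> - of_nat n / 2 + 1 + of_nat k \<noteq> 0" and n: "n \<ge> 1"
  shows "(\<Sum>j=0..Suc M. T_one (of_nat n) \<mu> j * (of_nat (n choose (Suc M - j)) * (-1/4) ^ (Suc M - j)))
    = (hyp_coeff (1 - of_nat n / 2) (\<mu> + 1 - of_nat n) (\<mu> - of_nat n / 2 + 1) (Suc M)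
       - hyp_coeff (1 - of_nat n / 2) (\<mu> + 1 - of_nat n) (\<mu> - of_nat n / 2 + 1) M) / 4 ^ Suc M"
proof -
  let ?n = "of_nat n :: complex"
  let ?c = "\<mu> - ?n / 2 + 1"
  define H where "H = fps_hyp (1 - ?n / 2) (\<mu> + 1 - ?n) ?c"
  have "of_nat (n - 1) = \<mu> + ?n / 2 - ?c" using n by (simp add: of_nat_diff)
  from euler_transformation[OF c this]
  have "fps_hyp \<mu> (?n / 2) ?c * (1 - fps_X) ^ (n - 1) = H"
    by (simp add: H_def algebra_simps)
  moreover have "(1 - fps_X :: complex fps) ^ n = (1 - fps_X) ^ (n - 1) * (1 - fps_X)"
    using n by (cases n) simp_all
  ultimately have eq: "fps_hyp \<mu> (?n / 2) ?c * (1 - fps_X) ^ n = H - H * fps_X"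
    by (simp only: mult.assoc[symmetric] right_diff_distrib mult_1_right)
  have binom: "fps_nth ((1 - fps_X :: complex fps) ^ n) k = of_nat (n choose k) * (-1) ^ k" for k
  proof -
    have "(1 - fps_X :: complex fps) ^ n = (\<Sum>k\<le>n. of_nat (n choose k) * (- fps_X) ^ k)"
      using binomial_ring[of "- fps_X" "1 :: complex fps" n] by simp
    also have "\<dots> = (\<Sum>k\<le>n. fps_const (of_nat (n choose k) * (-1) ^ k) * fps_X ^ k)"
      by (intro sum.cong refl) (simp add: power_minus[of fps_X] fps_of_nat[symmetric] fps_const_power[symmetric] mult_ac
          flip: fps_const_mult fps_const_neg)
    finally show ?thesis
      by (simp add: fps_sum_nth fps_X_power_nth if_distrib[of "\<lambda>z. _ * z"] cong: if_cong)
  qed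
  have "(\<Sum>j=0..Suc M. T_one ?n \<mu> j * (of_nat (n choose (Suc M - j)) * (-1/4) ^ (Suc M - j)))
     = (\<Sum>j=0..Suc M. fps_nth (fps_hyp \<mu> (?n / 2) ?c) j * fps_nth ((1 - fps_X) ^ n) (Suc M - j)) / 4 ^ Suc M"
    unfolding sum_divide_distrib
  proof (rule sum.cong[OF refl])
    fix j assume "j \<in> {0..Suc M}"
    then have four: "(4::complex) ^ Suc M = 4 ^ j * 4 ^ (Suc M - j)" by (simp flip: power_add)
    have "(-1/4::complex) ^ k = (-1) ^ k / 4 ^ k" for k by (simp only: power_divide)
    then show "T_one ?n \<mu> j * (of_nat (n choose (Suc M - j)) * (-1/4) ^ (Suc M - j))
      = fps_nth (fps_hyp \<mu> (?n / 2) ?c) j * fps_nth ((1 - fps_X) ^ n) (Suc M - j) / 4 ^ Suc M"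
      unfolding four by (simp add: T_one_def fps_hyp_def binom)
  qed
  also have "\<dots> = fps_nth (fps_hyp \<mu> (?n / 2) ?c * (1 - fps_X) ^ n) (Suc M) / 4 ^ Suc M"
    by (simp only: fps_mult_nth)
  also have "\<dots> = (fps_nth H (Suc M) - fps_nth H M) / 4 ^ Suc M"
    unfolding eq by simp
  finally show ?thesis by (simp add: H_def fps_hyp_def)
qed

lemma prod_shift_pochhammer:
  "(\<Prod>k=1..N. (z::complex) + of_nat k) = pochhammer (z + 1) N"
  by (induction N) (simp_all add: pochhammer_Suc prod.nat_ivl_Suc' mult.commute add_ac)

lemma prod_diff_pochhammer:
  "(\<Prod>j=1..M. (z::complex) - of_nat j) = (-1) ^ M * pochhammer (1 - z) M"
  by (induction M) (simp_all add: pochhammer_Suc prod.nat_ivl_Suc' algebra_simps)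

definition Q_poly :: "complex \<Rightarrow> nat \<Rightarrow> complex poly" where
  "Q_poly n N = smult ((-1) ^ (N - 1) * (\<Prod>j=0..N-1. n / 2 - of_nat j))
     ([:0, 1:] * (\<Prod>j=1..N-1. [:- of_nat N - of_nat j, 1:]))"

lemma poly_Q_poly:
  "poly (Q_poly n N) l = (-1) ^ (N - 1) * (\<Prod>j=0..N-1. n / 2 - of_nat j)
    * l * (\<Prod>j=1..N-1. l - of_nat N - of_nat j)"
  by (simp add: Q_poly_def poly_prod algebra_simps)

text \<open>For \<open>N = M + 1\<close> the difference of the two coefficients in \<open>holographic_sum\<close> is a common factor
  times \<open>(1 - n/2 + M) (\<lambda> - 1 - M) - (M + 1) (\<lambda> + n/2 - 1 - M) = - (n/2) \<lambda>\<close>.\<close>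
lemma Q_value:
  fixes l :: complex and n N :: nat
  assumes c: "\<And>k. \<mu> - of_nat n / 2 + 1 + of_nat k \<noteq> 0" and n: "n \<ge> 1" and N: "N \<ge> 1"
    and \<mu>: "\<mu> = l + of_nat n - 2 * of_nat N"
  shows "- (2 ^ (2 * N)) * fact N * (\<Prod>k=1..N. l + of_nat n / 2 - 2 * of_nat N + of_nat k)
     * (\<Sum>j=0..N. T_one (of_nat n) \<mu> j * (of_nat (n choose (N - j)) * (-1/4) ^ (N - j)))
    = poly (Q_poly (of_nat n) N) l"
proof -
  obtain M where M: "N = Suc M" using N by (cases N) auto
  let ?n = "of_nat n :: complex"
  define a where "a = 1 - ?n / 2"
  define b where "b = \<mu> + 1 - ?n"
  define c' where "c' = \<mu> - ?n / 2 + 1"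
  have nz: "pochhammer c' M \<noteq> 0" "c' + of_nat M \<noteq> 0"
    using c unfolding pochhammer_eq_0_iff c'_def by (auto simp: eq_neg_iff_add_eq_0)
  have prod: "(\<Prod>k=1..N. l + ?n / 2 - 2 * of_nat N + of_nat k) = pochhammer c' N"
    unfolding prod_shift_pochhammer c'_def \<mu> by (rule arg_cong[where f = "\<lambda>z. pochhammer z N"]) simp
  have four: "(2::complex) ^ (2 * N) = 4 ^ N" by (simp add: power_mult)
  have "fact N * pochhammer c' N * (hyp_coeff a b c' (Suc M) - hyp_coeff a b c' M)
     = pochhammer a M * pochhammer b M * ((a + of_nat M) * (b + of_nat M) - (of_nat M + 1) * (c' + of_nat M))"
  proof -
    have "fact N * pochhammer c' N * (hyp_coeff a b c' (Suc M) - hyp_coeff a b c' M)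
      = fact M * pochhammer c' M * ((of_nat M + 1) * (c' + of_nat M) * hyp_coeff a b c' (Suc M)
           - (of_nat M + 1) * (c' + of_nat M) * hyp_coeff a b c' M)"
      unfolding M pochhammer_Suc fact_Suc by (simp add: algebra_simps)
    also have "\<dots> = (fact M * pochhammer c' M * hyp_coeff a b c' M)
        * ((a + of_nat M) * (b + of_nat M) - (of_nat M + 1) * (c' + of_nat M))"
      unfolding hyp_coeff_Suc[OF nz(2)] by (simp only: algebra_simps)
    also have "fact M * pochhammer c' M * hyp_coeff a b c' M = pochhammer a M * pochhammer b M"
      using nz(1) by (simp add: hyp_coeff_def)
    finally show ?thesis .
  qed
  also have "(a + of_nat M) * (b + of_nat M) - (of_nat M + 1) * (c' + of_nat M) = - (?n / 2) * l"
    by (simp add: a_def b_def c'_def \<mu> M field_simps)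
  finally have key: "fact N * pochhammer c' N * (hyp_coeff a b c' (Suc M) - hyp_coeff a b c' M)
     = pochhammer a M * pochhammer b M * (- (?n / 2) * l)" .
  have "- (2 ^ (2 * N)) * fact N * (\<Prod>k=1..N. l + ?n / 2 - 2 * of_nat N + of_nat k)
     * (\<Sum>j=0..N. T_one ?n \<mu> j * (of_nat (n choose (N - j)) * (-1/4) ^ (N - j)))
    = - (fact N * pochhammer c' N * (hyp_coeff a b c' (Suc M) - hyp_coeff a b c' M))"
    unfolding prod four unfolding M holographic_sum[OF c n] a_def b_def c'_def by simp
  also have "\<dots> = ?n / 2 * l * (pochhammer a M * pochhammer b M)"
    unfolding key by simp
  also have "\<dots> = poly (Q_poly ?n N) l"
  proof -
    have p1: "(\<Prod>j=0..M. ?n / 2 - of_nat j) = ?n / 2 * ((-1) ^ M * pochhammer a M)"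
      unfolding prod_diff_pochhammer[symmetric] a_def by (subst prod.atLeast_Suc_atMost) simp_all
    have "pochhammer b M = pochhammer (- (of_nat N - l + of_nat M)) M"
      by (rule arg_cong[where f = "\<lambda>z. pochhammer z M"]) (simp add: b_def \<mu> M)
    also have "\<dots> = (-1) ^ M * pochhammer (1 - (l - of_nat N)) M"
      unfolding pochhammer_minus by (simp add: algebra_simps)
    finally have p2: "(\<Prod>j=1..M. l - of_nat N - of_nat j) = pochhammer b M"
      unfolding prod_diff_pochhammer by simp
    have sq: "(-1) ^ M * (-1) ^ M = (1::complex)" by (simp flip: power_add)
    show ?thesis
      unfolding poly_Q_poly unfolding M diff_Suc_1 p1 p2[unfolded M] using sq by (simp add: mult_ac)
  qed
  finally show ?thesis .
qed

theorem corollary4p1: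
  fixes N :: nat and p :: "'n::finite usphere" and l :: complex
  assumes "N \<ge> 1"
  shows "poly (Q_res N p) l =
    (-1) ^ (N - 1) * (\<Prod>j=0..N-1. of_nat CARD('n) / 2 - of_nat j)
    * l * (\<Prod>j=1..N-1. l - of_nat N - of_nat j)"
proof -
  let ?n = "CARD('n)"
  have val: "- (2 ^ (2 * N)) * fact N
       * (\<Prod>k=1..N. l + of_nat ?n / 2 - 2 * of_nat N + of_nat k)
       * (\<Sum>j=0..N. formal_adjoint (T_op j (l + of_nat ?n - 2 * of_nat N))
                      (\<lambda>p'. complex_of_real (holographic_coeff (N - j) p')) p)
      = poly (Q_poly (of_nat ?n) N) l"
    if g: "generic ?n (l + of_nat ?n - 2 * of_nat N)" for l
  proof -
    have "formal_adjoint (T_op j (l + of_nat ?n - 2 * of_nat N))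
            (\<lambda>p'. complex_of_real (holographic_coeff (N - j) p')) p
      = T_one (of_nat ?n) (l + of_nat ?n - 2 * of_nat N) j * (of_nat (?n choose (N - j)) * (-1/4) ^ (N - j))" for j
      unfolding holographic_coeff_eq formal_adjoint_const[OF g] by simp
    then show ?thesis
      using Q_value[OF generic_denominator[OF g] _ assms refl] by simp
  qed
  have "Q_res N p = Q_poly (of_nat ?n) N"
    unfolding Q_res_def
  proof (rule the_equality)
    show "\<forall>l. generic ?n (l + of_nat ?n - 2 * of_nat N) \<longrightarrow> poly (Q_poly (of_nat ?n) N) l =
      - (2 ^ (2 * N)) * fact N
       * (\<Prod>k=1..N. l + of_nat ?n / 2 - 2 * of_nat N + of_nat k)
       * (\<Sum>j=0..N. formal_adjoint (T_op j (l + of_nat ?n - 2 * of_nat N))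
                      (\<lambda>p'. complex_of_real (holographic_coeff (N - j) p')) p)"
      using val by simp
  next
    fix q assume q: "\<forall>l. generic ?n (l + of_nat ?n - 2 * of_nat N) \<longrightarrow> poly q l =
      - (2 ^ (2 * N)) * fact N
       * (\<Prod>k=1..N. l + of_nat ?n / 2 - 2 * of_nat N + of_nat k)
       * (\<Sum>j=0..N. formal_adjoint (T_op j (l + of_nat ?n - 2 * of_nat N))
                      (\<lambda>p'. complex_of_real (holographic_coeff (N - j) p')) p)"
    show "q = Q_poly (of_nat ?n) N"
    proof (rule ccontr)
      assume "q \<noteq> Q_poly (of_nat ?n) N"
      then have fin: "finite {l. poly (q - Q_poly (of_nat ?n) N) l = 0}"
        by (intro poly_roots_finite) simp
      \<comment> \<open>The parameter is generic at every non-real \<open>l\<close>, so the difference vanishes at all \<open>\<i> (k + 1)\<close>.\<close>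
      have "(\<lambda>k. \<i> * of_nat (Suc k)) ` (UNIV :: nat set) \<subseteq> {l. poly (q - Q_poly (of_nat ?n) N) l = 0}"
      proof (clarify)
        fix k
        have "generic ?n (\<i> * of_nat (Suc k) + of_nat ?n - 2 * of_nat N)"
          unfolding generic_def by (auto simp: complex_eq_iff)
        then show "poly (q - Q_poly (of_nat ?n) N) (\<i> * of_nat (Suc k)) = 0"
          using q val by simp
      qed
      moreover have "inj (\<lambda>k. \<i> * complex_of_nat (Suc k))"
        by (auto simp: inj_on_def)
      then have "infinite (range (\<lambda>k. \<i> * complex_of_nat (Suc k)))"
        using finite_imageD infinite_UNIV_nat by blast
      ultimately show False using fin finite_subset by blast
    qed
  qed
  then show ?thesis by (simp only: poly_Q_poly)
qed

end
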